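(* There exist an open nonempty set $\Sigma\subset\mathcal{S}$ and a continuous function $\bar\alpha:\Sigma\to(0,2)$ such that \[ \Pi=\{(V,\bar\alpha(V)):\ V\in\Sigma\}. \]
   Context: Let $d\ge 2$ and let $\mathbb{S}^{d-1}$ be the unit sphere of $\mathbb{R}^d$. Fix $\xi^+\neq\xi^-$ in $\mathbb{S}^{d-1}$ and a real number $V_{\min}>0$. Let $\mathcal{S}$ be the set of $V\in C^2(\mathbb{S}^{d-1})$ such that $V(s)\ge V(\xi^\pm)=V_{\min}$ for all $s\in\mathbb{S}^{d-1}$ and there exist $\delta>0$, $\mu>0$ such that $|s-\xi^\pm|<\delta$ implies $V(s)-V(\xi^\pm)\ge\mu|s-\xi^\pm|^2$ (for $s\in\mathbb{S}^{d-1}$); $\mathcal{S}$ is a metric space with the $C^2$ distance. Let $\mathcal{P}=\{(V,\alpha)\in C^2(\mathbb{S}^{d-1})\times(0,2): V\in\mathcal{S}\}$, equipped with the product distance. An element $(V,\alpha)\in\mathcal{P}$ is identified with the potential $V(x)=V(x/|x|)/|x|^\alpha$ on $\mathbb{R}^d\setminus\{0\}$ (with value $+\infty$ at $0$), and is often denoted simply by $V$. For $a<b$ and $x\in H^1((a,b);\mathbb{R}^d)$ the (possibly infinite) action is $\mathcal{A}([a,b];x)=\int_a^b\left(\frac12|\dot x|^2+V(x)\right)dt$. Define $c(V)=\inf\{\mathcal{A}([a,b];x): a<b,\ x\in H^1((a,b);\mathbb{R}^d),\ x(a)=\xi^-,\ x(b)=\xi^+\}$, $\mathrm{In}=\{V\in\mathcal{P}: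 c(V)=4\sqrt{2V_{\min}}/(2-\alpha)\}$, $\mathrm{Out}=\{V\in\mathcal{P}: c(V)<4\sqrt{2V_{\min}}/(2-\alpha)\}$, and $\Pi=\partial\,\mathrm{In}\cap\partial\,\mathrm{Out}$ (boundaries in $\mathcal{P}$). *)

theory Defs
  imports "HOL-Analysis.Analysis"
begin

definition blin_deriv :: "('a::real_normed_vector \<Rightarrow> 'b::real_normed_vector) \<Rightarrow> 'a \<Rightarrow> 'a \<Rightarrow>\<^sub>L 'b" where
  "blin_deriv f x = Blinfun (frechet_derivative f (at x))"

definition C2_on :: "'a::real_normed_vector set \<Rightarrow> ('a \<Rightarrow> 'b::real_normed_vector) \<Rightarrow> bool" where
  "C2_on U f \<longleftrightarrow> open U \<and> (\<forall>x\<in>U. f differentiable (at x)) \<and>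
     (\<forall>x\<in>U. blin_deriv f differentiable (at x)) \<and> continuous_on U (blin_deriv (blin_deriv f))"

definition hom0 :: "('a::real_normed_vector \<Rightarrow> real) \<Rightarrow> 'a \<Rightarrow> real" where
  "hom0 V x = V (x /\<^sub>R norm x)"

lemma blin_deriv_eq:
  assumes "(f has_derivative blinfun_apply L) (at x)"
  shows "blin_deriv f x = L"
  using frechet_derivative_at[OF assms] by (metis blin_deriv_def blinfun_apply_inverse)

lemma const_off_0:
  fixes f :: "'a::real_normed_vector \<Rightarrow> 'b::real_normed_vector"
  assumes "\<And>x. x \<noteq> 0 \<Longrightarrow> f x = k" and "x \<noteq> 0"
  shows "(f has_derivative blinfun_apply 0) (at x)"
proof -
  have "((\<lambda>_. k) has_derivative blinfun_apply 0) (at x)"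
    by (simp add: zero_blinfun.rep_eq)
  then show ?thesis
    by (rule has_derivative_transform_within_open[where s = "- {0}"]) (use assms in auto)
qed

text \<open>
  A function on the sphere is encoded as a function that is undefined off the sphere. It is
  of class \<open>C\<^sup>2\<close> if and only if its extension to the punctured space that is constant along rays
  (positively homogeneous of degree \<open>0\<close>) is of class \<open>C\<^sup>2\<close>.
\<close>

typedef (overloaded) 'a C2_sphere =
  "{V :: 'a::euclidean_space \<Rightarrow> real. V \<in> extensional (sphere 0 1) \<and> C2_on (- {0}) (hom0 V)}"
  morphisms C2_fun C2_abs
proof -
  let ?V = "restrict (\<lambda>_. 0) (sphere 0 1) :: 'a \<Rightarrow> real"
  have 0: "hom0 ?V x = 0" if "x \<noteq> 0" for x
    using that by (simp add: hom0_def)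
  have 1: "(hom0 ?V has_derivative blinfun_apply 0) (at x)" if "x \<noteq> 0" for x
    using const_off_0[OF 0 that] .
  have D1: "blin_deriv (hom0 ?V) x = 0" if "x \<noteq> 0" for x
    using blin_deriv_eq[OF 1[OF that]] .
  have 2: "(blin_deriv (hom0 ?V) has_derivative blinfun_apply 0) (at x)" if "x \<noteq> 0" for x
    using const_off_0[OF D1 that] .
  have D2: "blin_deriv (blin_deriv (hom0 ?V)) x = 0" if "x \<noteq> 0" for x
    using blin_deriv_eq[OF 2[OF that]] .
  have "continuous_on (- {0}) (blin_deriv (blin_deriv (hom0 ?V)))"
    by (rule continuous_on_eq[of _ "\<lambda>_. 0"]) (simp_all add: D2)
  with 1 2 have "C2_on (- {0}) (hom0 ?V)"
    by (auto simp: C2_on_def differentiable_def)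
  then show ?thesis
    by (intro exI[of _ ?V]) auto
qed

definition sup_sphere :: "('a::euclidean_space \<Rightarrow> 'b::real_normed_vector) \<Rightarrow> real" where
  "sup_sphere f = (SUP s\<in>sphere 0 1. norm (f s))"

lemma sphere_nonempty: "sphere (0::'a::euclidean_space) 1 \<noteq> {}"
  by simp

lemma sup_sphere_upper:
  assumes "continuous_on (sphere (0::'a::euclidean_space) 1) f" "s \<in> sphere 0 1"
  shows "norm (f s) \<le> sup_sphere f"
proof -
  have "compact ((\<lambda>s. norm (f s)) ` sphere (0::'a) 1)"
    by (intro compact_continuous_image continuous_intros assms) simp
  then show ?thesis
    unfolding sup_sphere_def
    by (intro cSUP_upper assms bounded_imp_bdd_above compact_imp_bounded)
qed

lemma sup_sphere_triangle:
  assumes "continuous_on (sphere (0::'a::euclidean_space) 1) f"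
    and "continuous_on (sphere 0 1) g" and "continuous_on (sphere 0 1) h"
  shows "sup_sphere (\<lambda>s. f s - g s) \<le> sup_sphere (\<lambda>s. f s - h s) + sup_sphere (\<lambda>s. g s - h s)"
  unfolding sup_sphere_def[of "\<lambda>s. f s - g s"]
proof (rule cSUP_least[OF sphere_nonempty])
  fix s :: 'a assume s: "s \<in> sphere 0 1"
  have "norm (f s - g s) \<le> norm (f s - h s) + norm (g s - h s)"
    by (metis dist_norm dist_triangle2)
  also have "\<dots> \<le> sup_sphere (\<lambda>s. f s - h s) + sup_sphere (\<lambda>s. g s - h s)"
    by (intro add_mono sup_sphere_upper continuous_intros assms s)
  finally show "norm (f s - g s) \<le> \<dots>" .
qed

lemma sup_sphere_nonneg:
  assumes "continuous_on (sphere (0::'a::euclidean_space) 1) f"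
  shows "0 \<le> sup_sphere f"
proof -
  obtain s :: 'a where "s \<in> sphere 0 1" using sphere_nonempty by blast
  then show ?thesis using sup_sphere_upper[OF assms] norm_ge_zero order_trans by metis
qed

lemma C2_sphere_continuous:
  fixes V :: "'a::euclidean_space C2_sphere"
  shows "continuous_on (sphere 0 1) (C2_fun V)"
    and "continuous_on (sphere 0 1) (blin_deriv (hom0 (C2_fun V)))"
    and "continuous_on (sphere 0 1) (blin_deriv (blin_deriv (hom0 (C2_fun V))))"
proof -
  have C: "C2_on (- {0}) (hom0 (C2_fun V))" using C2_fun[of V] by simp
  have sub: "sphere (0::'a) 1 \<subseteq> - {0}" by auto
  have "continuous_on (sphere 0 1) (hom0 (C2_fun V))"
    using C sub unfolding C2_on_def
    by (intro continuous_at_imp_continuous_on ballI differentiable_imp_continuous_within) auto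
  then show "continuous_on (sphere 0 1) (C2_fun V)"
    by (rule continuous_on_eq) (simp add: hom0_def)
  show "continuous_on (sphere 0 1) (blin_deriv (hom0 (C2_fun V)))"
    using C sub unfolding C2_on_def
    by (intro continuous_at_imp_continuous_on ballI differentiable_imp_continuous_within) auto
  show "continuous_on (sphere 0 1) (blin_deriv (blin_deriv (hom0 (C2_fun V))))"
    using C sub unfolding C2_on_def by (blast intro: continuous_on_subset)
qed

text \<open>
  The \<open>C\<^sup>2\<close> distance. At a point \<open>s\<close> of the sphere, the first derivative of the degree \<open>0\<close>
  extension vanishes on the normal direction \<open>s\<close> and is the differential of the function on the
  tangent space; its second derivative is the Riemannian Hessian on the tangent space, and its
  entries involving the normal direction are given by the first derivative. Hence this is
  the usual \<open>C\<^sup>2\<close> distance of the compact manifold (up to equivalence of norms).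
\<close>

instantiation C2_sphere :: (euclidean_space) metric_space
begin

definition dist_C2_sphere :: "'a C2_sphere \<Rightarrow> 'a C2_sphere \<Rightarrow> real" where
  "dist V W =
     sup_sphere (\<lambda>s. C2_fun V s - C2_fun W s) +
     sup_sphere (\<lambda>s. blin_deriv (hom0 (C2_fun V)) s - blin_deriv (hom0 (C2_fun W)) s) +
     sup_sphere (\<lambda>s. blin_deriv (blin_deriv (hom0 (C2_fun V))) s -
       blin_deriv (blin_deriv (hom0 (C2_fun W))) s)"

definition uniformity_C2_sphere :: "('a C2_sphere \<times> 'a C2_sphere) filter" where
  "(uniformity :: ('a C2_sphere \<times> 'a C2_sphere) filter) = (INF e\<in>{0 <..}. principal {(V, W). dist V W < e})"

definition open_C2_sphere :: "'a C2_sphere set \<Rightarrow> bool" where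
  "open (U :: 'a C2_sphere set) \<longleftrightarrow> (\<forall>V\<in>U. \<forall>\<^sub>F (V', W) in uniformity. V' = V \<longrightarrow> W \<in> U)"

instance
proof
  fix V W Z :: "'a C2_sphere"
  show "dist V W \<le> dist V Z + dist W Z"
    using sup_sphere_triangle[OF C2_sphere_continuous(1)[of V] C2_sphere_continuous(1)[of W]
        C2_sphere_continuous(1)[of Z]]
      sup_sphere_triangle[OF C2_sphere_continuous(2)[of V] C2_sphere_continuous(2)[of W]
        C2_sphere_continuous(2)[of Z]]
      sup_sphere_triangle[OF C2_sphere_continuous(3)[of V] C2_sphere_continuous(3)[of W]
        C2_sphere_continuous(3)[of Z]]
    unfolding dist_C2_sphere_def by linarith
  have c: "0 \<le> sup_sphere (\<lambda>s. C2_fun V s - C2_fun W s)"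
    "0 \<le> sup_sphere (\<lambda>s. blin_deriv (hom0 (C2_fun V)) s - blin_deriv (hom0 (C2_fun W)) s)"
    "0 \<le> sup_sphere (\<lambda>s. blin_deriv (blin_deriv (hom0 (C2_fun V))) s -
       blin_deriv (blin_deriv (hom0 (C2_fun W))) s)"
    by (intro sup_sphere_nonneg continuous_intros C2_sphere_continuous)+
  show "dist V W = 0 \<longleftrightarrow> V = W"
  proof
    assume "dist V W = 0"
    with c have 0: "sup_sphere (\<lambda>s. C2_fun V s - C2_fun W s) = 0"
      unfolding dist_C2_sphere_def by linarith
    have "C2_fun V s = C2_fun W s" if "s \<in> sphere 0 1" for s
      using sup_sphere_upper[of "\<lambda>s. C2_fun V s - C2_fun W s", OF _ that] 0
      by (simp add: continuous_on_diff C2_sphere_continuous)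
    then have "C2_fun V = C2_fun W"
      using C2_fun[of V] C2_fun[of W] by (intro extensionalityI[of _ "sphere 0 1"]) auto
    then show "V = W" by (simp add: C2_fun_inject)
  qed (simp add: dist_C2_sphere_def sup_sphere_def)
qed (rule uniformity_C2_sphere_def open_C2_sphere_def)+

end

text \<open>
  The parameters \<open>xm\<close>, \<open>xp\<close>, \<open>m\<close> below stand for \<open>\<xi>\<^sup>-\<close>, \<open>\<xi>\<^sup>+\<close> and \<open>V\<^sub>m\<^sub>i\<^sub>n\<close>.
\<close>

definition pot_S :: "'a::euclidean_space \<Rightarrow> 'a \<Rightarrow> real \<Rightarrow> 'a C2_sphere set" where
  "pot_S xm xp m = {V. \<forall>\<xi>\<in>{xm, xp}.
      C2_fun V \<xi> = m \<and> (\<forall>s\<in>sphere 0 1. C2_fun V s \<ge> C2_fun V \<xi>) \<and>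
      (\<exists>\<delta>>0. \<exists>\<mu>>0. \<forall>s\<in>sphere 0 1. norm (s - \<xi>) < \<delta> \<longrightarrow>
         C2_fun V s - C2_fun V \<xi> \<ge> \<mu> * (norm (s - \<xi>))\<^sup>2)}"

definition pot_P :: "'a::euclidean_space \<Rightarrow> 'a \<Rightarrow> real \<Rightarrow> ('a C2_sphere \<times> real) set" where
  "pot_P xm xp m = pot_S xm xp m \<times> {0<..<2}"

text \<open>
  Only used for functions that are positive on the sphere, so the truncation of negative
  numbers by \<open>ennreal\<close> plays no role.
\<close>

fun potential :: "'a::euclidean_space C2_sphere \<times> real \<Rightarrow> 'a \<Rightarrow> ennreal" where
  "potential (V, \<alpha>) x =
     (if x = 0 then \<infinity> else ennreal (C2_fun V (x /\<^sub>R norm x) / norm x powr \<alpha>))"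

text \<open>
  \<open>H\<^sup>1\<close> paths on an interval, in their absolutely continuous representative: the path \<open>x\<close> is a
  primitive of a square integrable function \<open>v\<close>, which is its weak derivative. On a bounded
  interval \<open>v\<close> is also integrable, and it is unique up to null sets.
\<close>

definition has_L2_deriv ::
  "real \<Rightarrow> real \<Rightarrow> (real \<Rightarrow> 'a::euclidean_space) \<Rightarrow> (real \<Rightarrow> 'a) \<Rightarrow> bool" where
  "has_L2_deriv a b x v \<longleftrightarrow>
     v \<in> borel_measurable (lebesgue_on {a..b}) \<and>
     integrable (lebesgue_on {a..b}) (\<lambda>t. (norm (v t))\<^sup>2) \<and>
     (\<forall>t\<in>{a..b}. x t = x a + (LINT \<tau>|lebesgue_on {a..t}. v \<tau>))"

definition H1 :: "real \<Rightarrow> real \<Rightarrow> (real \<Rightarrow> 'a::euclidean_space) set" where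
  "H1 a b = {x. \<exists>v. has_L2_deriv a b x v}"

definition L2_deriv :: "real \<Rightarrow> real \<Rightarrow> (real \<Rightarrow> 'a::euclidean_space) \<Rightarrow> real \<Rightarrow> 'a" where
  "L2_deriv a b x = (SOME v. has_L2_deriv a b x v)"

definition action ::
  "'a::euclidean_space C2_sphere \<times> real \<Rightarrow> real \<Rightarrow> real \<Rightarrow> (real \<Rightarrow> 'a) \<Rightarrow> ennreal" where
  "action p a b x =
     (\<integral>\<^sup>+t. (ennreal ((norm (L2_deriv a b x t))\<^sup>2 / 2) + potential p (x t)) \<partial>lebesgue_on {a..b})"

definition min_action :: "'a::euclidean_space \<Rightarrow> 'a \<Rightarrow> 'a C2_sphere \<times> real \<Rightarrow> ennreal" where
  "min_action xm xp p =
     Inf {action p a b x | a b x. a < b \<and> x \<in> H1 a b \<and> x a = xm \<and> x b = xp}"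

definition In_set :: "'a::euclidean_space \<Rightarrow> 'a \<Rightarrow> real \<Rightarrow> ('a C2_sphere \<times> real) set" where
  "In_set xm xp m = {(V, \<alpha>) \<in> pot_P xm xp m.
     min_action xm xp (V, \<alpha>) = ennreal (4 * sqrt (2 * m) / (2 - \<alpha>))}"

definition Out_set :: "'a::euclidean_space \<Rightarrow> 'a \<Rightarrow> real \<Rightarrow> ('a C2_sphere \<times> real) set" where
  "Out_set xm xp m = {(V, \<alpha>) \<in> pot_P xm xp m.
     min_action xm xp (V, \<alpha>) < ennreal (4 * sqrt (2 * m) / (2 - \<alpha>))}"

definition Pi_set :: "'a::euclidean_space \<Rightarrow> 'a \<Rightarrow> real \<Rightarrow> ('a C2_sphere \<times> real) set" where
  "Pi_set xm xp m =
     (top_of_set (pot_P xm xp m) frontier_of In_set xm xp m) \<inter>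
     (top_of_set (pot_P xm xp m) frontier_of Out_set xm xp m)"

end

theory Submission
  imports Defs
begin

text \<open>
Write \<open>b = 1 - \<alpha> / 2\<close> and \<open>m\<close> for the common minimum of the potential on the sphere. The substitution
\<open>\<rho> = |x|\<^sup>b\<close> turns the Jacobi length \<open>\<surd>(2 V(x)) |dx|\<close>, which bounds the action from below and whose
infimum over paths with given ends is the infimum of the action, into \<open>\<surd>2 / b\<close> times the length of
the cone metric \<open>V(s) (d\<rho>\<^sup>2 + b\<^sup>2 \<rho>\<^sup>2 ds\<^sup>2)\<close>. The threshold \<open>4 \<surd>(2 m) / (2 - \<alpha>)\<close> is the length of the
broken path that goes straight into the vertex and straight out again. It is an upper bound for the
minimal action, so In and Out partition the parameter set, and being In means that no path beats
the passage through the vertex.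

Membership in In has a dual description on the sphere alone, and the whole argument rests on it:
\<open>(V, \<alpha>)\<close> is In if and only if there is \<open>f\<close> on the sphere with \<open>f(\<xi>\<^sup>\<plusminus>) = \<plusminus> \<surd>m\<close> and
\<open>f\<^sup>2 + |\<nabla>f|\<^sup>2 / b\<^sup>2 \<le> V\<close>.
If \<open>f\<close> exists, then \<open>U(x) = (\<surd>2 / b) |x|\<^sup>b f(x / |x|)\<close> satisfies \<open>|\<nabla>U|\<^sup>2 \<le> 2 V\<close>, so its increment along a
path is at most the action, and its total increment is the threshold
(\<open>subsolution_imp_min_action_ge\<close>). Conversely, if no path beats the vertex, a Busemann-type function
of the ray through \<open>\<xi>\<^sup>-\<close> is homogeneous of degree \<open>b\<close>, and its restriction to the sphere, suitably
normalized and truncated, is such an \<open>f\<close> (\<open>min_action_ge_imp_subsolution\<close>). Gradients are replaced by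
pointwise asymptotic Lipschitz constants; this is stable under minimum and maximum and avoids any
differentiability almost everywhere.

The dual inequality becomes weaker as \<open>b\<close> grows, so for each \<open>V\<close> the exponents in In form an initial
interval of \<open>(0, 2)\<close>. Multiplying \<open>f\<close> by a constant below \<open>1\<close> and passing to the limit shows that In is
closed (\<open>In_closed\<close>), and a path that avoids the origin has bounded action while the threshold blows
up as \<open>\<alpha>\<close> tends to \<open>2\<close>, so each nonempty interval has a largest element \<open>\<alpha>\<^sub>V < 2\<close>. The heart of the
matter is that \<open>(V, \<alpha>)\<close> is interior to In whenever \<open>\<alpha> < \<alpha>\<^sub>V\<close> (\<open>In_stable\<close>). Cutting \<open>f\<close> off by explicit
barriers makes \<open>m - f\<^sup>2\<close> bounded below away from \<open>\<xi>\<^sup>\<plusminus>\<close>. There the gain from the larger \<open>b\<close> absorbs any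
small change of \<open>V\<close>. Near \<open>\<xi>\<^sup>\<plusminus>\<close> two potentials that are close in \<open>C\<^sup>2\<close> agree together with their first
derivatives at the common minimum, hence differ by a small multiple of the squared distance, which
the quadratic growth of \<open>V - m\<close> dominates.

Closedness and interiority together say that \<open>V \<mapsto> \<alpha>\<^sub>V\<close> is defined on an open set and continuous there. Since In is closed
and Out is its complement, both boundaries equal In minus its interior, which is the graph of this
function.
\<close>

section \<open>Pointwise slopes\<close>

text \<open>
The number \<open>L\<close> bounds the pointwise Lipschitz constant of \<open>f\<close> at \<open>x\<close> relative to \<open>S\<close>; for a differentiable
function this says that the norm of the gradient is at most \<open>L\<close>.
\<close>

definition slope_le :: "'a::metric_space set \<Rightarrow> ('a \<Rightarrow> real) \<Rightarrow> 'a \<Rightarrow> real \<Rightarrow> bool" where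
  "slope_le S f x L \<longleftrightarrow> (\<forall>K>L. \<forall>\<^sub>F y in at x within S. \<bar>f y - f x\<bar> \<le> K * dist y x)"

lemma slope_leD:
  assumes "slope_le S f x L" "L < K"
  shows "\<forall>\<^sub>F y in at x within S. \<bar>f y - f x\<bar> \<le> K * dist y x"
  using assms by (simp add: slope_le_def)

lemma slope_le_ball:
  assumes "slope_le S f x L" "L < K"
  obtains d where "d > 0" "\<And>y. y \<in> S \<Longrightarrow> dist y x < d \<Longrightarrow> \<bar>f y - f x\<bar> \<le> K * dist y x"
proof -
  obtain d where d: "d > 0" "\<And>y. y \<in> S \<Longrightarrow> y \<noteq> x \<Longrightarrow> dist y x < d \<Longrightarrow> \<bar>f y - f x\<bar> \<le> K * dist y x"
    using slope_leD[OF assms] unfolding eventually_at by blast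
  show thesis
  proof (rule that[OF d(1)])
    fix y assume "y \<in> S" "dist y x < d"
    then show "\<bar>f y - f x\<bar> \<le> K * dist y x" using d(2)[of y] by (cases "y = x") auto
  qed
qed

lemma slope_le_mono:
  assumes "slope_le S f x L" "L \<le> L'"
  shows "slope_le S f x L'"
  using assms by (auto simp: slope_le_def)

lemma slope_le_tendsto:
  assumes "slope_le S f x L"
  shows "(f \<longlongrightarrow> f x) (at x within S)"
proof -
  have "\<forall>\<^sub>F y in at x within S. norm (f y - f x) \<le> (L + 1) * dist y x"
    using slope_leD[OF assms, of "L + 1"] by simp
  moreover have "((\<lambda>y. (L + 1) * dist y x) \<longlongrightarrow> (L + 1) * dist x x) (at x within S)"
    by (intro tendsto_intros)
  then have "((\<lambda>y. (L + 1) * dist y x) \<longlongrightarrow> 0) (at x within S)"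
    by simp
  ultimately have "((\<lambda>y. f y - f x) \<longlongrightarrow> 0) (at x within S)"
    by (rule Lim_null_comparison)
  then show ?thesis
    by (simp add: LIM_zero_iff)
qed

lemma slope_le_contraction:
  assumes f: "slope_le S f x L" and h: "\<And>u w. \<bar>h u - h w\<bar> \<le> \<bar>u - w\<bar>"
  shows "slope_le S (\<lambda>y. h (f y)) x L"
  unfolding slope_le_def
proof (intro allI impI)
  fix K assume "L < K"
  show "\<forall>\<^sub>F y in at x within S. \<bar>h (f y) - h (f x)\<bar> \<le> K * dist y x"
    using slope_leD[OF f \<open>L < K\<close>] by eventually_elim (use h order_trans in blast)
qed

lemma slope_le_locally_const:
  assumes "\<forall>\<^sub>F y in at x within S. f y = f x" "0 \<le> L"
  shows "slope_le S f x L"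
  unfolding slope_le_def
proof (intro allI impI)
  fix K assume "L < K"
  show "\<forall>\<^sub>F y in at x within S. \<bar>f y - f x\<bar> \<le> K * dist y x"
    using assms(1) by eventually_elim (use assms(2) \<open>L < K\<close> in simp)
qed

lemma slope_le_minus: "slope_le S (\<lambda>y. - f y) x L \<longleftrightarrow> slope_le S f x L"
  by (simp add: slope_le_def abs_minus_commute)

lemma slope_le_cmult:
  assumes "slope_le S f x L" "0 \<le> c"
  shows "slope_le S (\<lambda>y. c * f y) x (c * L)"
  unfolding slope_le_def
proof (intro allI impI)
  fix K assume K: "c * L < K"
  show "\<forall>\<^sub>F y in at x within S. \<bar>c * f y - c * f x\<bar> \<le> K * dist y x"
  proof (cases "c = 0")
    case False
    with assms have "c > 0" by simp
    then have "L < K / c" using K by (simp add: field_simps)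
    from slope_leD[OF assms(1) this] show ?thesis
    proof eventually_elim
      case (elim y)
      have "\<bar>c * f y - c * f x\<bar> = c * \<bar>f y - f x\<bar>"
        using \<open>c > 0\<close> by (simp flip: right_diff_distrib add: abs_mult)
      also have "\<dots> \<le> c * (K / c * dist y x)"
        using elim \<open>c > 0\<close> by (intro mult_left_mono) auto
      finally show ?case using \<open>c > 0\<close> by simp
    qed
  qed (use K in auto)
qed

text \<open>
Where the two functions differ, the minimum coincides locally with the smaller one, so only the
slope of a function that attains the minimum at \<open>x\<close> matters.
\<close>

lemma slope_le_min:
  assumes f: "(f \<longlongrightarrow> f x) (at x within S)" and g: "(g \<longlongrightarrow> g x) (at x within S)"
    and fL: "f x \<le> g x \<Longrightarrow> slope_le S f x L" and gL: "g x \<le> f x \<Longrightarrow> slope_le S g x L"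
  shows "slope_le S (\<lambda>y. min (f y) (g y)) x L"
  unfolding slope_le_def
proof (intro allI impI)
  fix K assume K: "L < K"
  consider "f x < g x" | "g x < f x" | "f x = g x" by linarith
  then show "\<forall>\<^sub>F y in at x within S. \<bar>min (f y) (g y) - min (f x) (g x)\<bar> \<le> K * dist y x"
  proof cases
    case 1
    then have "\<forall>\<^sub>F y in at x within S. 0 < g y - f y"
      using tendsto_diff[OF g f] by (intro order_tendstoD(1)[of _ "g x - f x"]) auto
    with slope_leD[OF fL K] 1 show ?thesis
      by (simp, elim eventually_elim2) (auto simp: min_def)
  next
    case 2
    then have "\<forall>\<^sub>F y in at x within S. 0 < f y - g y"
      using tendsto_diff[OF f g] by (intro order_tendstoD(1)[of _ "f x - g x"]) auto
    with slope_leD[OF gL K] 2 show ?thesis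
      by (simp, elim eventually_elim2) (auto simp: min_def)
  next
    case 3
    then show ?thesis
      using eventually_conj[OF slope_leD[OF fL K] slope_leD[OF gL K]]
      by (simp, elim eventually_mono) (auto simp: min_def)
  qed
qed

lemma slope_le_max:
  assumes f: "(f \<longlongrightarrow> f x) (at x within S)" and g: "(g \<longlongrightarrow> g x) (at x within S)"
    and fL: "g x \<le> f x \<Longrightarrow> slope_le S f x L" and gL: "f x \<le> g x \<Longrightarrow> slope_le S g x L"
  shows "slope_le S (\<lambda>y. max (f y) (g y)) x L"
proof -
  have "slope_le S (\<lambda>y. min (- f y) (- g y)) x L"
    using assms by (intro slope_le_min tendsto_intros) (auto simp: slope_le_minus)
  moreover have "(\<lambda>y. max (f y) (g y)) = (\<lambda>y. - min (- f y) (- g y))"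
    by (simp add: fun_eq_iff minus_min_eq_max)
  ultimately show ?thesis
    by (simp add: slope_le_minus)
qed

lemma slope_le_dist_power2: "slope_le S (\<lambda>y. (dist y p)\<^sup>2) x (2 * dist x p)"
  unfolding slope_le_def
proof (intro allI impI)
  fix K assume K: "2 * dist x p < K"
  have "((\<lambda>y. dist y p + dist x p) \<longlongrightarrow> dist x p + dist x p) (at x within S)"
    by (intro tendsto_intros)
  then have "\<forall>\<^sub>F y in at x within S. dist y p + dist x p < K"
    using K by (intro order_tendstoD(2)[of _ "dist x p + dist x p"]) auto
  then show "\<forall>\<^sub>F y in at x within S. \<bar>(dist y p)\<^sup>2 - (dist x p)\<^sup>2\<bar> \<le> K * dist y x"
  proof eventually_elim
    case (elim y)
    have "\<bar>(dist y p)\<^sup>2 - (dist x p)\<^sup>2\<bar> = (dist y p + dist x p) * \<bar>dist y p - dist x p\<bar>"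
      by (simp add: power2_eq_square square_diff_square_factored abs_mult)
    also have "\<dots> \<le> K * dist y x"
    proof (rule mult_mono)
      show "\<bar>dist y p - dist x p\<bar> \<le> dist y x"
        using dist_triangle[of y p x] dist_triangle[of x p y] by (simp add: abs_le_iff dist_commute)
    qed (use elim K zero_le_dist[of x p] in linarith)+
    finally show ?case .
  qed
qed

section \<open>Calibrations bound the action from below\<close>

lemma has_L2_derivD:
  fixes v :: "real \<Rightarrow> 'a::euclidean_space"
  assumes "has_L2_deriv a b x v"
  shows "v absolutely_integrable_on {a..b}"
    and "(\<lambda>t. (norm (v t))\<^sup>2) absolutely_integrable_on {a..b}"
    and "\<And>t. t \<in> {a..b} \<Longrightarrow> x t = x a + integral {a..t} v"
proof -
  note h = assms[unfolded has_L2_deriv_def]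
  have sq: "integrable (lebesgue_on {a..b}) (\<lambda>t. (norm (v t))\<^sup>2)" using h by blast
  show 2: "(\<lambda>t. (norm (v t))\<^sup>2) absolutely_integrable_on {a..b}"
    using integrable_on_lebesgue_on[OF sq] by (subst absolutely_integrable_on_iff_nonneg) auto
  have 1: "(\<lambda>t. 1 + (norm (v t))\<^sup>2) integrable_on {a..b}"
    using integrable_on_lebesgue_on[OF sq] by (intro integrable_add) auto
  show v: "v absolutely_integrable_on {a..b}"
  proof (rule measurable_bounded_by_integrable_imp_absolutely_integrable[OF _ _ 1])
    fix t
    have "0 \<le> (norm (v t) - 1)\<^sup>2" by simp
    then have "2 * norm (v t) \<le> 1 + (norm (v t))\<^sup>2" by (simp add: power2_diff)
    then show "norm (v t) \<le> 1 + (norm (v t))\<^sup>2" using norm_ge_zero[of "v t"] by linarith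
  qed (use h in auto)
  fix t assume t: "t \<in> {a..b}"
  have "v absolutely_integrable_on {a..t}"
    using v t by (intro absolutely_integrable_on_subinterval) auto
  then have "integrable (lebesgue_on {a..t}) v"
    by (intro absolutely_integrable_imp_integrable) auto
  then have "(LINT \<tau>|lebesgue_on {a..t}. v \<tau>) = integral {a..t} v"
    by (intro lebesgue_integral_eq_integral) auto
  moreover have "x t = x a + (LINT \<tau>|lebesgue_on {a..t}. v \<tau>)" using h t by blast
  ultimately show "x t = x a + integral {a..t} v" by metis
qed

lemma H1_increment:
  fixes v :: "real \<Rightarrow> 'a::euclidean_space"
  assumes "has_L2_deriv a b x v" "a \<le> s" "s \<le> t" "t \<le> b"
  shows "norm (x t - x s) \<le> integral {s..t} (\<lambda>\<tau>. norm (v \<tau>))"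
proof -
  note v = has_L2_derivD(1)[OF assms(1)]
  have vi: "v integrable_on {a..t}"
    using v assms by (intro absolutely_integrable_on_def[THEN iffD1, THEN conjunct1])
      (auto intro: absolutely_integrable_on_subinterval)
  have "x t - x s = integral {a..t} v - integral {a..s} v"
    using has_L2_derivD(3)[OF assms(1), of t] has_L2_derivD(3)[OF assms(1), of s] assms by simp
  also have "\<dots> = integral {s..t} v"
    using Henstock_Kurzweil_Integration.integral_combine[OF assms(2,3) vi] by (simp add: algebra_simps)
  finally have e: "x t - x s = integral {s..t} v" .
  have "v absolutely_integrable_on {s..t}"
    using v assms by (intro absolutely_integrable_on_subinterval) auto
  then show ?thesis
    unfolding e by (intro integral_norm_bound_integral) (auto simp: absolutely_integrable_on_def)
qed

lemma H1_continuous: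
  fixes v :: "real \<Rightarrow> 'a::euclidean_space"
  assumes "has_L2_deriv a b x v"
  shows "continuous_on {a..b} x"
proof -
  have "continuous_on {a..b} (\<lambda>t. x a + integral {a..t} v)"
    using has_L2_derivD(1)[OF assms]
    by (intro continuous_intros indefinite_integral_continuous_1) (auto simp: absolutely_integrable_on_def)
  then show ?thesis
    by (rule continuous_on_eq) (rule has_L2_derivD(3)[OF assms, symmetric])
qed

text \<open>
The pointwise slope bound gives, near each time, \<open>|dU| \<le> \<surd>(2 q) |v| \<le> |v|\<^sup>2 / 2 + q\<close> up to a small error
per unit of time. Such local estimates add up over an interval by bisection, so neither \<open>U\<close> nor the
path has to be differentiated.
\<close>

lemma calibration_along_H1_path:
  fixes x v :: "real \<Rightarrow> 'a::euclidean_space"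
  assumes v: "has_L2_deriv a b x v" and ab: "a \<le> b"
    and q: "continuous_on UNIV q" "\<And>y. 0 \<le> q y"
    and U: "\<And>y. slope_le UNIV U y (sqrt (2 * q y))"
  shows "\<bar>U (x b) - U (x a)\<bar> \<le> integral {a..b} (\<lambda>t. (norm (v t))\<^sup>2 / 2 + q (x t))"
proof (rule field_le_epsilon)
  fix e :: real assume e: "e > 0"
  define n where "n = e / (b - a + 1)"
  have n: "n > 0" using e ab by (simp add: n_def)
  let ?E = "\<lambda>t. (norm (v t))\<^sup>2 / 2 + q (x t) + n"
  have cx: "continuous_on {a..b} x" using H1_continuous[OF v] .
  have cq: "continuous_on {a..b} (\<lambda>t. q (x t))"
    using continuous_on_compose2[OF q(1) cx] by auto
  have v2i: "(\<lambda>t. (norm (v t))\<^sup>2 / 2) integrable_on {a..b}"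
    using has_L2_derivD(2)[OF v] by (intro integrable_on_divide) (auto simp: absolutely_integrable_on_def)
  have E0: "(\<lambda>t. (norm (v t))\<^sup>2 / 2 + q (x t)) integrable_on {a..b}"
    by (intro integrable_add v2i integrable_continuous_interval cq)
  have Ei: "?E integrable_on {a..b}"
    by (intro integrable_add E0) auto
  have vi: "(\<lambda>t. norm (v t)) integrable_on {a..b}"
    using has_L2_derivD(1)[OF v] by (auto simp: absolutely_integrable_on_def)
  have "a \<le> a \<and> b \<le> b \<longrightarrow> \<bar>U (x b) - U (x a)\<bar> \<le> integral {a..b} ?E"
    using ab
  proof (induction rule: Bolzano[where P = "\<lambda>s t. a \<le> s \<and> t \<le> b \<longrightarrow>
      \<bar>U (x t) - U (x s)\<bar> \<le> integral {s..t} ?E"])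
    case (trans s t u)
    show ?case
    proof
      assume su: "a \<le> s \<and> u \<le> b"
      have "integral {s..t} ?E + integral {t..u} ?E = integral {s..u} ?E"
        using trans su Ei
        by (intro Henstock_Kurzweil_Integration.integral_combine) (auto intro: integrable_subinterval_real)
      with trans su show "\<bar>U (x u) - U (x s)\<bar> \<le> integral {s..u} ?E" by linarith
    qed
  next
    case (local t0)
    \<comment> \<open>A slope slightly above the admitted one, whose square exceeds \<open>2 q\<close> by exactly \<open>n\<close>: half of the
      allowance \<open>n\<close> goes into this, the other half into the oscillation of \<open>q\<close> along the path.\<close>
    define K where "K = sqrt (2 * q (x t0) + n)"
    have K: "sqrt (2 * q (x t0)) < K" "0 \<le> K" "K\<^sup>2 = 2 * q (x t0) + n"
      using n q(2)[of "x t0"] by (auto simp: K_def)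
    obtain d1 where d1: "d1 > 0"
      "\<And>y. dist y (x t0) < d1 \<Longrightarrow> \<bar>U y - U (x t0)\<bar> \<le> K * dist y (x t0)"
      using slope_le_ball[OF U K(1)] by auto
    obtain d2 where d2: "d2 > 0" "\<And>t. t \<in> {a..b} \<Longrightarrow> dist t t0 < d2 \<Longrightarrow> dist (x t) (x t0) < d1"
      using cx local d1(1) unfolding continuous_on_iff by (metis atLeastAtMost_iff)
    obtain d3 where d3: "d3 > 0"
      "\<And>t. t \<in> {a..b} \<Longrightarrow> dist t t0 < d3 \<Longrightarrow> dist (q (x t)) (q (x t0)) < n / 2"
      using cq local n unfolding continuous_on_iff by (metis atLeastAtMost_iff half_gt_zero)
    show ?case
    proof (intro exI[of _ "min d2 d3"] conjI allI impI)
      show "min d2 d3 > 0" using d2 d3 by simp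
      fix s t assume st: "s \<le> t0 \<and> t0 \<le> t \<and> t - s < min d2 d3" "a \<le> s \<and> t \<le> b"
      have near: "\<bar>U (x r) - U (x t0)\<bar> \<le> K * norm (x r - x t0)" if "r \<in> {s, t}" for r
        using that st d1(2)[of "x r"] d2(2)[of r] by (auto simp: dist_norm)
      have vst: "(\<lambda>t. norm (v t)) integrable_on {s..t}"
        using vi st by (auto intro: integrable_subinterval_real)
      have "\<bar>U (x t) - U (x s)\<bar> \<le> \<bar>U (x t) - U (x t0)\<bar> + \<bar>U (x s) - U (x t0)\<bar>" by linarith
      also have "\<dots> \<le> K * norm (x t - x t0) + K * norm (x s - x t0)"
        using near by (intro add_mono) auto
      also have "\<dots> \<le> K * integral {t0..t} (\<lambda>\<tau>. norm (v \<tau>)) + K * integral {s..t0} (\<lambda>\<tau>. norm (v \<tau>))"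
        using H1_increment[OF v, of t0 t] H1_increment[OF v, of s t0] st K(2)
        by (intro add_mono mult_left_mono) (auto simp: norm_minus_commute)
      also have "\<dots> = integral {s..t} (\<lambda>\<tau>. K * norm (v \<tau>))"
        using Henstock_Kurzweil_Integration.integral_combine[of s t0 t "\<lambda>\<tau>. norm (v \<tau>)"] st vst
        by (simp flip: distrib_left add: add.commute)
      also have "\<dots> \<le> integral {s..t} ?E"
      proof (rule integral_le)
        show "(\<lambda>\<tau>. K * norm (v \<tau>)) integrable_on {s..t}"
          using vst by (rule integrable_on_mult_right)
        show "?E integrable_on {s..t}"
          using Ei st by (auto intro: integrable_subinterval_real)
        fix \<tau> assume \<tau>: "\<tau> \<in> {s..t}"
        have "0 \<le> (norm (v \<tau>) - K)\<^sup>2" by simp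
        then have "K * norm (v \<tau>) \<le> (norm (v \<tau>))\<^sup>2 / 2 + K\<^sup>2 / 2"
          by (simp add: power2_diff algebra_simps)
        moreover have "\<bar>q (x \<tau>) - q (x t0)\<bar> < n / 2"
          using \<tau> st d3(2)[of \<tau>] by (auto simp: dist_real_def)
        then have "q (x t0) - n / 2 < q (x \<tau>)"
          unfolding abs_less_iff by linarith
        ultimately show "K * norm (v \<tau>) \<le> ?E \<tau>"
          using K(3) by linarith
      qed
      finally show "\<bar>U (x t) - U (x s)\<bar> \<le> integral {s..t} ?E" .
    qed
  qed
  then have "\<bar>U (x b) - U (x a)\<bar> \<le> integral {a..b} ?E" by simp
  also have "\<dots> = integral {a..b} (\<lambda>t. (norm (v t))\<^sup>2 / 2 + q (x t)) + n * (b - a)"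
    using ab by (subst Henstock_Kurzweil_Integration.integral_add[OF E0]) auto
  also have "n * (b - a) \<le> e"
    using e ab by (simp add: n_def field_simps)
  finally show "\<bar>U (x b) - U (x a)\<bar> \<le> integral {a..b} (\<lambda>t. (norm (v t))\<^sup>2 / 2 + q (x t)) + e" by simp
qed

lemma polar_dist:
  fixes s s' :: "'a::real_inner"
  assumes "norm s = 1" "norm s' = 1"
  shows "(norm (l *\<^sub>R s' - s))\<^sup>2 = (l - 1)\<^sup>2 + l * (norm (s' - s))\<^sup>2"
proof -
  have "s \<bullet> s = 1" "s' \<bullet> s' = 1" using assms by (simp_all add: norm_eq_1)
  then show ?thesis
    by (simp add: power2_norm_eq_inner inner_diff_left inner_diff_right inner_commute)
      (simp add: power2_eq_square algebra_simps)
qed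

lemma normalize_scaleR:
  assumes "r > 0"
  shows "(r *\<^sub>R y) /\<^sub>R norm (r *\<^sub>R y) = y /\<^sub>R norm y"
  unfolding sgn_div_norm[symmetric] using assms by (simp add: sgn_scaleR)

section \<open>Homogeneous extensions from the sphere\<close>

definition homog :: "real \<Rightarrow> ('a::real_normed_vector \<Rightarrow> real) \<Rightarrow> 'a \<Rightarrow> real" where
  "homog b f y = norm y powr b * f (y /\<^sub>R norm y)"

lemma homog_scale:
  assumes "r > 0"
  shows "homog b f (r *\<^sub>R y) = r powr b * homog b f y"
  unfolding homog_def normalize_scaleR[OF assms] using assms by (simp add: powr_mult)

lemma homog_sphere: "norm s = 1 \<Longrightarrow> homog b f s = f s"
  by (simp add: homog_def)

lemma cauchy_schwarz_real2:
  fixes p q u w :: real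
  shows "p * u + q * w \<le> sqrt (p\<^sup>2 + q\<^sup>2) * sqrt (u\<^sup>2 + w\<^sup>2)"
proof -
  have "(p * u + q * w)\<^sup>2 + (p * w - q * u)\<^sup>2 = (p\<^sup>2 + q\<^sup>2) * (u\<^sup>2 + w\<^sup>2)"
    by (simp add: power2_eq_square algebra_simps)
  then have "(p * u + q * w)\<^sup>2 \<le> (p\<^sup>2 + q\<^sup>2) * (u\<^sup>2 + w\<^sup>2)"
    by (metis zero_le_power2 le_add_same_cancel1)
  then show ?thesis
    unfolding real_sqrt_mult[symmetric] by (rule real_le_rsqrt)
qed

text \<open>
In polar coordinates the radial derivative of the extension is \<open>b f\<close> and its tangential slope is that of
\<open>f\<close>; the two directions are orthogonal, so the squares add up.
\<close>

lemma slope_homog_sphere: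
  fixes s :: "'a::euclidean_space"
  assumes s: "norm s = 1" and f: "slope_le (sphere 0 1) f s L" and L: "0 \<le> L" and b: "0 < b"
  shows "slope_le UNIV (homog b f) s (sqrt ((b * f s)\<^sup>2 + L\<^sup>2))"
  unfolding slope_le_def
proof (intro allI impI)
  fix K assume K: "sqrt ((b * f s)\<^sup>2 + L\<^sup>2) < K"
  \<comment> \<open>A margin \<open>e\<close> absorbs the errors in the three approximations \<open>ev1\<close>, \<open>ev2\<close> and \<open>ft\<close> below.\<close>
  let ?h = "\<lambda>e. sqrt (((b + e) * f s)\<^sup>2 + ((1 + e) * (L + e))\<^sup>2)"
  have "(?h \<longlongrightarrow> sqrt (((b + 0) * f s)\<^sup>2 + ((1 + 0) * (L + 0))\<^sup>2)) (at_right 0)"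
    by (intro tendsto_intros)
  then have "\<forall>\<^sub>F e in at_right 0. ?h e < K"
    by (rule order_tendstoD(2)) (use K in simp)
  moreover have "\<forall>\<^sub>F e in at_right (0::real). e > 0"
    by (rule eventually_at_right_less)
  ultimately obtain e where e: "e > 0" "?h e < K"
    using eventually_happens[OF eventually_conj] by (metis (mono_tags, lifting) trivial_limit_at_right_real)
  obtain d where d: "d > 0" "\<And>y. y \<in> sphere 0 1 \<Longrightarrow> dist y s < d \<Longrightarrow> \<bar>f y - f s\<bar> \<le> (L + e) * dist y s"
    using slope_le_ball[OF f, of "L + e"] e by auto
  have lim: "((\<lambda>x. norm x) \<longlongrightarrow> 1) (at s)"
    using tendsto_norm[OF tendsto_ident_at[of s UNIV]] s by simp
  have ev0: "\<forall>\<^sub>F x in at s. norm x > 1/2"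
    using lim by (rule order_tendstoD) simp
  have ev1: "\<forall>\<^sub>F x in at s. \<bar>norm x powr b - 1\<bar> \<le> (b + e) * \<bar>norm x - 1\<bar>"
  proof -
    have "((\<lambda>r. r powr b) has_real_derivative b) (at 1)"
      by (auto intro!: derivative_eq_intros)
    then have "((\<lambda>r. (r powr b - 1) / (r - 1)) \<longlongrightarrow> b) (at 1)"
      by (simp add: has_field_derivative_iff)
    then have "((\<lambda>r. \<bar>(r powr b - 1) / (r - 1)\<bar>) \<longlongrightarrow> b) (at 1)"
      using tendsto_rabs b by fastforce
    then have "\<forall>\<^sub>F r in at 1. \<bar>(r powr b - 1) / (r - 1)\<bar> < b + e"
      by (rule order_tendstoD(2)) (use e in simp)
    then obtain d' where d': "d' > 0" "\<And>r. r \<noteq> 1 \<Longrightarrow> dist r 1 < d' \<Longrightarrow> \<bar>(r powr b - 1) / (r - 1)\<bar> < b + e"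
      unfolding eventually_at by blast
    have "\<forall>\<^sub>F x in at s. dist (norm x) 1 < d'"
      using lim d'(1) by (rule tendstoD)
    then show ?thesis
    proof eventually_elim
      case (elim x)
      show ?case
      proof (cases "norm x = 1")
        case False
        then show ?thesis
          using d'(2)[OF False elim] by (simp add: abs_divide divide_less_eq)
      qed simp
    qed
  qed
  have ev2: "\<forall>\<^sub>F x in at s. norm x powr b / sqrt (norm x) < 1 + e"
  proof -
    have "((\<lambda>x. norm x powr b / sqrt (norm x)) \<longlongrightarrow> 1 powr b / sqrt 1) (at s)"
      by (intro tendsto_intros lim) auto
    then show ?thesis by (rule order_tendstoD(2)) (use e in simp)
  qed
  have ev3: "\<forall>\<^sub>F x in at s. dist (x /\<^sub>R norm x) s < d"
  proof -
    have "((\<lambda>x. x /\<^sub>R norm x) \<longlongrightarrow> s /\<^sub>R 1) (at s)"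
      by (intro tendsto_intros lim) auto
    then show ?thesis using d(1) by (intro tendstoD) auto
  qed
  show "\<forall>\<^sub>F x in at s. \<bar>homog b f x - homog b f s\<bar> \<le> K * dist x s"
    using ev0 ev1 ev2 ev3
  proof eventually_elim
    case (elim x)
    define R where "R = norm x"
    define t where "t = x /\<^sub>R norm x"
    have R: "R > 0" using elim(1) unfolding R_def by linarith
    have t: "norm t = 1" "x = R *\<^sub>R t" using R by (auto simp: t_def R_def)
    have ft: "\<bar>f t - f s\<bar> \<le> (L + e) * dist t s"
      using elim(4) t(1) by (intro d(2)) (auto simp: t_def)
    have nx: "dist x s = sqrt (\<bar>R - 1\<bar>\<^sup>2 + (sqrt R * dist t s)\<^sup>2)"
      using polar_dist[OF s t(1), of R] R t(2)
      by (simp add: dist_norm power_mult_distrib real_sqrt_unique)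
    have "\<bar>homog b f x - homog b f s\<bar> = \<bar>(R powr b - 1) * f s + R powr b * (f t - f s)\<bar>"
      using s by (simp add: homog_def R_def t_def algebra_simps)
    also have "\<dots> \<le> \<bar>R powr b - 1\<bar> * \<bar>f s\<bar> + R powr b * \<bar>f t - f s\<bar>"
      by (rule order_trans[OF abs_triangle_ineq]) (simp add: abs_mult)
    also have "\<dots> \<le> ((b + e) * \<bar>R - 1\<bar>) * \<bar>f s\<bar> + R powr b * ((L + e) * dist t s)"
      using elim(2) ft by (intro add_mono mult_right_mono mult_left_mono) (auto simp: R_def)
    also have "R powr b * ((L + e) * dist t s) = R powr b / sqrt R * (L + e) * (sqrt R * dist t s)"
      using R by simp
    also have "\<dots> \<le> (1 + e) * (L + e) * (sqrt R * dist t s)"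
      using elim(3) L e R by (intro mult_right_mono) (auto simp: R_def)
    finally have "\<bar>homog b f x - homog b f s\<bar> \<le> ((b + e) * \<bar>f s\<bar>) * \<bar>R - 1\<bar> + (1 + e) * (L + e) * (sqrt R * dist t s)"
      by (simp add: mult_ac)
    also have "\<dots> \<le> sqrt (((b + e) * \<bar>f s\<bar>)\<^sup>2 + ((1 + e) * (L + e))\<^sup>2) * sqrt (\<bar>R - 1\<bar>\<^sup>2 + (sqrt R * dist t s)\<^sup>2)"
      by (rule cauchy_schwarz_real2)
    also have "\<dots> = ?h e * dist x s"
      by (simp add: nx power_mult_distrib)
    also have "\<dots> \<le> K * dist x s"
      using e by (intro mult_right_mono) auto
    finally show ?case .
  qed
qed

lemma slope_homog:
  fixes y :: "'a::euclidean_space"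
  assumes y: "y \<noteq> 0" and f: "slope_le (sphere 0 1) f (y /\<^sub>R norm y) L" and L: "0 \<le> L" and b: "0 < b"
  shows "slope_le UNIV (homog b f) y (norm y powr (b - 1) * sqrt ((b * f (y /\<^sub>R norm y))\<^sup>2 + L\<^sup>2))"
  unfolding slope_le_def
proof (intro allI impI)
  define r where "r = norm y"
  define s where "s = y /\<^sub>R norm y"
  have r: "r > 0" and s: "norm s = 1" "y = r *\<^sub>R s" using y by (auto simp: r_def s_def)
  fix K assume K: "norm y powr (b - 1) * sqrt ((b * f (y /\<^sub>R norm y))\<^sup>2 + L\<^sup>2) < K"
  have "sqrt ((b * f s)\<^sup>2 + L\<^sup>2) < K / r powr (b - 1)"
    using K r unfolding r_def[symmetric] s_def[symmetric] s_def[unfolded r_def[symmetric], symmetric]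
    by (simp add: pos_less_divide_eq mult.commute)
  then obtain d where d: "d > 0"
    "\<And>x. dist x s < d \<Longrightarrow> \<bar>homog b f x - homog b f s\<bar> \<le> K / r powr (b - 1) * dist x s"
    using slope_le_ball[OF slope_homog_sphere[OF s(1) _ L b, of f]] f by (metis UNIV_I s_def)
  have "\<forall>\<^sub>F x in at y. dist x y < r * d"
    using d r unfolding eventually_at by (intro exI[of _ "r * d"]) auto
  then show "\<forall>\<^sub>F x in at y. \<bar>homog b f x - homog b f y\<bar> \<le> K * dist x y"
  proof eventually_elim
    case (elim x)
    have e: "dist (x /\<^sub>R r) s = dist x y / r"
    proof -
      have "x /\<^sub>R r - s = (x - y) /\<^sub>R r" using r s(2) by (simp add: scaleR_diff_right)
      then show ?thesis using r by (simp add: dist_norm divide_inverse mult.commute)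
    qed
    have "\<bar>homog b f x - homog b f y\<bar> = r powr b * \<bar>homog b f (x /\<^sub>R r) - homog b f s\<bar>"
      using homog_scale[OF r, of b f "x /\<^sub>R r"] homog_scale[OF r, of b f s] r s(2)
      by (simp flip: right_diff_distrib add: abs_mult)
    also have "\<dots> \<le> r powr b * (K / r powr (b - 1) * (dist x y / r))"
      using d(2)[of "x /\<^sub>R r", unfolded e] elim r
      by (intro mult_left_mono) (auto simp: pos_divide_less_eq mult.commute)
    also have "\<dots> = K * dist x y"
      using r by (simp add: powr_diff)
    finally show ?case .
  qed
qed

text \<open>
This is \<open>f\<^sup>2 + |\<nabla>f|\<^sup>2 / b\<^sup>2 \<le> V\<close> solved for the gradient. The first conjunct keeps the argument of the
square root nonnegative, since the square root of a negative number is negative, not \<open>0\<close>.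
\<close>

definition subsolution :: "('a::euclidean_space \<Rightarrow> real) \<Rightarrow> real \<Rightarrow> ('a \<Rightarrow> real) \<Rightarrow> bool" where
  "subsolution V b f \<longleftrightarrow> (\<forall>s\<in>sphere 0 1. (f s)\<^sup>2 \<le> V s \<and>
     slope_le (sphere 0 1) f s (b * sqrt (V s - (f s)\<^sup>2)))"

lemma subsolution_homog:
  assumes f: "subsolution V b f" and b: "0 < b" and y: "y \<noteq> 0"
  shows "slope_le UNIV (homog b f) y (norm y powr (b - 1) * (b * sqrt (V (y /\<^sub>R norm y))))"
proof -
  let ?s = "y /\<^sub>R norm y"
  have s: "?s \<in> sphere 0 1" using y by simp
  then have fs: "(f ?s)\<^sup>2 \<le> V ?s" "slope_le (sphere 0 1) f ?s (b * sqrt (V ?s - (f ?s)\<^sup>2))"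
    using f by (auto simp: subsolution_def)
  have "sqrt ((b * f ?s)\<^sup>2 + (b * sqrt (V ?s - (f ?s)\<^sup>2))\<^sup>2) = b * sqrt (V ?s)"
    using fs(1) b by (simp add: power_mult_distrib real_sqrt_mult flip: distrib_left)
  then show ?thesis
    using slope_homog[OF y fs(2) _ b] fs(1) b by simp
qed

lemma subsolution_continuous:
  assumes "subsolution V b f"
  shows "continuous_on (sphere 0 1) f"
  using assms slope_le_tendsto unfolding subsolution_def continuous_on by blast

text \<open>
Soft thresholding is a contraction that vanishes near \<open>0\<close>. Composing a homogeneous extension with it
removes the infinite slope at the origin and changes values by at most \<open>e\<close>.
\<close>

definition soft :: "real \<Rightarrow> real \<Rightarrow> real" where
  "soft e u = max (u - e) 0 + min (u + e) 0"

lemma soft_contraction: "0 \<le> e \<Longrightarrow> \<bar>soft e u - soft e w\<bar> \<le> \<bar>u - w\<bar>"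
  unfolding soft_def by linarith

lemma soft_near: "0 \<le> e \<Longrightarrow> u - e \<le> soft e u" "0 \<le> e \<Longrightarrow> soft e u \<le> u + e"
  unfolding soft_def by linarith+

lemma soft_zero: "\<bar>u\<bar> \<le> e \<Longrightarrow> soft e u = 0"
  unfolding soft_def by linarith

lemma hom0_continuous: "continuous_on (- {0}) (hom0 (C2_fun V))"
proof -
  have "C2_on (- {0}) (hom0 (C2_fun V))" using C2_fun[of V] by simp
  then show ?thesis
    unfolding C2_on_def
    by (intro continuous_at_imp_continuous_on ballI differentiable_imp_continuous_within) auto
qed

lemma C2_fun_bound:
  fixes V :: "'a::euclidean_space C2_sphere"
  obtains B where "B > 0" "\<And>s. s \<in> sphere 0 1 \<Longrightarrow> C2_fun V s \<le> B"
proof -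
  have "bounded (C2_fun V ` sphere 0 1)"
    by (intro compact_imp_bounded compact_continuous_image C2_sphere_continuous) simp
  then obtain B where "B > 0" "\<And>s. s \<in> sphere 0 1 \<Longrightarrow> \<bar>C2_fun V s\<bar> \<le> B"
    by (auto simp: bounded_pos)
  then show thesis by (intro that[of B]) (auto simp: abs_le_iff)
qed

lemma action_ge_integral:
  fixes x v :: "real \<Rightarrow> 'a::euclidean_space"
  assumes v: "has_L2_deriv a b x (L2_deriv a b x)" and q: "continuous_on UNIV q" "\<And>y. 0 \<le> q y"
    and qp: "\<And>y. ennreal (q y) \<le> potential p y"
  shows "ennreal (integral {a..b} (\<lambda>t. (norm (L2_deriv a b x t))\<^sup>2 / 2 + q (x t))) \<le> action p a b x"
proof -
  let ?E = "\<lambda>t. (norm (L2_deriv a b x t))\<^sup>2 / 2 + q (x t)"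
  have cq: "continuous_on {a..b} (\<lambda>t. q (x t))"
    using continuous_on_compose2[OF q(1) H1_continuous[OF v]] by auto
  have v2i: "(\<lambda>t. (norm (L2_deriv a b x t))\<^sup>2 / 2) integrable_on {a..b}"
    using has_L2_derivD(2)[OF v] by (intro integrable_on_divide) (auto simp: absolutely_integrable_on_def)
  have "?E integrable_on {a..b}"
    by (intro integrable_add v2i integrable_continuous_interval cq)
  then have "?E absolutely_integrable_on {a..b}"
    using q(2) by (subst absolutely_integrable_on_iff_nonneg) auto
  then have i: "integrable (lebesgue_on {a..b}) ?E"
    by (intro absolutely_integrable_imp_integrable) auto
  then have "ennreal (integral {a..b} ?E) = ennreal (LINT t|lebesgue_on {a..b}. ?E t)"
    by (subst lebesgue_integral_eq_integral) auto
  also have "\<dots> = (\<integral>\<^sup>+t. ennreal (?E t) \<partial>lebesgue_on {a..b})"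
    using i q(2) by (intro nn_integral_eq_integral[symmetric]) auto
  also have "\<dots> \<le> action p a b x"
    unfolding action_def using q(2) qp by (intro nn_integral_mono) (auto simp: add_left_mono)
  finally show ?thesis .
qed

text \<open>
The potential tends to infinity at the origin because \<open>V \<ge> m > 0\<close>, so truncating it at height \<open>N\<close> makes it
continuous everywhere.
\<close>

lemma truncated_potential:
  fixes V :: "'a::euclidean_space C2_sphere"
  assumes m: "m > 0" "\<And>s. s \<in> sphere 0 1 \<Longrightarrow> m \<le> C2_fun V s" and a: "0 < \<alpha>" and N: "N > 0"
  defines "q \<equiv> \<lambda>y. if y = 0 then N else min N (C2_fun V (y /\<^sub>R norm y) / norm y powr \<alpha>)"
  shows "continuous_on UNIV q" "0 \<le> q y" "ennreal (q y) \<le> potential (V, \<alpha>) y"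
proof -
  have Vpos: "0 \<le> C2_fun V (y /\<^sub>R norm y)" if "y \<noteq> 0" for y
    using m(1) m(2)[of "y /\<^sub>R norm y"] that by auto
  show "0 \<le> q y" using N Vpos by (auto simp: q_def)
  show "ennreal (q y) \<le> potential (V, \<alpha>) y"
    by (auto simp: q_def intro: ennreal_leI)
  define \<rho> where "\<rho> = (m / N) powr (1 / \<alpha>)"
  have \<rho>: "\<rho> > 0" "\<rho> powr \<alpha> = m / N" using m N a by (auto simp: \<rho>_def powr_powr)
  have near: "q y = N" if "norm y < \<rho>" for y
  proof (cases "y = 0")
    case False
    have "norm y powr \<alpha> \<le> m / N"
      using that a by (subst \<rho>(2)[symmetric]) (intro powr_mono2, auto)
    then have "N * norm y powr \<alpha> \<le> m" using N by (simp add: field_simps)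
    also have "\<dots> \<le> C2_fun V (y /\<^sub>R norm y)" using m(2) False by simp
    finally show ?thesis using False by (simp add: q_def field_simps min_def)
  qed (simp add: q_def)
  have "continuous_on (ball 0 \<rho>) q"
    by (rule continuous_on_eq[of _ "\<lambda>_. N"]) (use near in auto)
  moreover have "continuous_on (- {0}) q"
  proof (rule continuous_on_eq)
    show "continuous_on (- {0}) (\<lambda>y. min N (hom0 (C2_fun V) y / norm y powr \<alpha>))"
      by (intro continuous_intros hom0_continuous) auto
  qed (auto simp: q_def hom0_def)
  ultimately have "continuous_on (ball 0 \<rho> \<union> - {0}) q"
    by (intro continuous_on_open_Un) auto
  moreover have "ball 0 \<rho> \<union> - {0::'a} = UNIV" using \<rho>(1) by auto
  ultimately show "continuous_on UNIV q" by simp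
qed

text \<open>
The homogeneous extension of \<open>f\<close>, scaled by \<open>\<surd>2 / b\<close>, has slope at most \<open>\<surd>(2 V)\<close> away from the origin. A
path may pass through the origin, where this slope is infinite. Soft thresholding flattens the
extension on a ball around the origin; outside that ball the potential is bounded by \<open>N\<close>, so
the truncated potential dominates the slope everywhere.
\<close>

lemma subsolution_imp_min_action_ge:
  fixes V :: "'a::euclidean_space C2_sphere"
  assumes m: "m > 0" "\<And>s. s \<in> sphere 0 1 \<Longrightarrow> m \<le> C2_fun V s" and a: "0 < \<alpha>" "\<alpha> < 2"
    and b: "b = 1 - \<alpha> / 2" and f: "subsolution (C2_fun V) b f"
    and x: "norm xm = 1" "norm xp = 1"
  shows "ennreal (sqrt 2 / b * (f xp - f xm)) \<le> min_action xm xp (V, \<alpha>)"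
  unfolding min_action_def
proof (rule Inf_greatest, safe)
  fix s t :: real and x :: "real \<Rightarrow> 'a"
  assume st: "s < t" and xH: "x \<in> H1 s t" and xe: "xm = x s" "xp = x t"
  let ?D = "sqrt 2 / b * (f xp - f xm)"
  have v: "has_L2_deriv s t x (L2_deriv s t x)"
    using xH unfolding H1_def L2_deriv_def by (auto intro: someI[of "has_L2_deriv s t x"])
  have b0: "b > 0" "b < 1" using a b by auto
  have "ennreal ?D \<le> action (V, \<alpha>) s t x"
  proof (rule ennreal_le_epsilon)
    fix e :: real assume e: "e > 0"
    define U where "U = (\<lambda>y. sqrt 2 / b * homog b f y)"
    obtain C where C: "C > 0" "\<And>s. s \<in> sphere 0 1 \<Longrightarrow> \<bar>f s\<bar> \<le> C"
      using compact_imp_bounded[OF compact_continuous_image[OF subsolution_continuous[OF f] compact_sphere]]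
      by (auto simp: bounded_pos)
    define r where "r = (e / 2 / (sqrt 2 / b * C)) powr (1 / b)"
    have r: "r > 0" "sqrt 2 / b * (r powr b * C) = e / 2"
      using e b0 C by (auto simp: r_def powr_powr)
    have small: "soft (e / 2) (U y) = 0" if "norm y < r" for y
    proof (rule soft_zero, cases "y = 0")
      case False
      have "\<bar>U y\<bar> = sqrt 2 / b * (norm y powr b * \<bar>f (y /\<^sub>R norm y)\<bar>)"
        using b0 by (simp add: U_def homog_def abs_mult)
      also have "\<dots> \<le> sqrt 2 / b * (r powr b * C)"
        using that b0 C False by (intro mult_left_mono mult_mono powr_mono2) auto
      finally show "\<bar>U y\<bar> \<le> e / 2" by (simp only: r(2))
    qed (use e b0 in \<open>simp add: U_def homog_def\<close>)
    obtain B where B: "B > 0" "\<And>s. s \<in> sphere 0 1 \<Longrightarrow> C2_fun V s \<le> B" using C2_fun_bound by blast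
    define N where "N = B / r powr \<alpha>"
    have N: "N > 0" using B r by (simp add: N_def)
    define q where "q = (\<lambda>y. if y = 0 then N else min N (C2_fun V (y /\<^sub>R norm y) / norm y powr \<alpha>))"
    have q: "continuous_on UNIV q" "\<And>y. 0 \<le> q y" "\<And>y. ennreal (q y) \<le> potential (V, \<alpha>) y"
      unfolding q_def by (rule truncated_potential[OF m a(1) N], assumption)+
    have sl: "slope_le UNIV (\<lambda>y. soft (e / 2) (U y)) y (sqrt (2 * q y))" for y
    proof (cases "norm y < r")
      case True
      have "\<forall>\<^sub>F z in at y. dist z y < r - norm y"
        using True unfolding eventually_at by (intro exI[of _ "r - norm y"]) auto
      then have "\<forall>\<^sub>F z in at y. soft (e / 2) (U z) = soft (e / 2) (U y)"
      proof eventually_elim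
        case (elim z)
        have "norm z \<le> norm y + dist z y" by (metis dist_norm norm_triangle_sub)
        with elim show ?case using small True by simp
      qed
      then show ?thesis using q(2) by (intro slope_le_locally_const) auto
    next
      case False
      then have y: "y \<noteq> 0" using r(1) by auto
      have "C2_fun V (y /\<^sub>R norm y) / norm y powr \<alpha> \<le> N"
        unfolding N_def using B y False r a
        by (intro frac_le powr_mono2) auto
      then have qy: "q y = C2_fun V (y /\<^sub>R norm y) / norm y powr \<alpha>"
        using y by (simp add: q_def)
      have "slope_le UNIV U y (sqrt 2 / b * (norm y powr (b - 1) * (b * sqrt (C2_fun V (y /\<^sub>R norm y)))))"
        unfolding U_def using b0 by (intro slope_le_cmult subsolution_homog f y) auto
      also have "sqrt 2 / b * (norm y powr (b - 1) * (b * sqrt (C2_fun V (y /\<^sub>R norm y)))) = sqrt (2 * q y)"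
      proof -
        have "norm y powr (b - 1) = 1 / sqrt (norm y powr \<alpha>)"
          using y b by (simp add: powr_half_sqrt[symmetric] powr_powr powr_minus_divide[symmetric])
        then show ?thesis
          using b0 by (simp add: qy real_sqrt_mult real_sqrt_divide)
      qed
      finally show ?thesis
        using e by (intro slope_le_contraction[where h = "soft (e / 2)"] soft_contraction) auto
    qed
    have "soft (e / 2) (U xp) - soft (e / 2) (U xm) \<le> integral {s..t} (\<lambda>\<tau>. (norm (L2_deriv s t x \<tau>))\<^sup>2 / 2 + q (x \<tau>))"
      using calibration_along_H1_path[OF v _ q(1,2) sl] st by (simp add: xe abs_le_iff)
    moreover have "?D - e \<le> soft (e / 2) (U xp) - soft (e / 2) (U xm)"
    proof -
      have "?D = U xp - U xm" using x by (simp add: U_def homog_sphere right_diff_distrib)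
      then show ?thesis using soft_near(1)[of "e / 2" "U xp"] soft_near(2)[of "e / 2" "U xm"] e by simp
    qed
    ultimately have "ennreal (?D - e) \<le> ennreal (integral {s..t} (\<lambda>\<tau>. (norm (L2_deriv s t x \<tau>))\<^sup>2 / 2 + q (x \<tau>)))"
      by (intro ennreal_leI) simp
    also have "\<dots> \<le> action (V, \<alpha>) s t x"
      by (rule action_ge_integral[OF v q])
    finally have "ennreal (?D - e) + ennreal e \<le> action (V, \<alpha>) s t x + ennreal e"
      by (rule add_right_mono)
    moreover have "ennreal ?D \<le> ennreal (?D - e) + ennreal e"
    proof (cases "e \<le> ?D")
      case True
      then show ?thesis using e by (subst ennreal_plus[symmetric]) auto
    next
      case False
      then have "ennreal ?D \<le> ennreal e" by (intro ennreal_leI) simp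
      then show ?thesis by (simp add: add_increasing)
    qed
    ultimately show "ennreal ?D \<le> action (V, \<alpha>) s t x + ennreal e" by (rule order_trans[rotated])
  qed
  then show "ennreal (sqrt 2 / b * (f (x t) - f (x s))) \<le> action (V, \<alpha>) s t x"
    by (simp add: xe)
qed

section \<open>Uniqueness of the weak derivative and polygonal paths\<close>

text \<open>
The integral vanishes on half-lines, which form an intersection-stable generator of the Borel sets,
hence on all Borel sets, and then on all Lebesgue sets because these differ from Borel sets by null sets.
\<close>

lemma AE_zero_if_indefinite_integral_zero:
  fixes d :: "real \<Rightarrow> 'a::euclidean_space"
  assumes d: "d absolutely_integrable_on {a..b}"
    and z: "\<And>t. t \<in> {a..b} \<Longrightarrow> integral {a..t} d = 0"
  shows "AE t in lebesgue. t \<in> {a..b} \<longrightarrow> d t = 0"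
proof -
  let ?d = "\<lambda>t. indicator {a..b} t *\<^sub>R d t"
  have i: "integrable lebesgue ?d" using d by (simp add: set_integrable_def)
  have si: "set_integrable lebesgue A ?d" if "A \<in> sets lebesgue" for A
    using i that unfolding set_integrable_def by (rule integrable_mult_indicator[rotated])
  have Icc: "set_lebesgue_integral lebesgue {..x} ?d = 0" for x
  proof -
    have "set_lebesgue_integral lebesgue {..x} ?d = set_lebesgue_integral lebesgue {a..min x b} d"
      unfolding set_lebesgue_integral_def
      by (intro Bochner_Integration.integral_cong) (auto simp: indicator_def)
    also have "\<dots> = integral {a..min x b} d"
      by (intro set_lebesgue_integral_eq_integral absolutely_integrable_on_subinterval[OF d]) auto
    also have "\<dots> = 0"
      using z[of "min x b"] by (cases "a \<le> min x b") auto
    finally show ?thesis .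
  qed
  have tot: "set_lebesgue_integral lebesgue UNIV ?d = 0"
  proof -
    have "set_lebesgue_integral lebesgue UNIV ?d = set_lebesgue_integral lebesgue {..b} ?d"
      unfolding set_lebesgue_integral_def
      by (intro Bochner_Integration.integral_cong) (auto simp: indicator_def)
    then show ?thesis using Icc by simp
  qed
  have borel: "set_lebesgue_integral lebesgue A ?d = 0" if "A \<in> sets borel" for A
  proof -
    have leb: "B \<in> sets lebesgue" if "B \<in> sigma_sets UNIV (range (\<lambda>a::real. {..a}))" for B
    proof -
      have "B \<in> sets borel"
        using that unfolding borel_eq_atMost by simp
      then show ?thesis by (metis sets_completionI_sets sets_lborel)
    qed
    have "Int_stable (range (\<lambda>a::real. {..a}))"
      by (auto simp: Int_stable_def)
    moreover have "range (\<lambda>a::real. {..a}) \<subseteq> Pow UNIV" by simp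
    moreover have "A \<in> sigma_sets UNIV (range (\<lambda>a::real. {..a}))"
      using that unfolding borel_eq_atMost by simp
    ultimately show ?thesis
    proof (induction rule: sigma_sets_induct_disjoint)
      case (basic A)
      then show ?case using Icc by auto
    next
      case empty
      show ?case by (simp add: set_lebesgue_integral_def)
    next
      case (compl A)
      have A: "A \<in> sets lebesgue" using compl leb by blast
      have "set_lebesgue_integral lebesgue (A \<union> (UNIV - A)) ?d =
          set_lebesgue_integral lebesgue A ?d + set_lebesgue_integral lebesgue (UNIV - A) ?d"
        using A by (intro set_integral_Un si) auto
      then show ?case using compl tot by simp
    next
      case (union A)
      have A: "A i \<in> sets lebesgue" for i using union leb by blast
      have "set_lebesgue_integral lebesgue (\<Union>i. A i) ?d = (\<Sum>i. set_lebesgue_integral lebesgue (A i) ?d)"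
        using A union(1) by (intro lebesgue_integral_countable_add si) (auto simp: disjoint_family_on_def)
      then show ?case using union by simp
    qed
  qed
  have sigma_finite_lebesgue: "sigma_finite_measure (lebesgue :: real measure)"
  proof
    show "\<exists>A. countable A \<and> A \<subseteq> sets (lebesgue :: real measure) \<and> \<Union> A = space lebesgue \<and>
        (\<forall>a\<in>A. emeasure lebesgue a \<noteq> \<infinity>)"
    proof (intro exI[of _ "range (\<lambda>n::nat. {- real n..real n})"] conjI ballI)
      have "x \<in> (\<Union>n::nat. {- real n..real n})" for x
        using real_arch_simple[of "\<bar>x\<bar>"] by (auto simp: abs_le_iff minus_le_iff)
      then show "(\<Union>n::nat. {- real n..real n}) = space lebesgue" by auto
    qed auto
  qed
  have "AE t in lebesgue. ?d t = 0"
  proof (rule sigma_finite_measure.density_zero[OF sigma_finite_lebesgue i])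
    fix A :: "real set" assume A: "A \<in> sets lebesgue"
    then obtain S N N' where S: "A = S \<union> N" "N \<subseteq> N'" "N' \<in> null_sets lborel" "S \<in> sets lborel"
      by (rule sets_completionE)
    have Sl: "S \<in> sets lebesgue" using S(4) by (rule sets_completionI_sets)
    have "set_lebesgue_integral lebesgue A ?d = set_lebesgue_integral lebesgue S ?d"
    proof (rule set_integral_null_delta[OF i A Sl])
      have "N' \<in> null_sets lebesgue" using S(3) by (rule null_sets_completionI)
      moreover have "A - S \<union> (S - A) \<subseteq> N'" using S by auto
      ultimately show "A - S \<union> (S - A) \<in> null_sets lebesgue"
        using null_sets_completion_subset by blast
    qed
    also have "\<dots> = 0" using borel S(4) by simp
    finally show "set_lebesgue_integral lebesgue A ?d = 0" .
  qed
  then show ?thesis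
    by eventually_elim (auto simp: indicator_def)
qed

text \<open>
The action is defined through an arbitrarily chosen weak derivative. Uniqueness up to null sets is
what allows it to be estimated with a known derivative of an explicit path.
\<close>

lemma has_L2_deriv_unique:
  fixes v w :: "real \<Rightarrow> 'a::euclidean_space"
  assumes v: "has_L2_deriv a b x v" and w: "has_L2_deriv a b x w"
  shows "AE t in lebesgue_on {a..b}. v t = w t"
proof -
  note vi = has_L2_derivD(1)[OF v] and wi = has_L2_derivD(1)[OF w]
  have "AE t in lebesgue. t \<in> {a..b} \<longrightarrow> v t - w t = 0"
  proof (rule AE_zero_if_indefinite_integral_zero)
    show "(\<lambda>t. v t - w t) absolutely_integrable_on {a..b}"
      using vi wi by (rule set_integral_diff)
    fix t assume t: "t \<in> {a..b}"
    have "v absolutely_integrable_on {a..t}" "w absolutely_integrable_on {a..t}"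
      using t by (auto intro: absolutely_integrable_on_subinterval[OF vi] absolutely_integrable_on_subinterval[OF wi])
    then have "integral {a..t} (\<lambda>t. v t - w t) = integral {a..t} v - integral {a..t} w"
      by (intro Henstock_Kurzweil_Integration.integral_diff) (auto simp: absolutely_integrable_on_def)
    then show "integral {a..t} (\<lambda>t. v t - w t) = 0"
      using has_L2_derivD(3)[OF v t] has_L2_derivD(3)[OF w t] by simp
  qed
  then show ?thesis
    by (subst AE_restrict_space_iff) auto
qed

lemma has_L2_derivI:
  fixes v :: "real \<Rightarrow> 'a::euclidean_space"
  assumes v: "v absolutely_integrable_on {a..b}" and v2: "(\<lambda>t. (norm (v t))\<^sup>2) absolutely_integrable_on {a..b}"
    and x: "\<And>t. t \<in> {a..b} \<Longrightarrow> x t = x a + integral {a..t} v"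
  shows "has_L2_deriv a b x v"
  unfolding has_L2_deriv_def
proof (intro conjI ballI)
  show "v \<in> borel_measurable (lebesgue_on {a..b})"
    by (rule absolutely_integrable_imp_borel_measurable[OF v]) simp
  show "integrable (lebesgue_on {a..b}) (\<lambda>t. (norm (v t))\<^sup>2)"
    by (rule absolutely_integrable_imp_integrable[OF v2]) simp
  fix t assume t: "t \<in> {a..b}"
  have "v absolutely_integrable_on {a..t}"
    using v t by (intro absolutely_integrable_on_subinterval) auto
  then have "integrable (lebesgue_on {a..t}) v"
    by (intro absolutely_integrable_imp_integrable) auto
  then have "(LINT \<tau>|lebesgue_on {a..t}. v \<tau>) = integral {a..t} v"
    by (intro lebesgue_integral_eq_integral) auto
  then show "x t = x a + (LINT \<tau>|lebesgue_on {a..t}. v \<tau>)" by (metis x t)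
qed

lemma has_L2_deriv_append_segment:
  fixes v :: "real \<Rightarrow> 'a::euclidean_space" and c :: 'a
  assumes v: "has_L2_deriv a T x v" and T: "a \<le> T" and h: "0 \<le> h"
  defines "x' \<equiv> \<lambda>t. if t \<le> T then x t else x T + (t - T) *\<^sub>R c"
    and "v' \<equiv> \<lambda>t. if t \<le> T then v t else c"
  shows "has_L2_deriv a (T + h) x' v'"
proof -
  have AI: "(\<lambda>t. if t \<le> T then f t else k) absolutely_integrable_on {a..T + h}"
    if f: "f absolutely_integrable_on {a..T}" for f :: "real \<Rightarrow> 'b::euclidean_space" and k
  proof (rule absolutely_integrable_on_combine[where c = T])
    show "(\<lambda>t. if t \<le> T then f t else k) absolutely_integrable_on {a..T}"
      by (rule absolutely_integrable_spike[OF f, of "{}"]) auto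
    have "(\<lambda>t. k) absolutely_integrable_on {T..T + h}"
      by (rule absolutely_integrable_continuous_real) auto
    then show "(\<lambda>t. if t \<le> T then f t else k) absolutely_integrable_on {T..T + h}"
      by (rule absolutely_integrable_spike[of _ _ "{T}"]) auto
  qed (use T h in auto)
  have v'i: "v' absolutely_integrable_on {a..T + h}"
    unfolding v'_def by (rule AI[OF has_L2_derivD(1)[OF v]])
  show ?thesis
  proof (rule has_L2_derivI[OF v'i])
    have "(\<lambda>t. (norm (v' t))\<^sup>2) = (\<lambda>t. if t \<le> T then (norm (v t))\<^sup>2 else (norm c)\<^sup>2)"
      by (auto simp: v'_def)
    then show "(\<lambda>t. (norm (v' t))\<^sup>2) absolutely_integrable_on {a..T + h}"
      using AI[OF has_L2_derivD(2)[OF v]] by simp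
    fix t assume t: "t \<in> {a..T + h}"
    have xa: "x' a = x a" using T by (simp add: x'_def)
    have le: "integral {a..s} v' = integral {a..s} v" if "s \<le> T" for s
      by (rule integral_cong) (use that in \<open>auto simp: v'_def\<close>)
    show "x' t = x' a + integral {a..t} v'"
    proof (cases "t \<le> T")
      case True
      then have "x t = x a + integral {a..t} v" using t by (intro has_L2_derivD(3)[OF v]) auto
      then show ?thesis using True by (simp only: xa le) (simp add: x'_def)
    next
      case False
      have xT: "x T = x a + integral {a..T} v" using T by (intro has_L2_derivD(3)[OF v]) auto
      have "v' absolutely_integrable_on {a..t}"
        using t by (intro absolutely_integrable_on_subinterval[OF v'i]) auto
      then have "integral {a..T} v' + integral {T..t} v' = integral {a..t} v'"
        using T False by (intro Henstock_Kurzweil_Integration.integral_combine) (auto simp: absolutely_integrable_on_def)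
      moreover have "integral {T..t} v' = integral {T..t} (\<lambda>_. c)"
        by (rule integral_spike[of "{T}"]) (auto simp: v'_def)
      ultimately have "integral {a..t} v' = integral {a..T} v + (t - T) *\<^sub>R c"
        using le[of T] False by simp
      moreover have "x' t = x T + (t - T) *\<^sub>R c" using False by (simp add: x'_def)
      ultimately show ?thesis using xT xa by (metis add.assoc)
    qed
  qed
qed

text \<open>
The energy of the path is dominated by an integrable function \<open>e\<close> instead of being integrated itself.
This way pieces of a path can be joined without discussing the measurability of the potential along
the path.
\<close>

definition path_of_cost :: "('a::euclidean_space \<Rightarrow> ennreal) \<Rightarrow> 'a \<Rightarrow> 'a \<Rightarrow> real \<Rightarrow> bool" where
  "path_of_cost P y z K \<longleftrightarrow> (\<exists>T\<ge>0. \<exists>x v e. has_L2_deriv 0 T x v \<and> x 0 = y \<and> x T = z \<and>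
     e absolutely_integrable_on {0..T} \<and> integral {0..T} e \<le> K \<and>
     (\<forall>t. 0 \<le> e t) \<and> (\<forall>t\<in>{0..T}. ennreal ((norm (v t))\<^sup>2 / 2) + P (x t) \<le> ennreal (e t)))"

lemma path_of_cost_refl:
  assumes K: "0 \<le> K" and P: "P y < \<infinity>"
  shows "path_of_cost P y y K"
proof -
  have "has_L2_deriv 0 0 (\<lambda>_. y) (\<lambda>_. 0 :: 'a)"
    by (rule has_L2_derivI) (auto intro: absolutely_integrable_on_null)
  moreover have "(\<lambda>_. enn2real (P y)) absolutely_integrable_on {0..0::real}"
    by (rule absolutely_integrable_continuous_real) auto
  moreover have "P y = ennreal (enn2real (P y))"
    using P by simp
  ultimately show ?thesis
    unfolding path_of_cost_def using K
    by (intro exI[of _ "0::real"] conjI exI[of _ "\<lambda>_. y"] exI[of _ "\<lambda>_. 0 :: 'a"] exI[of _ "\<lambda>_. enn2real (P y)"]) auto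
qed

lemma path_of_cost_append_segment:
  assumes p: "path_of_cost P x y K" and M: "0 < M"
    and P: "\<And>w. w \<in> closed_segment y z \<Longrightarrow> P w \<le> ennreal M"
    and K': "K + dist y z * sqrt (2 * M) \<le> K'"
  shows "path_of_cost P x z K'"
proof -
  obtain T X v e where h: "T \<ge> 0" "has_L2_deriv 0 T X v" "X 0 = x" "X T = y"
    "e absolutely_integrable_on {0..T}" "integral {0..T} e \<le> K"
    "\<And>t. 0 \<le> e t" "\<And>t. t \<in> {0..T} \<Longrightarrow> ennreal ((norm (v t))\<^sup>2 / 2) + P (X t) \<le> ennreal (e t)"
    using p unfolding path_of_cost_def by blast
  \<comment> \<open>The segment is run at the speed for which kinetic and potential bounds agree.\<close>
  define S where "S = dist y z / sqrt (2 * M)"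
  define c where "c = (sqrt (2 * M) / dist y z) *\<^sub>R (z - y)"
  define e' where "e' = (\<lambda>t. if t \<le> T then e t else 2 * M)"
  define X' where "X' = (\<lambda>t. if t \<le> T then X t else X T + (t - T) *\<^sub>R c)"
  define v' where "v' = (\<lambda>t. if t \<le> T then v t else c)"
  have S: "S \<ge> 0" using M by (simp add: S_def)
  have end_pt: "X' (T + S) = z"
  proof (cases "y = z")
    case False
    then have "0 < S" using M by (simp add: S_def)
    moreover have "S *\<^sub>R c = z - y" using False M by (simp add: S_def c_def)
    ultimately show ?thesis using h(4) by (simp add: X'_def)
  qed (use h(4) in \<open>simp add: X'_def S_def c_def\<close>)
  have e1: "e' absolutely_integrable_on {0..T}"
    by (rule absolutely_integrable_spike[OF h(5), of "{}"]) (auto simp: e'_def)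
  have "(\<lambda>t. 2 * M) absolutely_integrable_on {T..T + S}"
    by (rule absolutely_integrable_continuous_real) auto
  then have e2: "e' absolutely_integrable_on {T..T + S}"
    by (rule absolutely_integrable_spike[of _ _ "{T}"]) (auto simp: e'_def)
  have e: "e' absolutely_integrable_on {0..T + S}"
    using absolutely_integrable_on_combine[OF e1 e2] h(1) S by simp
  have "integral {0..T + S} e' = integral {0..T} e' + integral {T..T + S} e'"
    using e h(1) S
    by (intro Henstock_Kurzweil_Integration.integral_combine[symmetric]) (auto simp: absolutely_integrable_on_def)
  also have "integral {0..T} e' = integral {0..T} e"
    by (rule integral_cong) (auto simp: e'_def)
  also have "integral {T..T + S} e' = integral {T..T + S} (\<lambda>_. 2 * M)"
    by (rule integral_spike[of "{T}"]) (auto simp: e'_def)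
  also have "\<dots> = dist y z * sqrt (2 * M)"
    using S M by (simp add: S_def) (simp add: field_simps)
  finally have int: "integral {0..T + S} e' \<le> K'" using h(6) K' by linarith
  have pt: "ennreal ((norm (v' t))\<^sup>2 / 2) + P (X' t) \<le> ennreal (e' t)" if t: "t \<in> {0..T + S}" for t
  proof (cases "t \<le> T")
    case True
    then show ?thesis using h(8)[of t] t by (simp add: v'_def X'_def e'_def)
  next
    case False
    then have yz: "y \<noteq> z" using t by (auto simp: S_def)
    define u where "u = (t - T) * (sqrt (2 * M) / dist y z)"
    have u: "0 \<le> u" "u \<le> 1" using False t M yz by (auto simp: u_def S_def field_simps)
    have "X' t = (1 - u) *\<^sub>R y + u *\<^sub>R z"
      using False h(4) by (simp add: X'_def c_def u_def algebra_simps)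
    then have "P (X' t) \<le> ennreal M" using u by (intro P) (auto simp: in_segment)
    moreover have "(norm (v' t))\<^sup>2 / 2 = M"
      using False yz M by (simp add: v'_def c_def dist_norm norm_minus_commute power_mult_distrib power_divide)
    ultimately have "ennreal ((norm (v' t))\<^sup>2 / 2) + P (X' t) \<le> ennreal M + ennreal M"
      by (simp add: add_left_mono)
    also have "\<dots> = ennreal (e' t)"
      using False M by (simp add: e'_def flip: ennreal_plus)
    finally show ?thesis .
  qed
  have "has_L2_deriv 0 (T + S) X' v'"
    unfolding X'_def v'_def by (rule has_L2_deriv_append_segment[OF h(2,1) S])
  moreover have "X' 0 = x" using h by (simp add: X'_def)
  moreover have "\<forall>t. 0 \<le> e' t" using h(7) M by (simp add: e'_def)
  ultimately show ?thesis
    unfolding path_of_cost_def using end_pt e int pt h(1) S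
    by (intro exI[of _ "T + S"] conjI exI[of _ X'] exI[of _ v'] exI[of _ e']) auto
qed

lemma path_of_cost_imp_min_action_le:
  assumes p: "path_of_cost (potential p) y z K" and yz: "y \<noteq> z"
  shows "min_action y z p \<le> ennreal K"
proof -
  obtain T X v e where h: "T \<ge> 0" "has_L2_deriv 0 T X v" "X 0 = y" "X T = z"
    "e absolutely_integrable_on {0..T}" "integral {0..T} e \<le> K"
    "\<And>t. 0 \<le> e t" "\<And>t. t \<in> {0..T} \<Longrightarrow> ennreal ((norm (v t))\<^sup>2 / 2) + potential p (X t) \<le> ennreal (e t)"
    using p unfolding path_of_cost_def by blast
  have T: "0 < T" using h yz by (cases "T = 0") auto
  have H1: "X \<in> H1 0 T" using h(2) by (auto simp: H1_def)
  have w: "has_L2_deriv 0 T X (L2_deriv 0 T X)"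
    unfolding L2_deriv_def using h(2) by (rule someI[of "has_L2_deriv 0 T X"])
  have "action p 0 T X \<le> (\<integral>\<^sup>+t. ennreal (e t) \<partial>lebesgue_on {0..T})"
    unfolding action_def
  proof (rule nn_integral_mono_AE)
    show "AE t in lebesgue_on {0..T}. ennreal ((norm (L2_deriv 0 T X t))\<^sup>2 / 2) + potential p (X t) \<le> ennreal (e t)"
      using has_L2_deriv_unique[OF h(2) w] AE_space
    proof eventually_elim
      case (elim t)
      then show ?case using h(8)[of t] by simp
    qed
  qed
  also have "\<dots> = ennreal (LINT t|lebesgue_on {0..T}. e t)"
    using h(5,7) by (intro nn_integral_eq_integral absolutely_integrable_imp_integrable) auto
  also have "(LINT t|lebesgue_on {0..T}. e t) = integral {0..T} e"
    by (intro lebesgue_integral_eq_integral absolutely_integrable_imp_integrable h(5)) auto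
  also have "ennreal (integral {0..T} e) \<le> ennreal K"
    using h(6) by (rule ennreal_leI)
  finally have "action p 0 T X \<le> ennreal K" .
  moreover have "min_action y z p \<le> action p 0 T X"
    unfolding min_action_def using T H1 h by (intro Inf_lower) blast
  ultimately show ?thesis by (rule order_trans[rotated])
qed

section \<open>Costs of polygonal chains\<close>

text \<open>
Polygonal chains that avoid the origin, with the cost of each segment bounded by length times
\<open>\<surd>(2 M)\<close> for an upper bound \<open>M\<close> of the potential on it, which bounds the action at constant speed \<open>\<surd>(2 M)\<close>.
The last argument is an upper bound for the cost. In contrast to curves with their time
parametrization, chains can be concatenated and rescaled without effort.
\<close>

inductive reach :: "('a::euclidean_space \<Rightarrow> real) \<Rightarrow> 'a \<Rightarrow> 'a \<Rightarrow> real \<Rightarrow> bool" for W where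
  stay: "0 \<le> K \<Longrightarrow> reach W x x K"
| step: "reach W x y K \<Longrightarrow> 0 \<notin> closed_segment y z \<Longrightarrow> 0 < M \<Longrightarrow>
    (\<And>w. w \<in> closed_segment y z \<Longrightarrow> W w \<le> M) \<Longrightarrow> K + dist y z * sqrt (2 * M) \<le> K' \<Longrightarrow> reach W x z K'"

lemma reach_mono:
  assumes "reach W x y K" "K \<le> K'"
  shows "reach W x y K'"
  using assms
proof (induction arbitrary: K')
  case (stay K x)
  then show ?case by (intro reach.stay) simp
next
  case (step x y K z M K'')
  show ?case using step.hyps(1-3) step.hyps(4) by (rule reach.step) (use step in auto)
qed

lemma reach_nonneg: "reach W x y K \<Longrightarrow> 0 \<le> K"
proof (induction rule: reach.induct)
  case (step x y K z M K')
  have "0 \<le> dist y z * sqrt (2 * M)" using step by simp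
  then show ?case using step by linarith
qed

lemma reach_trans:
  assumes "reach W y z L" "reach W x y K"
  shows "reach W x z (K + L)"
  using assms
proof (induction)
  case (stay L y)
  then show ?case by (auto intro: reach_mono)
next
  case (step y w L z M L')
  have "reach W x w (K + L)" using step by blast
  then show ?case using step.hyps(2-4) by (rule reach.step) (use step in auto)
qed

lemma reach_segment:
  assumes "0 \<notin> closed_segment y z" "0 < M" "\<And>w. w \<in> closed_segment y z \<Longrightarrow> W w \<le> M"
    and "dist y z * sqrt (2 * M) \<le> K"
  shows "reach W y z K"
  by (rule reach.step[OF reach.stay[of 0] assms(1-3)]) (use assms(4) in auto)

lemma reach_imp_path_of_cost:
  assumes "reach W x y K" and P: "\<And>w. w \<noteq> 0 \<Longrightarrow> P w = ennreal (W w)" and x: "x \<noteq> 0"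
  shows "path_of_cost P x y K"
  using assms(1) x
proof (induction)
  case (stay K x)
  then show ?case using P by (intro path_of_cost_refl) auto
next
  case (step x y K z M K')
  have "path_of_cost P x y K" using step by blast
  then show ?case using step.hyps(3) _ step.hyps(5)
  proof (rule path_of_cost_append_segment)
    fix w assume w: "w \<in> closed_segment y z"
    then have "w \<noteq> 0" using step.hyps by auto
    then show "P w \<le> ennreal M" using P step.hyps(4)[OF w] by (simp add: ennreal_leI)
  qed
qed

definition homog_pot :: "'a::euclidean_space C2_sphere \<Rightarrow> real \<Rightarrow> 'a \<Rightarrow> real" where
  "homog_pot V \<alpha> y = C2_fun V (y /\<^sub>R norm y) / norm y powr \<alpha>"

lemma homog_pot_scale:
  assumes "r > 0"
  shows "homog_pot V \<alpha> (r *\<^sub>R y) = r powr (- \<alpha>) * homog_pot V \<alpha> y"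
  unfolding homog_pot_def normalize_scaleR[OF assms]
  using assms by (simp add: powr_mult powr_minus divide_inverse)

lemma homog_pot_sphere: "norm s = 1 \<Longrightarrow> homog_pot V \<alpha> s = C2_fun V s"
  by (simp add: homog_pot_def)

lemma homog_pot_continuous: "continuous_on (- {0}) (homog_pot V \<alpha>)"
proof (rule continuous_on_eq)
  show "continuous_on (- {0}) (\<lambda>y. hom0 (C2_fun V) y / norm y powr \<alpha>)"
    by (intro continuous_intros hom0_continuous) auto
qed (auto simp: homog_pot_def hom0_def)

lemma reach_imp_min_action_le:
  assumes "reach (homog_pot V \<alpha>) x y K" "x \<noteq> 0" "x \<noteq> y"
  shows "min_action x y (V, \<alpha>) \<le> ennreal K"
  using assms(1) _ assms(2)
  by (rule path_of_cost_imp_min_action_le[OF reach_imp_path_of_cost]) (auto simp: homog_pot_def assms(3))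

text \<open>
The potential scales with exponent \<open>- \<alpha>\<close>, its square root with \<open>- \<alpha> / 2\<close>, and lengths with exponent \<open>1\<close>.
\<close>

lemma reach_scale:
  assumes "reach (homog_pot V \<alpha>) x y K" and r: "r > 0"
  shows "reach (homog_pot V \<alpha>) (r *\<^sub>R x) (r *\<^sub>R y) (r powr (1 - \<alpha> / 2) * K)"
  using assms(1)
proof (induction)
  case (stay K x)
  then show ?case by (intro reach.stay) auto
next
  case (step x y K z M K')
  have seg: "closed_segment (r *\<^sub>R y) (r *\<^sub>R z) = (*\<^sub>R) r ` closed_segment y z"
    by (rule closed_segment_linear_image) (rule linear_scale_self)
  from step.IH show ?case
  proof (rule reach.step)
    show "0 \<notin> closed_segment (r *\<^sub>R y) (r *\<^sub>R z)"
      using step.hyps(2) r by (auto simp: seg)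
    show "0 < r powr (- \<alpha>) * M" using r step.hyps by simp
    show "homog_pot V \<alpha> w \<le> r powr (- \<alpha>) * M" if "w \<in> closed_segment (r *\<^sub>R y) (r *\<^sub>R z)" for w
      using that step.hyps(4) r by (auto simp: seg homog_pot_scale)
    have "sqrt (r powr - \<alpha>) = r powr (- \<alpha> / 2)"
      using r by (simp add: powr_half_sqrt[symmetric] powr_powr)
    then have "dist (r *\<^sub>R y) (r *\<^sub>R z) * sqrt (2 * (r powr - \<alpha> * M)) = (r * r powr (- \<alpha> / 2)) * (dist y z * sqrt (2 * M))"
      using r by (simp add: dist_norm real_sqrt_mult flip: scaleR_diff_right)
    also have "r * r powr (- \<alpha> / 2) = r powr (1 - \<alpha> / 2)"
      using r powr_add[of r 1 "- \<alpha> / 2"] by simp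
    finally have "r powr (1 - \<alpha> / 2) * K + dist (r *\<^sub>R y) (r *\<^sub>R z) * sqrt (2 * (r powr - \<alpha> * M)) =
        r powr (1 - \<alpha> / 2) * (K + dist y z * sqrt (2 * M))"
      by (simp add: distrib_left)
    also have "\<dots> \<le> r powr (1 - \<alpha> / 2) * K'"
      using step.hyps(5) by (intro mult_left_mono) auto
    finally show "r powr (1 - \<alpha> / 2) * K + dist (r *\<^sub>R y) (r *\<^sub>R z) * sqrt (2 * (r powr - \<alpha> * M)) \<le> r powr (1 - \<alpha> / 2) * K'" .
  qed
qed

lemma reach_local:
  assumes y: "y \<noteq> 0" and W: "0 \<le> homog_pot V \<alpha> y" and K: "sqrt (2 * homog_pot V \<alpha> y) < K"
  obtains d where "d > 0" "\<And>x z. x \<in> ball y d \<Longrightarrow> z \<in> ball y d \<Longrightarrow> reach (homog_pot V \<alpha>) x z (K * dist x z)"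
proof -
  define M where "M = K\<^sup>2 / 2"
  have K0: "0 < K" using K W by (smt (verit) real_sqrt_ge_zero)
  have "2 * homog_pot V \<alpha> y < K\<^sup>2"
    using K K0 by (metis real_sqrt_less_iff real_sqrt_abs abs_of_pos)
  then have M: "homog_pot V \<alpha> y < M" "M > 0" "sqrt (2 * M) = K" using K0 by (auto simp: M_def)
  have "isCont (homog_pot V \<alpha>) y"
    using homog_pot_continuous[of V \<alpha>] y by (simp add: continuous_on_eq_continuous_at open_Compl)
  then have "\<forall>\<^sub>F w in nhds y. homog_pot V \<alpha> w < M"
    using M(1) by (intro order_tendstoD(2)[of _ "homog_pot V \<alpha> y"]) (auto simp: isCont_def tendsto_at_iff_tendsto_nhds)
  moreover have "\<forall>\<^sub>F w in nhds y. w \<noteq> 0"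
    using y by (rule t1_space_nhds)
  ultimately have "\<forall>\<^sub>F w in nhds y. homog_pot V \<alpha> w < M \<and> w \<noteq> 0"
    by (rule eventually_conj)
  then obtain d where d: "d > 0" "\<And>w. dist w y < d \<Longrightarrow> homog_pot V \<alpha> w < M \<and> w \<noteq> 0"
    unfolding eventually_nhds_metric by blast
  show thesis
  proof (rule that[OF d(1)])
    fix x z assume xz: "x \<in> ball y d" "z \<in> ball y d"
    then have "closed_segment x z \<subseteq> ball y d"
      by (intro closed_segment_subset) auto
    then have w: "homog_pot V \<alpha> w < M \<and> w \<noteq> 0" if "w \<in> closed_segment x z" for w
      using that d(2)[of w] by (auto simp: dist_commute)
    show "reach (homog_pot V \<alpha>) x z (K * dist x z)"
      by (rule reach_segment[OF _ M(2)]) (use w M(3) in \<open>auto simp: less_imp_le\<close>)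
  qed
qed

text \<open>
The punctured space is connected in dimension at least \<open>2\<close>. A fixed chain stays away from the origin,
so the potentials for all exponents in \<open>(0, 2)\<close> are bounded on it simultaneously; this uniformity is
what later keeps the critical exponent away from \<open>2\<close>.
\<close>

lemma reach_uniform:
  fixes V :: "'a::euclidean_space C2_sphere"
  assumes dim: "DIM('a) \<ge> 2" and xy: "x \<noteq> 0" "y \<noteq> 0"
  shows "\<exists>K. \<forall>\<alpha>\<in>{0<..<2}. reach (homog_pot V \<alpha>) x y K"
proof -
  define R where "R x y \<longleftrightarrow> (\<exists>K. \<forall>\<alpha>\<in>{0<..<2}. reach (homog_pot V \<alpha>) x y K \<and> reach (homog_pot V \<alpha>) y x K)"
    for x y
  obtain B where B: "B > 0" "\<And>s. s \<in> sphere 0 1 \<Longrightarrow> C2_fun V s \<le> B" using C2_fun_bound by blast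
  have "R x y"
  proof (rule connected_equivalence_relation[where R = R, OF connected_punctured_universe[OF dim, of 0]])
    fix x y z :: 'a assume "R x y" "R y z"
    then obtain K L where K: "\<And>\<alpha>. \<alpha> \<in> {0<..<2} \<Longrightarrow> reach (homog_pot V \<alpha>) x y K \<and> reach (homog_pot V \<alpha>) y x K"
      and L: "\<And>\<alpha>. \<alpha> \<in> {0<..<2} \<Longrightarrow> reach (homog_pot V \<alpha>) y z L \<and> reach (homog_pot V \<alpha>) z y L"
      unfolding R_def by blast
    have "reach (homog_pot V \<alpha>) x z (K + L) \<and> reach (homog_pot V \<alpha>) z x (K + L)" if "\<alpha> \<in> {0<..<2}" for \<alpha>
      using reach_trans[of _ y z L x K] reach_trans[of _ y x K z L] K[OF that] L[OF that]
      by (simp add: add.commute)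
    then show "R x z" unfolding R_def by blast
  next
    fix a :: 'a assume a: "a \<in> - {0}"
    define \<rho> where "\<rho> = min 1 (norm a / 2)"
    have \<rho>: "0 < \<rho>" "\<rho> \<le> 1" "\<rho> \<le> norm a / 2" using a by (auto simp: \<rho>_def)
    define M where "M = B / \<rho>\<^sup>2"
    have M: "M > 0" using B \<rho> by (simp add: M_def)
    have far: "\<rho> \<le> norm w" if "w \<in> ball a \<rho>" for w
    proof -
      have "norm a \<le> norm w + dist a w" by (metis dist_norm norm_triangle_sub)
      then show ?thesis using that \<rho> by simp
    qed
    have bound: "homog_pot V \<alpha> w \<le> M" if "w \<in> ball a \<rho>" "\<alpha> \<in> {0<..<2}" for w \<alpha>
    proof -
      have "\<rho>\<^sup>2 = \<rho> powr 2" using \<rho> by simp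
      also have "\<dots> \<le> \<rho> powr \<alpha>" using \<rho> that by (intro powr_mono') auto
      also have "\<dots> \<le> norm w powr \<alpha>" using far[OF that(1)] \<rho> that by (intro powr_mono2) auto
      finally have "\<rho>\<^sup>2 \<le> norm w powr \<alpha>" .
      moreover have "w \<noteq> 0" using far[OF that(1)] \<rho> by auto
      ultimately show ?thesis
        unfolding homog_pot_def M_def using B \<rho> by (intro frac_le) auto
    qed
    show "\<exists>T. openin (top_of_set (- {0})) T \<and> a \<in> T \<and> (\<forall>x\<in>T. R a x)"
    proof (intro exI[of _ "ball a \<rho>"] conjI ballI)
      have "ball a \<rho> \<subseteq> - {0}" using far \<rho> by fastforce
      then show "openin (top_of_set (- {0})) (ball a \<rho>)"
        by (intro open_subset) auto
      show "a \<in> ball a \<rho>" using \<rho> by simp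
      fix x assume x: "x \<in> ball a \<rho>"
      have seg: "closed_segment a x \<subseteq> ball a \<rho>"
        using x \<rho> by (intro closed_segment_subset) auto
      have "reach (homog_pot V \<alpha>) a x (dist a x * sqrt (2 * M)) \<and> reach (homog_pot V \<alpha>) x a (dist a x * sqrt (2 * M))"
        if "\<alpha> \<in> {0<..<2}" for \<alpha>
      proof -
        have z: "0 \<notin> closed_segment a x" using seg far[of 0] \<rho> by auto
        have b: "homog_pot V \<alpha> w \<le> M" if "w \<in> closed_segment a x" for w
          using bound seg that \<open>\<alpha> \<in> _\<close> by blast
        show ?thesis
          using reach_segment[OF z M b] reach_segment[of x a M "homog_pot V \<alpha>"] z M b
          by (auto simp: closed_segment_commute dist_commute)
      qed
      then show "R a x" unfolding R_def by blast
    qed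
  next
    show "x \<in> - {0}" "y \<in> - {0}" using xy by auto
    show "R y x" if "R x y" for x y using that unfolding R_def by blast
  qed
  then show ?thesis unfolding R_def by blast
qed

text \<open>
On the ray through a point of the sphere with \<open>V = m\<close>, the Jacobi length is the integral of
\<open>\<surd>(2 m) r\<^bsup>b - 1\<^esup>\<close>. Chains with small steps approximate it: the local cost bound is compared with the
increment of the primitive, and the local comparisons are combined by bisection.
\<close>

lemma reach_radial:
  fixes V :: "'a::euclidean_space C2_sphere"
  assumes s: "norm s = 1" "C2_fun V s = m" and m: "m > 0" and a: "0 < \<alpha>" "\<alpha> < 2"
    and pq: "0 < p" "p \<le> q" and e: "e > 0" and b: "b = 1 - \<alpha> / 2"
  defines "c \<equiv> sqrt (2 * m) / b * (q powr b - p powr b) + e"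
  shows "reach (homog_pot V \<alpha>) (p *\<^sub>R s) (q *\<^sub>R s) c" "reach (homog_pot V \<alpha>) (q *\<^sub>R s) (p *\<^sub>R s) c"
proof -
  define F where "F = (\<lambda>r. sqrt (2 * m) / b * r powr b)"
  \<comment> \<open>Error allowed per unit of radius. One is added because \<open>q = p\<close> is possible.\<close>
  define n where "n = e / (q - p + 1)"
  have n: "n > 0" using e pq by (simp add: n_def)
  have b0: "b > 0" using a b by simp
  let ?W = "homog_pot V \<alpha>"
  let ?P = "\<lambda>x y. p \<le> x \<longrightarrow> reach ?W (x *\<^sub>R s) (y *\<^sub>R s) (F y - F x + n * (y - x)) \<and>
      reach ?W (y *\<^sub>R s) (x *\<^sub>R s) (F y - F x + n * (y - x))"
  have dF: "(F has_real_derivative sqrt (2 * m) * r powr (b - 1)) (at r)" if "r > 0" for r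
    unfolding F_def using that b0 by (auto intro!: derivative_eq_intros)
  have "?P p q"
    using pq(2)
  proof (induction rule: Bolzano[where P = ?P])
    case (trans x y z)
    show ?case
    proof
      assume "p \<le> x"
      then have "reach ?W (x *\<^sub>R s) (z *\<^sub>R s) (F y - F x + n * (y - x) + (F z - F y + n * (z - y)))"
        "reach ?W (z *\<^sub>R s) (x *\<^sub>R s) (F z - F y + n * (z - y) + (F y - F x + n * (y - x)))"
        using trans by (blast intro: reach_trans order_trans)+
      moreover have "F y - F x + n * (y - x) + (F z - F y + n * (z - y)) = F z - F x + n * (z - x)"
        "F z - F y + n * (z - y) + (F y - F x + n * (y - x)) = F z - F x + n * (z - x)"
        by (simp_all add: algebra_simps)
      ultimately show "reach ?W (x *\<^sub>R s) (z *\<^sub>R s) (F z - F x + n * (z - x)) \<and>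
          reach ?W (z *\<^sub>R s) (x *\<^sub>R s) (F z - F x + n * (z - x))"
        by simp
    qed
  next
    case (local r)
    have r: "r > 0" using local pq by simp
    define k where "k = sqrt (2 * m) * r powr (b - 1)"
    have Wr: "sqrt (2 * ?W (r *\<^sub>R s)) = k"
    proof -
      have "r powr (b - 1) = sqrt (r powr (- \<alpha>))"
        using r b by (simp add: powr_half_sqrt[symmetric] powr_powr)
      then show ?thesis
        using r s by (simp add: homog_pot_scale homog_pot_sphere k_def real_sqrt_mult)
    qed
    obtain d1 where d1: "d1 > 0"
      "\<And>x z. x \<in> ball (r *\<^sub>R s) d1 \<Longrightarrow> z \<in> ball (r *\<^sub>R s) d1 \<Longrightarrow> reach ?W x z ((k + n / 2) * dist x z)"
    proof (rule reach_local[of "r *\<^sub>R s" V \<alpha> "k + n / 2"])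
      show "r *\<^sub>R s \<noteq> 0" using r s by auto
      show "0 \<le> ?W (r *\<^sub>R s)" using r s m by (simp add: homog_pot_scale homog_pot_sphere)
      show "sqrt (2 * ?W (r *\<^sub>R s)) < k + n / 2" using Wr n by simp
    qed (use that in blast)
    have "isCont (\<lambda>z. sqrt (2 * m) * z powr (b - 1)) r"
      using r by (intro continuous_intros) auto
    then have "\<forall>\<^sub>F z in at r. dist (sqrt (2 * m) * z powr (b - 1)) k < n / 2"
      unfolding isCont_def k_def using n by (intro tendstoD) auto
    then obtain d2 where d2: "d2 > 0"
      "\<And>z. dist z r < d2 \<Longrightarrow> dist (sqrt (2 * m) * z powr (b - 1)) k < n / 2"
      unfolding eventually_at k_def using n by (metis UNIV_I dist_self half_gt_zero)
    show ?case
    proof (intro exI[of _ "min d1 d2"] conjI allI impI)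
      show "0 < min d1 d2" using d1 d2 by simp
    next
      fix x y assume xy: "x \<le> r \<and> r \<le> y \<and> y - x < min d1 d2" and px: "p \<le> x"
      have D: "(k + n / 2) * (y - x) \<le> F y - F x + n * (y - x)"
      proof (cases "x = y")
        case False
        then have "x < y" using xy by linarith
        moreover have "(F has_real_derivative sqrt (2 * m) * z powr (b - 1)) (at z)" if "x \<le> z" "z \<le> y" for z
          using that px pq by (intro dF) auto
        ultimately obtain z where z: "x < z" "z < y" "F y - F x = (y - x) * (sqrt (2 * m) * z powr (b - 1))"
          using MVT2[of x y F "\<lambda>z. sqrt (2 * m) * z powr (b - 1)"] by blast
        have "dist (sqrt (2 * m) * z powr (b - 1)) k < n / 2"
          using z xy by (intro d2) (auto simp: dist_real_def)
        then have "k - n / 2 \<le> sqrt (2 * m) * z powr (b - 1)"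
          unfolding dist_real_def by linarith
        then have "(y - x) * (k - n / 2) \<le> F y - F x"
          unfolding z(3) using \<open>x < y\<close> by (intro mult_left_mono) auto
        moreover have "(k + n / 2) * (y - x) = (y - x) * (k - n / 2) + n * (y - x)"
          by (simp add: field_simps)
        ultimately show ?thesis by linarith
      qed simp
      have dr: "dist (r *\<^sub>R s) (t *\<^sub>R s) = \<bar>r - t\<bar>" for t
        using s by (simp add: dist_norm flip: scaleR_diff_left)
      have in_ball: "x *\<^sub>R s \<in> ball (r *\<^sub>R s) d1" "y *\<^sub>R s \<in> ball (r *\<^sub>R s) d1"
        unfolding mem_ball dr using xy by auto
      have dd: "dist (x *\<^sub>R s) (y *\<^sub>R s) = y - x" "dist (y *\<^sub>R s) (x *\<^sub>R s) = y - x"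
        using s xy by (auto simp: dist_norm simp flip: scaleR_diff_left)
      show "reach ?W (x *\<^sub>R s) (y *\<^sub>R s) (F y - F x + n * (y - x))"
        using d1(2)[OF in_ball] D unfolding dd by (rule reach_mono)
      show "reach ?W (y *\<^sub>R s) (x *\<^sub>R s) (F y - F x + n * (y - x))"
        using d1(2)[OF in_ball(2,1)] D unfolding dd by (rule reach_mono)
    qed
  qed
  moreover have "F q - F p + n * (q - p) \<le> c"
  proof -
    have "n * (q - p) \<le> e" using e pq by (simp add: n_def field_simps)
    then show ?thesis by (simp add: F_def c_def right_diff_distrib)
  qed
  ultimately show "reach ?W (p *\<^sub>R s) (q *\<^sub>R s) c" "reach ?W (q *\<^sub>R s) (p *\<^sub>R s) c"
    by (auto intro: reach_mono)
qed

text \<open>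
Go in along one ray to a small radius \<open>r\<close>, change rays there, and go out. By scaling, the change costs
\<open>r\<^sup>b\<close> times a constant, and the two radial parts together cost less than the threshold.
\<close>

lemma reach_threshold:
  fixes V :: "'a::euclidean_space C2_sphere"
  assumes dim: "DIM('a) \<ge> 2" and x: "norm xm = 1" "norm xp = 1"
    and V: "C2_fun V xm = m" "C2_fun V xp = m" and m: "m > 0" and a: "0 < \<alpha>" "\<alpha> < 2"
    and e: "e > 0"
  shows "reach (homog_pot V \<alpha>) xm xp (4 * sqrt (2 * m) / (2 - \<alpha>) + e)"
proof -
  define b where "b = 1 - \<alpha> / 2"
  have b0: "b > 0" using a by (simp add: b_def)
  let ?W = "homog_pot V \<alpha>"
  have "xm \<noteq> 0" "xp \<noteq> 0" using x by auto
  then obtain K where "\<forall>\<alpha>\<in>{0<..<2}. reach (homog_pot V \<alpha>) xm xp K"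
    using reach_uniform[OF dim, of xm xp V] by blast
  then have K: "reach ?W xm xp K" using a by simp
  define r where "r = min 1 ((e / 2 / (K + 1)) powr (1 / b))"
  have K0: "K \<ge> 0" using K by (rule reach_nonneg)
  have r: "0 < r" "r \<le> 1" using e K0 by (auto simp: r_def)
  have "r powr b \<le> ((e / 2 / (K + 1)) powr (1 / b)) powr b"
    using r b0 by (intro powr_mono2) (auto simp: r_def)
  also have "\<dots> = e / 2 / (K + 1)" using e K0 b0 by (simp add: powr_powr)
  finally have "r powr b * (K + 1) \<le> e / 2" using K0 by (simp add: field_simps)
  moreover have "r powr b * K \<le> r powr b * (K + 1)" by (intro mult_left_mono) auto
  ultimately have rK: "r powr b * K \<le> e / 2" by linarith
  let ?c = "sqrt (2 * m) / b * (1 powr b - r powr b) + e / 4"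
  have 1: "reach ?W (1 *\<^sub>R xm) (r *\<^sub>R xm) ?c"
    using e by (intro reach_radial x V m a r b_def) auto
  have 2: "reach ?W (r *\<^sub>R xm) (r *\<^sub>R xp) (r powr b * K)"
    unfolding b_def by (rule reach_scale[OF K r(1)])
  have 3: "reach ?W (r *\<^sub>R xp) (1 *\<^sub>R xp) ?c"
    using e by (intro reach_radial x V m a r b_def) auto
  have "reach ?W (1 *\<^sub>R xm) (1 *\<^sub>R xp) (?c + (r powr b * K + ?c))"
    using reach_trans[OF reach_trans[OF 3 2] 1] .
  moreover have "?c + (r powr b * K + ?c) \<le> 4 * sqrt (2 * m) / (2 - \<alpha>) + e"
  proof -
    have "sqrt (2 * m) / b * (1 powr b - r powr b) \<le> sqrt (2 * m) / b * 1"
      using b0 m by (intro mult_left_mono) auto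
    moreover have "4 * sqrt (2 * m) / (2 - \<alpha>) = 2 * (sqrt (2 * m) / b)"
      using a by (simp add: b_def field_simps)
    ultimately show ?thesis using rK by linarith
  qed
  ultimately show ?thesis by (auto intro: reach_mono)
qed

lemma min_action_le_threshold:
  fixes V :: "'a::euclidean_space C2_sphere"
  assumes dim: "DIM('a) \<ge> 2" and x: "norm xm = 1" "norm xp = 1" "xm \<noteq> xp"
    and V: "C2_fun V xm = m" "C2_fun V xp = m" and m: "m > 0" and a: "0 < \<alpha>" "\<alpha> < 2"
  shows "min_action xm xp (V, \<alpha>) \<le> ennreal (4 * sqrt (2 * m) / (2 - \<alpha>))"
proof (rule ennreal_le_epsilon)
  fix e :: real assume e: "0 < e"
  have "min_action xm xp (V, \<alpha>) \<le> ennreal (4 * sqrt (2 * m) / (2 - \<alpha>) + e)"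
    using x by (intro reach_imp_min_action_le reach_threshold[OF dim x(1,2) V m a e]) auto
  also have "\<dots> = ennreal (4 * sqrt (2 * m) / (2 - \<alpha>)) + ennreal e"
    using e m a by (intro ennreal_plus) auto
  finally show "min_action xm xp (V, \<alpha>) \<le> ennreal (4 * sqrt (2 * m) / (2 - \<alpha>)) + ennreal e" .
qed

section \<open>A subsolution from the minimality of the passage through the origin\<close>

text \<open>
A homogeneous function of degree \<open>b\<close> with slope \<open>b \<surd>W\<close> at \<open>s\<close> has radial derivative \<open>b U(s)\<close>, which leaves
at most \<open>b \<surd>(W - U(s)\<^sup>2)\<close> for the tangential slope. Without differentiability, this is obtained by comparing
\<open>s\<close> with the radially displaced point \<open>(1 + q h) y\<close> instead of \<open>y\<close>, where \<open>h\<close> is the distance of \<open>y\<close>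
and \<open>s\<close>, and optimizing over \<open>q\<close>.
\<close>

lemma homogeneous_upper_slope_sphere:
  fixes s :: "'a::euclidean_space"
  assumes hom: "\<And>r x. r > 0 \<Longrightarrow> x \<noteq> 0 \<Longrightarrow> U (r *\<^sub>R x) = r powr b * U x"
    and s: "norm s = 1" and b: "0 < b" and U: "slope_le UNIV U s (b * sqrt W)"
    and W: "(U s)\<^sup>2 \<le> W" and K: "b * sqrt (W - (U s)\<^sup>2) < K"
  shows "\<forall>\<^sub>F y in at s within sphere 0 1. U y \<le> U s + K * dist y s"
proof -
  define p where "p = U s"
  define K' where "K' = (K + b * sqrt (W - p\<^sup>2)) / 2"
  define B where "B = K' / b"
  \<comment> \<open>The minimizer of \<open>L \<surd>(1 + q\<^sup>2) - b q p\<close>, whose minimum is \<open>b B = K'\<close>.\<close>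
  define q where "q = p / B"
  define L where "L = b * sqrt (p\<^sup>2 + B\<^sup>2)"
  have sq0: "0 \<le> sqrt (W - p\<^sup>2)" using W by (simp add: p_def)
  have K': "b * sqrt (W - p\<^sup>2) < K'" "K' < K" using K by (auto simp: K'_def p_def)
  have B: "sqrt (W - p\<^sup>2) < B" using K'(1) b by (simp add: B_def field_simps)
  then have B0: "B > 0" using sq0 by linarith
  have "W - p\<^sup>2 < B\<^sup>2"
    using B sq0 W by (metis B0 abs_of_pos real_sqrt_abs real_sqrt_less_iff)
  then have "b * sqrt W < L" using b by (simp add: L_def)
  then obtain d where d: "d > 0" "\<And>x. dist x s < d \<Longrightarrow> \<bar>U x - p\<bar> \<le> L * dist x s"
    using slope_le_ball[OF U, of L] unfolding p_def by auto
  \<comment> \<open>The bound for \<open>U y\<close> at distance \<open>h\<close> that results from the slope condition at \<open>(1 + q h) y\<close>.\<close>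
  define \<psi> where "\<psi> = (\<lambda>h. (1 + q * h) powr (- b) * (p + L * h * sqrt (1 + q\<^sup>2 + q * h)))"
  have "1 + q\<^sup>2 > 0" by (simp add: add_pos_nonneg)
  then have "(\<psi> has_real_derivative - b * q * p + L * sqrt (1 + q\<^sup>2)) (at 0)"
    unfolding \<psi>_def by (auto intro!: derivative_eq_intros)
  also have "- b * q * p + L * sqrt (1 + q\<^sup>2) = K'"
  proof -
    have "1 + q\<^sup>2 = (p\<^sup>2 + B\<^sup>2) / B\<^sup>2" using B0 by (simp add: q_def field_simps)
    then have "sqrt (1 + q\<^sup>2) = sqrt (p\<^sup>2 + B\<^sup>2) / B" using B0 by (simp add: real_sqrt_divide)
    then have "L * sqrt (1 + q\<^sup>2) = b * (p\<^sup>2 + B\<^sup>2) / B" by (simp add: L_def)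
    then have "- b * q * p + L * sqrt (1 + q\<^sup>2) = b * B"
      using B0 by (simp add: q_def field_simps power2_eq_square)
    then show ?thesis using b by (simp add: B_def)
  qed
  finally have "((\<lambda>h. (\<psi> h - \<psi> 0) / (h - 0)) \<longlongrightarrow> K') (at_right 0)"
    unfolding has_field_derivative_iff by (rule tendsto_within_subset) simp
  then have ev1: "\<forall>\<^sub>F h in at_right 0. (\<psi> h - \<psi> 0) / (h - 0) < K"
    by (rule order_tendstoD) (rule K'(2))
  have "((\<lambda>h. 1 + q * h) \<longlongrightarrow> 1 + q * 0) (at_right 0)"
    by (intro tendsto_intros)
  then have ev2: "\<forall>\<^sub>F h in at_right 0. 0 < 1 + q * h"
    by (rule order_tendstoD) simp
  have "((\<lambda>h. h * sqrt (1 + q\<^sup>2 + q * h)) \<longlongrightarrow> 0 * sqrt (1 + q\<^sup>2 + q * 0)) (at_right 0)"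
    by (intro tendsto_intros)
  then have ev3: "\<forall>\<^sub>F h in at_right 0. h * sqrt (1 + q\<^sup>2 + q * h) < d"
    by (rule order_tendstoD) (use d in simp)
  obtain h0 where h0: "h0 > 0" "\<And>h. 0 < h \<Longrightarrow> h < h0 \<Longrightarrow>
      (\<psi> h - \<psi> 0) / (h - 0) < K \<and> 0 < 1 + q * h \<and> h * sqrt (1 + q\<^sup>2 + q * h) < d"
    using eventually_conj[OF ev1 eventually_conj[OF ev2 ev3]]
    unfolding eventually_at_right_field by auto
  show ?thesis
    unfolding eventually_at
  proof (intro exI[of _ h0] conjI ballI impI)
    fix y :: 'a assume y: "y \<in> sphere 0 1" "y \<noteq> s \<and> dist y s < h0"
    define h where "h = dist y s"
    have h: "0 < h" "h < h0" using y by (auto simp: h_def)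
    note c = h0(2)[OF h]
    define r where "r = 1 + q * h"
    have r: "r > 0" using c by (simp add: r_def)
    have yn: "norm y = 1" "y \<noteq> 0" using y by auto
    have nn: "1 + q\<^sup>2 + q * h \<ge> 0" using c by (smt (verit) zero_le_power2)
    have "(norm (r *\<^sub>R y - s))\<^sup>2 = (h * sqrt (1 + q\<^sup>2 + q * h))\<^sup>2"
    proof -
      have "(norm (r *\<^sub>R y - s))\<^sup>2 = (r - 1)\<^sup>2 + r * h\<^sup>2"
        using polar_dist[OF s yn(1)] by (simp add: h_def dist_norm)
      also have "\<dots> = h\<^sup>2 * (1 + q\<^sup>2 + q * h)"
        by (simp add: r_def power2_eq_square algebra_simps)
      finally show ?thesis using nn by (simp add: power_mult_distrib)
    qed
    then have dist_r: "dist (r *\<^sub>R y) s = h * sqrt (1 + q\<^sup>2 + q * h)"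
      using nn h by (subst (asm) power2_eq_iff_nonneg) (auto simp: dist_norm)
    then have "\<bar>U (r *\<^sub>R y) - p\<bar> \<le> L * (h * sqrt (1 + q\<^sup>2 + q * h))"
      using d(2)[of "r *\<^sub>R y"] c by simp
    then have "U (r *\<^sub>R y) \<le> p + L * h * sqrt (1 + q\<^sup>2 + q * h)" by (simp add: abs_le_iff mult.assoc)
    then have "r powr (- b) * U (r *\<^sub>R y) \<le> \<psi> h"
      unfolding \<psi>_def r_def by (intro mult_left_mono) auto
    moreover have "r powr (- b) * U (r *\<^sub>R y) = U y"
      using hom[OF r yn(2)] r by (simp add: powr_minus)
    moreover have "\<psi> h \<le> p + K * h"
      using c h by (simp add: \<psi>_def[THEN fun_cong, of 0] pos_divide_less_eq)
    ultimately show "U y \<le> U s + K * dist y s" by (simp add: p_def h_def)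
  qed (use h0 in auto)
qed

lemma homogeneous_slope_sphere:
  fixes s :: "'a::euclidean_space"
  assumes hom: "\<And>r x. r > 0 \<Longrightarrow> x \<noteq> 0 \<Longrightarrow> U (r *\<^sub>R x) = r powr b * U x"
    and s: "norm s = 1" and b: "0 < b" and U: "slope_le UNIV U s (b * sqrt W)"
    and W: "(U s)\<^sup>2 \<le> W"
  shows "slope_le (sphere 0 1) U s (b * sqrt (W - (U s)\<^sup>2))"
  unfolding slope_le_def
proof (intro allI impI)
  fix K assume K: "b * sqrt (W - (U s)\<^sup>2) < K"
  have "\<forall>\<^sub>F y in at s within sphere 0 1. U y \<le> U s + K * dist y s"
    using assms K by (intro homogeneous_upper_slope_sphere) auto
  moreover have "\<forall>\<^sub>F y in at s within sphere 0 1. - U y \<le> - U s + K * dist y s"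
    using assms K by (intro homogeneous_upper_slope_sphere[where U = "\<lambda>x. - U x"]) (auto simp: slope_le_minus)
  ultimately show "\<forall>\<^sub>F y in at s within sphere 0 1. \<bar>U y - U s\<bar> \<le> K * dist y s"
    by eventually_elim (auto simp: abs_le_iff)
qed

text \<open>
The function \<open>U\<close> below compares the cost of reaching a point from a point \<open>r xm\<close> of the ray through \<open>xm\<close>
with the cost of reaching the origin from there, and optimizes over \<open>r\<close>. The optimization over all
\<open>r\<close> makes it homogeneous. Its slope is at most \<open>\<surd>(2 V)\<close> because nearby points reach each other at
that rate. The hypothesis enters only through \<open>cost'\<close>, which gives a lower bound for \<open>U\<close> at \<open>xp\<close> and
shows that the infimum is finite. Truncation at \<open>\<plusminus> \<surd>m\<close> yields the prescribed values at the two
points and ensures \<open>f\<^sup>2 \<le> V\<close>.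
\<close>

lemma min_action_ge_imp_subsolution:
  fixes V :: "'a::euclidean_space C2_sphere"
  assumes dim: "DIM('a) \<ge> 2" and x: "norm xm = 1" "norm xp = 1" "xm \<noteq> xp"
    and V: "C2_fun V xm = m" "C2_fun V xp = m" "\<And>s. s \<in> sphere 0 1 \<Longrightarrow> m \<le> C2_fun V s"
    and m: "m > 0" and a: "0 < \<alpha>" "\<alpha> < 2" and b: "b = 1 - \<alpha> / 2"
    and ge: "ennreal (4 * sqrt (2 * m) / (2 - \<alpha>)) \<le> min_action xm xp (V, \<alpha>)"
  obtains f where "subsolution (C2_fun V) b f" "f xp = sqrt m" "f xm = - sqrt m"
    "\<And>s. \<bar>f s\<bar> \<le> sqrt m"
proof -
  have b0: "b > 0" "b < 1" using a b by auto
  have x0: "xm \<noteq> 0" "xp \<noteq> 0" using x by auto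
  let ?W = "homog_pot V \<alpha>"
  define F where "F = sqrt (2 * m) / b"
  have F0: "F > 0" using m b0 by (simp add: F_def)
  have thr: "4 * sqrt (2 * m) / (2 - \<alpha>) = 2 * F"
    using a unfolding F_def b by (simp add: field_simps)
  have cost: "2 * F \<le> K" if "reach ?W xm xp K" for K
  proof -
    have "ennreal (2 * F) \<le> ennreal K"
      using ge reach_imp_min_action_le[OF that x0(1) x(3)] unfolding thr by (rule order_trans)
    then show ?thesis using reach_nonneg[OF that] by simp
  qed
  \<comment> \<open>Complete the chain by a radial piece: at its start if \<open>r \<le> 1\<close>, and at its end, after rescaling the
    start to the sphere, if \<open>r > 1\<close>. The radial cost is exactly what separates the two sides.\<close>
  have cost': "F * (1 + r powr b) \<le> K" if r: "r > 0" and K: "reach ?W (r *\<^sub>R xm) xp K" for r K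
  proof (cases "r \<le> 1")
    case True
    show ?thesis
    proof (rule field_le_epsilon)
      fix e :: real assume e: "e > 0"
      have "reach ?W (1 *\<^sub>R xm) (r *\<^sub>R xm) (sqrt (2 * m) / b * (1 powr b - r powr b) + e)"
        by (rule reach_radial(2)[OF x(1) V(1) m a r True e b])
      from reach_trans[OF K this] have "reach ?W xm xp (F * (1 - r powr b) + e + K)"
        by (simp add: F_def)
      from cost[OF this] show "F * (1 + r powr b) \<le> K + e"
        by (simp add: algebra_simps)
    qed
  next
    case False
    define r' where "r' = 1 / r"
    have r': "0 < r'" "r' \<le> 1" "r' powr b * r powr b = 1"
      using False by (auto simp: r'_def simp flip: powr_mult)
    have Kr: "reach ?W (1 *\<^sub>R xm) (r' *\<^sub>R xp) (r' powr b * K)"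
      using reach_scale[OF K r'(1)] False b by (simp add: r'_def)
    have "F * (1 + r' powr b) \<le> r' powr b * K"
    proof (rule field_le_epsilon)
      fix e :: real assume e: "e > 0"
      have "reach ?W (r' *\<^sub>R xp) (1 *\<^sub>R xp) (sqrt (2 * m) / b * (1 powr b - r' powr b) + e)"
        by (rule reach_radial(1)[OF x(2) V(2) m a r'(1,2) e b])
      from reach_trans[OF this Kr] have "reach ?W xm xp (r' powr b * K + (F * (1 - r' powr b) + e))"
        by (simp add: F_def)
      from cost[OF this] show "F * (1 + r' powr b) \<le> r' powr b * K + e"
        by (simp add: algebra_simps)
    qed
    then have "r powr b * (F * (1 + r' powr b)) \<le> r powr b * (r' powr b * K)"
      by (intro mult_left_mono) auto
    moreover have "r powr b * (r' powr b * K) = K"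
      using r'(3) by (metis mult.assoc mult.commute mult.right_neutral)
    moreover have "r powr b * (F * (1 + r' powr b)) = F * (1 + r powr b)"
      using r'(3) by (simp add: algebra_simps)
    ultimately show ?thesis by simp
  qed
  define S where "S = (\<lambda>y. {K - F * r powr b | r K. r > 0 \<and> reach ?W (r *\<^sub>R xm) y K})"
  define U where "U = (\<lambda>y. Inf (S y))"
  have U_eq: "U y = Inf (S y)" for y by (simp add: U_def)
  have connect: "\<exists>K. reach ?W y z K" if "y \<noteq> 0" "z \<noteq> 0" for y z
  proof -
    obtain K where "\<forall>\<alpha>\<in>{0<..<2}. reach (homog_pot V \<alpha>) y z K"
      using reach_uniform[OF dim \<open>y \<noteq> 0\<close> \<open>z \<noteq> 0\<close>] by blast
    then show ?thesis using a by auto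
  qed
  have ne: "S y \<noteq> {}" if "y \<noteq> 0" for y
  proof -
    obtain K where "reach ?W (1 *\<^sub>R xm) y K" using connect[OF x0(1) \<open>y \<noteq> 0\<close>] by auto
    then have "K - F * 1 powr b \<in> S y" unfolding S_def using zero_less_one by blast
    then show ?thesis by blast
  qed
  have low: "F - L \<le> k" if L: "reach ?W y xp L" and k: "k \<in> S y" for y k L
  proof -
    obtain r K where r: "r > 0" "reach ?W (r *\<^sub>R xm) y K" "k = K - F * r powr b"
      using k unfolding S_def by blast
    have "F * (1 + r powr b) \<le> K + L"
      using cost'[OF r(1) reach_trans[OF L r(2)]] .
    then show ?thesis using r(3) by (simp add: algebra_simps)
  qed
  have bdd: "bdd_below (S y)" if "y \<noteq> 0" for y
  proof -
    obtain L where "reach ?W y xp L" using connect[OF \<open>y \<noteq> 0\<close> x0(2)] by blast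
    then show ?thesis using low by (intro bdd_belowI) auto
  qed
  have step: "U z \<le> U y + c" if c: "reach ?W y z c" and y: "y \<noteq> 0" "z \<noteq> 0" for y z c
  proof -
    have "U z - c \<le> k" if k: "k \<in> S y" for k
    proof -
      obtain r K where r: "r > 0" "reach ?W (r *\<^sub>R xm) y K" "k = K - F * r powr b"
        using k unfolding S_def by blast
      have "K + c - F * r powr b \<in> S z"
        using r(1) reach_trans[OF c r(2)] unfolding S_def by blast
      then have "U z \<le> K + c - F * r powr b" unfolding U_def by (intro cInf_lower bdd y)
      then show ?thesis using r(3) by simp
    qed
    then have "U z - c \<le> U y" unfolding U_eq[of y] by (intro cInf_greatest ne y) auto
    then show ?thesis by simp
  qed
  have hom_le: "U (r *\<^sub>R y) \<le> r powr b * U y" if r: "r > 0" and y: "y \<noteq> 0" for r y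
  proof -
    have "U (r *\<^sub>R y) / r powr b \<le> k" if k: "k \<in> S y" for k
    proof -
      obtain t K where t: "t > 0" "reach ?W (t *\<^sub>R xm) y K" "k = K - F * t powr b"
        using k unfolding S_def by blast
      have "reach ?W ((r * t) *\<^sub>R xm) (r *\<^sub>R y) (r powr b * K)"
        using reach_scale[OF t(2) r] b by simp
      moreover have "0 < r * t" using r t by simp
      ultimately have "r powr b * K - F * (r * t) powr b \<in> S (r *\<^sub>R y)"
        unfolding S_def by blast
      then have "U (r *\<^sub>R y) \<le> r powr b * K - F * (r * t) powr b"
        unfolding U_def using r y by (intro cInf_lower bdd) auto
      also have "\<dots> = k * r powr b" using r t(1) unfolding t(3) by (simp add: powr_mult algebra_simps)
      finally show ?thesis using r by (simp add: pos_divide_le_eq)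
    qed
    then have "U (r *\<^sub>R y) / r powr b \<le> U y" unfolding U_eq[of y] by (intro cInf_greatest ne y) auto
    then show ?thesis using r by (simp add: pos_divide_le_eq mult.commute)
  qed
  have hom: "U (r *\<^sub>R y) = r powr b * U y" if r: "r > 0" and y: "y \<noteq> 0" for r y
  proof (rule antisym)
    have "U ((1 / r) *\<^sub>R r *\<^sub>R y) \<le> (1 / r) powr b * U (r *\<^sub>R y)"
      using r y by (intro hom_le) auto
    then show "r powr b * U y \<le> U (r *\<^sub>R y)"
      using r by (simp add: powr_divide field_simps)
  qed (rule hom_le[OF r y])
  have Up: "F \<le> U xp"
    unfolding U_def using low[OF reach.stay[of 0]] by (intro cInf_greatest ne x0) auto
  have Um: "U xm \<le> - F"
  proof -
    have "reach ?W (1 *\<^sub>R xm) xm 0" using reach.stay[of 0 ?W xm] by simp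
    then have "0 - F * 1 powr b \<in> S xm" unfolding S_def using zero_less_one by blast
    then have "U xm \<le> 0 - F * 1 powr b" unfolding U_def by (intro cInf_lower bdd x0)
    then show ?thesis by simp
  qed
  have slope_U: "slope_le UNIV U y (sqrt (2 * ?W y))" if y: "y \<noteq> 0" for y
    unfolding slope_le_def
  proof (intro allI impI)
    fix K assume K: "sqrt (2 * ?W y) < K"
    have "0 \<le> ?W y" using y m V(3)[of "y /\<^sub>R norm y"] by (simp add: homog_pot_def)
    then obtain d where d: "d > 0" "\<And>w z. w \<in> ball y d \<Longrightarrow> z \<in> ball y d \<Longrightarrow> reach ?W w z (K * dist w z)"
      using reach_local[OF y _ K] by blast
    have "\<forall>\<^sub>F z in at y. dist z y < d" using d(1) unfolding eventually_at by blast
    moreover have "\<forall>\<^sub>F z in at y. z \<noteq> 0" using tendsto_imp_eventually_ne[OF tendsto_ident_at y] .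
    ultimately show "\<forall>\<^sub>F z in at y. \<bar>U z - U y\<bar> \<le> K * dist z y"
    proof eventually_elim
      case (elim z)
      have "reach ?W y z (K * dist y z)" "reach ?W z y (K * dist z y)"
        using d(2)[of y z] d(2)[of z y] elim d(1) by (simp_all add: dist_commute)
      then have "U z \<le> U y + K * dist y z" "U y \<le> U z + K * dist z y"
        using y elim by (auto intro!: step)
      then show ?case by (simp add: dist_commute abs_le_iff)
    qed
  qed
  define g where "g = (\<lambda>y. b / sqrt 2 * U y)"
  have scale: "b / sqrt 2 * F = sqrt m" using b0 by (simp add: F_def real_sqrt_mult)
  have g_slope: "slope_le UNIV g s (b * sqrt (C2_fun V s))" if s: "norm s = 1" for s
  proof -
    have "s \<noteq> 0" using s by auto
    then have "slope_le UNIV g s (b / sqrt 2 * sqrt (2 * ?W s))"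
      unfolding g_def using b0 by (intro slope_le_cmult slope_U) auto
    then show ?thesis using s by (simp add: homog_pot_sphere real_sqrt_mult)
  qed
  have gp: "sqrt m \<le> g xp"
    using mult_left_mono[OF Up, of "b / sqrt 2"] b0 unfolding g_def scale by simp
  have "b / sqrt 2 * U xm \<le> b / sqrt 2 * (- F)"
    using Um b0 by (intro mult_left_mono) auto
  then have gm: "g xm \<le> - sqrt m"
    unfolding g_def mult_minus_right scale .
  define f where "f = (\<lambda>s. max (min (g s) (sqrt m)) (- sqrt m))"
  have f_bound: "\<bar>f s\<bar> \<le> sqrt m" for s
    using m real_sqrt_ge_zero[of m] unfolding f_def by linarith
  show thesis
  proof (rule that[of f])
    show "f xp = sqrt m" using gp m by (simp add: f_def)
    show "f xm = - sqrt m" using gm m by (simp add: f_def)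
    show "\<bar>f s\<bar> \<le> sqrt m" for s by (rule f_bound)
    show "subsolution (C2_fun V) b f"
      unfolding subsolution_def
    proof (intro ballI conjI)
      fix s :: 'a assume s: "s \<in> sphere 0 1"
      have "(f s)\<^sup>2 \<le> (sqrt m)\<^sup>2" using f_bound[of s] by (subst abs_le_square_iff[symmetric]) simp
      also have "\<dots> \<le> C2_fun V s" using V(3)[OF s] m by simp
      finally show fV: "(f s)\<^sup>2 \<le> C2_fun V s" .
      have cg: "(g \<longlongrightarrow> g s) (at s within sphere 0 1)"
        using slope_le_tendsto[OF g_slope] s by (auto intro: tendsto_within_subset)
      define L where "L = b * sqrt (C2_fun V s - (f s)\<^sup>2)"
      have 0: "slope_le (sphere 0 1) (\<lambda>_. k) s L" for k
        using fV b0 by (intro slope_le_locally_const) (auto simp: L_def)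
      have "slope_le (sphere 0 1) (\<lambda>s. max (min (g s) (sqrt m)) (- sqrt m)) s L"
      proof (rule slope_le_max)
        show "((\<lambda>s. min (g s) (sqrt m)) \<longlongrightarrow> min (g s) (sqrt m)) (at s within sphere 0 1)"
          by (intro tendsto_intros cg)
        assume lower: "- sqrt m \<le> min (g s) (sqrt m)"
        show "slope_le (sphere 0 1) (\<lambda>s. min (g s) (sqrt m)) s L"
        proof (rule slope_le_min[OF cg])
          assume "g s \<le> sqrt m"
          then have fg: "f s = g s" using lower by (simp add: f_def)
          have "slope_le (sphere 0 1) g s (b * sqrt (C2_fun V s - (g s)\<^sup>2))"
          proof (rule homogeneous_slope_sphere)
            show "g (r *\<^sub>R y) = r powr b * g y" if "r > 0" "y \<noteq> 0" for r y
              using hom[OF that] by (simp add: g_def)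
          qed (use s b0 g_slope fV fg in auto)
          then show "slope_le (sphere 0 1) g s L" by (simp add: fg L_def)
        qed (auto intro: 0)
      qed (auto intro: 0)
      then show "slope_le (sphere 0 1) f s (b * sqrt (C2_fun V s - (f s)\<^sup>2))"
        by (simp add: f_def L_def)
    qed
  qed
qed

section \<open>Potentials that are close in the second order\<close>

lemma blin_deriv_works:
  assumes "f differentiable (at x)"
  shows "(f has_derivative blinfun_apply (blin_deriv f x)) (at x)"
proof -
  have d: "(f has_derivative frechet_derivative f (at x)) (at x)"
    using assms by (simp add: frechet_derivative_works)
  then have "blinfun_apply (blin_deriv f x) = frechet_derivative f (at x)"
    unfolding blin_deriv_def by (intro bounded_linear_Blinfun_apply has_derivative_bounded_linear)
  then show ?thesis using d by simp
qed

lemma hom0_derivatives: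
  fixes V :: "'a::euclidean_space C2_sphere"
  assumes "x \<noteq> 0"
  defines "f \<equiv> hom0 (C2_fun V)"
  shows "(f has_derivative blinfun_apply (blin_deriv f x)) (at x)"
    and "(blin_deriv f has_derivative blinfun_apply (blin_deriv (blin_deriv f) x)) (at x)"
proof -
  have "C2_on (- {0}) f" using C2_fun[of V] by (simp add: f_def)
  then show "(f has_derivative blinfun_apply (blin_deriv f x)) (at x)"
    "(blin_deriv f has_derivative blinfun_apply (blin_deriv (blin_deriv f) x)) (at x)"
    using assms(1) by (auto simp: C2_on_def intro: blin_deriv_works)
qed

lemma blin_deriv_homogeneous:
  fixes f :: "'a::euclidean_space \<Rightarrow> 'b::real_normed_vector"
  assumes r: "r > 0" and x: "x \<noteq> 0" and hom: "\<And>y. y \<noteq> 0 \<Longrightarrow> f y = c *\<^sub>R f (r *\<^sub>R y)"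
    and f: "f differentiable (at (r *\<^sub>R x))"
  shows "blin_deriv f x = (c * r) *\<^sub>R blin_deriv f (r *\<^sub>R x)"
proof (rule blin_deriv_eq)
  have "((\<lambda>y. r *\<^sub>R y) has_derivative (\<lambda>h. r *\<^sub>R h)) (at x)"
    by (intro derivative_intros)
  then have "((\<lambda>y. f (r *\<^sub>R y)) has_derivative (\<lambda>h. blinfun_apply (blin_deriv f (r *\<^sub>R x)) (r *\<^sub>R h))) (at x)"
    by (rule has_derivative_compose) (rule blin_deriv_works[OF f])
  then have "((\<lambda>y. c *\<^sub>R f (r *\<^sub>R y)) has_derivative (\<lambda>h. c *\<^sub>R blinfun_apply (blin_deriv f (r *\<^sub>R x)) (r *\<^sub>R h))) (at x)"
    by (rule has_derivative_scaleR_right)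
  also have "(\<lambda>h. c *\<^sub>R blinfun_apply (blin_deriv f (r *\<^sub>R x)) (r *\<^sub>R h)) =
      blinfun_apply ((c * r) *\<^sub>R blin_deriv f (r *\<^sub>R x))"
    by (simp add: fun_eq_iff blinfun.scaleR_right blinfun.scaleR_left)
  finally show "(f has_derivative blinfun_apply ((c * r) *\<^sub>R blin_deriv f (r *\<^sub>R x))) (at x)"
    by (rule has_derivative_transform_within_open[where s = "- {0}"]) (use x hom in auto)
qed

text \<open>
The distance of potentials controls second derivatives on the sphere only, while Taylor's formula is
applied along segments that leave it; homogeneity of degree \<open>-2\<close> bridges the gap.
\<close>

lemma hom0_second_derivative_scale:
  fixes V :: "'a::euclidean_space C2_sphere"
  assumes x: "x \<noteq> 0" and r: "r > 0"
  defines "f \<equiv> hom0 (C2_fun V)"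
  shows "blin_deriv (blin_deriv f) x = r\<^sup>2 *\<^sub>R blin_deriv (blin_deriv f) (r *\<^sub>R x)"
proof -
  have diff: "f differentiable (at y)" "blin_deriv f differentiable (at y)" if "y \<noteq> 0" for y
    using hom0_derivatives[OF that, of V] by (auto simp: f_def differentiable_def)
  have 0: "f y = 1 *\<^sub>R f (r *\<^sub>R y)" if "y \<noteq> 0" for y
    unfolding f_def hom0_def normalize_scaleR[OF r] by simp
  have 1: "blin_deriv f y = r *\<^sub>R blin_deriv f (r *\<^sub>R y)" if "y \<noteq> 0" for y
    using blin_deriv_homogeneous[of r y f 1, OF r that 0] diff that r by auto
  show ?thesis
    using blin_deriv_homogeneous[of r x "blin_deriv f" r, OF r x 1] diff x r
    by (simp add: power2_eq_square)
qed

lemma C2_dist_bounds: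
  fixes V W :: "'a::euclidean_space C2_sphere"
  assumes s: "s \<in> sphere 0 1"
  shows "\<bar>C2_fun V s - C2_fun W s\<bar> \<le> dist V W"
    and "norm (blin_deriv (blin_deriv (hom0 (C2_fun V))) s - blin_deriv (blin_deriv (hom0 (C2_fun W))) s) \<le> dist V W"
proof -
  let ?a = "\<lambda>s. C2_fun V s - C2_fun W s"
  let ?b = "\<lambda>s. blin_deriv (hom0 (C2_fun V)) s - blin_deriv (hom0 (C2_fun W)) s"
  let ?c = "\<lambda>s. blin_deriv (blin_deriv (hom0 (C2_fun V))) s - blin_deriv (blin_deriv (hom0 (C2_fun W))) s"
  have c: "continuous_on (sphere 0 1) ?a" "continuous_on (sphere 0 1) ?b" "continuous_on (sphere 0 1) ?c"
    by (intro continuous_intros C2_sphere_continuous)+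
  have "norm (?a s) \<le> sup_sphere ?a" "norm (?c s) \<le> sup_sphere ?c"
    using sup_sphere_upper[OF c(1) s] sup_sphere_upper[OF c(3) s] by auto
  then show "\<bar>?a s\<bar> \<le> dist V W" "norm (?c s) \<le> dist V W"
    using sup_sphere_nonneg[OF c(1)] sup_sphere_nonneg[OF c(2)] sup_sphere_nonneg[OF c(3)]
    unfolding dist_C2_sphere_def by auto
qed

text \<open>
The degree \<open>0\<close> extensions of \<open>V\<close> and \<open>W\<close> have the same value and vanishing derivative at \<open>\<xi>\<close>, since \<open>\<xi>\<close>
minimizes both. Applying the mean value inequality twice to their difference leaves a quadratic
remainder. On the ball of radius \<open>1 / 2\<close> around \<open>\<xi>\<close> all norms are at least \<open>1 / 2\<close>, and rescaling second
derivatives to the sphere costs the factor \<open>4\<close>.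
\<close>

lemma C2_close_at_common_minimum:
  fixes V W :: "'a::euclidean_space C2_sphere"
  assumes \<xi>: "\<xi> \<in> sphere 0 1" and eq: "C2_fun V \<xi> = C2_fun W \<xi>"
    and min: "\<And>s. s \<in> sphere 0 1 \<Longrightarrow> C2_fun V \<xi> \<le> C2_fun V s" "\<And>s. s \<in> sphere 0 1 \<Longrightarrow> C2_fun W \<xi> \<le> C2_fun W s"
    and s: "s \<in> sphere 0 1" "dist s \<xi> \<le> 1 / 2"
  shows "\<bar>C2_fun V s - C2_fun W s\<bar> \<le> 4 * dist V W * (dist s \<xi>)\<^sup>2"
proof -
  define f where "f = (\<lambda>V::'a C2_sphere. hom0 (C2_fun V))"
  define d where "d = (\<lambda>y. f V y - f W y)"
  define D where "D = (\<lambda>y. blin_deriv (f V) y - blin_deriv (f W) y)"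
  have \<xi>0: "\<xi> \<noteq> 0" using \<xi> by auto
  have far: "1 / 2 \<le> norm y" if "y \<in> cball \<xi> (1 / 2)" for y
  proof -
    have "norm \<xi> \<le> norm y + dist \<xi> y" by (metis dist_norm norm_triangle_sub)
    then show ?thesis using that \<xi> by simp
  qed
  have crit: "blin_deriv (f X) \<xi> = 0" if X: "\<And>s. s \<in> sphere 0 1 \<Longrightarrow> C2_fun X \<xi> \<le> C2_fun X s" for X
  proof -
    have "f X \<xi> \<le> f X y" if "y \<in> - {0}" for y
      using X[of "y /\<^sub>R norm y"] that \<xi> by (auto simp: f_def hom0_def)
    then have "blinfun_apply (blin_deriv (f X) \<xi>) = (\<lambda>v. 0)"
      using \<xi>0 hom0_derivatives(1)[OF \<xi>0, of X]
      by (intro differential_zero_maxmin[of \<xi> "- {0}" "f X"]) (auto simp: f_def)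
    then show ?thesis by (intro blinfun_eqI) simp
  qed
  have D_bound: "norm (D y) \<le> 4 * dist V W * norm (y - \<xi>)" if y: "y \<in> cball \<xi> (1 / 2)" for y
  proof -
    let ?D2 = "\<lambda>y. blin_deriv (blin_deriv (f V)) y - blin_deriv (blin_deriv (f W)) y"
    have "norm (D y - D \<xi>) \<le> 4 * dist V W * norm (y - \<xi>)"
    proof (rule differentiable_bound)
      show "convex (cball \<xi> (1 / 2))" by (rule convex_cball)
      fix z assume z: "z \<in> cball \<xi> (1 / 2)"
      have z0: "z \<noteq> 0" using far[OF z] by auto
      have "(D has_derivative blinfun_apply (?D2 z)) (at z)"
        unfolding D_def f_def blinfun.bilinear_simps
        by (intro has_derivative_diff hom0_derivatives(2)[OF z0])
      then show "(D has_derivative blinfun_apply (?D2 z)) (at z within cball \<xi> (1 / 2))"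
        by (rule has_derivative_at_withinI)
      have r: "0 < 1 / norm z" using z0 by simp
      have "?D2 z = (1 / norm z)\<^sup>2 *\<^sub>R ?D2 ((1 / norm z) *\<^sub>R z)"
        unfolding f_def scaleR_diff_right
          hom0_second_derivative_scale[OF z0 r, of V, symmetric] hom0_second_derivative_scale[OF z0 r, of W, symmetric] ..
      then have "norm (?D2 z) = (1 / norm z)\<^sup>2 * norm (?D2 ((1 / norm z) *\<^sub>R z))"
        by (metis norm_scaleR abs_of_nonneg zero_le_power2)
      also have "\<dots> \<le> 2\<^sup>2 * dist V W"
      proof (rule mult_mono)
        show "(1 / norm z)\<^sup>2 \<le> 2\<^sup>2"
          using far[OF z] z0 by (intro power_mono) (auto simp: field_simps)
        show "norm (?D2 ((1 / norm z) *\<^sub>R z)) \<le> dist V W"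
          unfolding f_def using z0 by (intro C2_dist_bounds) simp
      qed auto
      finally show "onorm (blinfun_apply (?D2 z)) \<le> 4 * dist V W"
        by (simp add: norm_blinfun.rep_eq)
    qed (use y in auto)
    then show ?thesis using crit[OF min(1)] crit[OF min(2)] by (simp add: D_def)
  qed
  have "norm (d s - d \<xi>) \<le> 4 * dist V W * dist s \<xi> * norm (s - \<xi>)"
  proof (rule differentiable_bound)
    show "convex (cball \<xi> (dist s \<xi>))" by (rule convex_cball)
    fix z assume z: "z \<in> cball \<xi> (dist s \<xi>)"
    then have z': "z \<in> cball \<xi> (1 / 2)" using s by auto
    have z0: "z \<noteq> 0" using far[OF z'] by auto
    have "(d has_derivative blinfun_apply (D z)) (at z)"
      unfolding d_def D_def f_def blinfun.bilinear_simps
      by (intro has_derivative_diff hom0_derivatives(1)[OF z0])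
    then show "(d has_derivative blinfun_apply (D z)) (at z within cball \<xi> (dist s \<xi>))"
      by (rule has_derivative_at_withinI)
    have "norm (D z) \<le> 4 * dist V W * norm (z - \<xi>)" by (rule D_bound[OF z'])
    also have "\<dots> \<le> 4 * dist V W * dist s \<xi>"
      using z by (intro mult_left_mono) (auto simp: dist_norm norm_minus_commute)
    finally show "onorm (blinfun_apply (D z)) \<le> 4 * dist V W * dist s \<xi>"
      by (simp add: norm_blinfun.rep_eq)
  qed (auto simp: dist_commute)
  then show ?thesis
    using \<xi> s eq by (simp add: d_def f_def hom0_def dist_norm power2_eq_square mult.assoc)
qed

section \<open>Existence of smooth potentials with two wells\<close>

definition C1_on :: "'a::real_normed_vector set \<Rightarrow> ('a \<Rightarrow> 'b::real_normed_vector) \<Rightarrow> bool" where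
  "C1_on U f \<longleftrightarrow> (\<exists>f'. (\<forall>x\<in>U. (f has_derivative blinfun_apply (f' x)) (at x)) \<and> continuous_on U f')"

lemma C1_on_imp_continuous_on: "C1_on U f \<Longrightarrow> continuous_on U f"
  unfolding C1_on_def
  by (meson continuous_at_imp_continuous_on has_derivative_continuous)

lemma C1_on_const: "C1_on U (\<lambda>_. c)"
  unfolding C1_on_def by (intro exI[of _ "\<lambda>_. 0"]) (auto simp: zero_blinfun.rep_eq)

lemma C1_on_bounded_linear: "bounded_linear f \<Longrightarrow> C1_on U f"
  unfolding C1_on_def
  by (intro exI[of _ "\<lambda>_. Blinfun f"])
    (auto simp: bounded_linear_Blinfun_apply intro: bounded_linear_imp_has_derivative)

lemma C1_on_add:
  assumes "C1_on U f" "C1_on U g"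
  shows "C1_on U (\<lambda>x. f x + g x)"
proof -
  obtain f' g' where "\<forall>x\<in>U. (f has_derivative blinfun_apply (f' x)) (at x)" "continuous_on U f'"
    "\<forall>x\<in>U. (g has_derivative blinfun_apply (g' x)) (at x)" "continuous_on U g'"
    using assms unfolding C1_on_def by blast
  then have "continuous_on U (\<lambda>x. f' x + g' x)"
    "\<forall>x\<in>U. ((\<lambda>x. f x + g x) has_derivative blinfun_apply (f' x + g' x)) (at x)"
    unfolding plus_blinfun.rep_eq by (auto intro: has_derivative_add continuous_on_add)
  then show ?thesis
    unfolding C1_on_def by (intro exI[of _ "\<lambda>x. f' x + g' x"] conjI)
qed

lemma C1_on_scaleR:
  fixes f :: "'a::real_normed_vector \<Rightarrow> real"
  assumes "C1_on U f" "C1_on U g"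
  shows "C1_on U (\<lambda>x. f x *\<^sub>R g x)"
proof -
  have cont: "continuous_on U f" "continuous_on U g"
    using assms by (auto intro: C1_on_imp_continuous_on)
  obtain f' g' where h: "\<forall>x\<in>U. (f has_derivative blinfun_apply (f' x)) (at x)" "continuous_on U f'"
    "\<forall>x\<in>U. (g has_derivative blinfun_apply (g' x)) (at x)" "continuous_on U g'"
    using assms unfolding C1_on_def by blast
  show ?thesis
    unfolding C1_on_def
  proof (intro exI[of _ "\<lambda>x. f x *\<^sub>R g' x + (blinfun_scaleR_left (g x) o\<^sub>L f' x)"] conjI ballI)
    fix x assume "x \<in> U"
    with h show "((\<lambda>x. f x *\<^sub>R g x) has_derivative
        blinfun_apply (f x *\<^sub>R g' x + (blinfun_scaleR_left (g x) o\<^sub>L f' x))) (at x)"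
      by (auto simp: blinfun.bilinear_simps intro!: derivative_eq_intros)
  next
    show "continuous_on U (\<lambda>x. f x *\<^sub>R g' x + (blinfun_scaleR_left (g x) o\<^sub>L f' x))"
      using cont h by (intro continuous_intros bounded_linear.continuous_on[OF bounded_linear_blinfun_scaleR_left])
  qed
qed

lemma C2_onI:
  assumes U: "open U" and f: "\<And>x. x \<in> U \<Longrightarrow> (f has_derivative blinfun_apply (f' x)) (at x)"
    and f': "C1_on U f'"
  shows "C2_on U f"
proof -
  obtain f'' where f'': "\<And>x. x \<in> U \<Longrightarrow> (f' has_derivative blinfun_apply (f'' x)) (at x)" "continuous_on U f''"
    using f' unfolding C1_on_def by blast
  have 1: "blin_deriv f x = f' x" if "x \<in> U" for x
    using blin_deriv_eq[OF f[OF that]] .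
  have 2: "(blin_deriv f has_derivative blinfun_apply (f'' x)) (at x)" if "x \<in> U" for x
    by (rule has_derivative_transform_within_open[OF f''(1)[OF that] U that]) (simp add: 1)
  have 3: "blin_deriv (blin_deriv f) x = f'' x" if "x \<in> U" for x
    using blin_deriv_eq[OF 2[OF that]] .
  have "continuous_on U (blin_deriv (blin_deriv f))"
    using f''(2) by (rule continuous_on_eq) (simp add: 3)
  then show ?thesis
    unfolding C2_on_def using U f 2 by (auto simp: differentiable_def)
qed

lemma inverse_norm_derivative:
  fixes x :: "'a::euclidean_space"
  assumes "x \<noteq> 0"
  shows "((\<lambda>y. inverse (norm y)) has_derivative
    blinfun_apply ((- inverse (norm x) * inverse (norm x) * inverse (norm x)) *\<^sub>R blinfun_inner_right x)) (at x)"
proof -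
  have "((\<lambda>y. inverse (norm y)) has_derivative
      (\<lambda>h. - (inverse (norm x) * (sgn x \<bullet> h) * inverse (norm x)))) (at x)"
    using assms by (auto intro!: derivative_eq_intros has_derivative_norm simp: inner_commute)
  then show ?thesis
    by (rule has_derivative_eq_rhs) (auto simp: fun_eq_iff blinfun.bilinear_simps sgn_div_norm)
qed

lemma C1_on_inverse_norm: "C1_on (- {0}) (\<lambda>y::'a::euclidean_space. inverse (norm y))"
  unfolding C1_on_def
proof (intro exI conjI ballI)
  show "((\<lambda>y. inverse (norm y)) has_derivative
    blinfun_apply ((- inverse (norm x) * inverse (norm x) * inverse (norm x)) *\<^sub>R blinfun_inner_right x)) (at x)"
    if "x \<in> - {0}" for x :: 'a
    using inverse_norm_derivative that by auto
  show "continuous_on (- {0}) (\<lambda>x::'a. (- inverse (norm x) * inverse (norm x) * inverse (norm x)) *\<^sub>R blinfun_inner_right x)"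
    by (intro continuous_intros bounded_linear.continuous_on[OF bounded_linear_blinfun_inner_right]) auto
qed

text \<open>
On the sphere \<open>1 - s \<bullet> \<xi>\<close> is half the squared distance of \<open>s\<close> and \<open>\<xi>\<close>, so for \<open>c > 0\<close> and
distinct points \<open>xm\<close>, \<open>xp\<close> of the sphere these are potentials with nondegenerate minima exactly there.
\<close>

lemma C2_well_exists:
  fixes xm xp :: "'a::euclidean_space"
  obtains V :: "'a C2_sphere"
  where "\<And>s. s \<in> sphere 0 1 \<Longrightarrow> C2_fun V s = m + c * (1 - s \<bullet> xm) * (1 - s \<bullet> xp)"
proof -
  define V0 where "V0 = restrict (\<lambda>s. m + c * (1 - s \<bullet> xm) * (1 - s \<bullet> xp)) (sphere 0 1)"
  define N where "N = (\<lambda>y::'a. inverse (norm y))"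
  define N' where "N' = (\<lambda>x::'a. (- N x * N x * N x) *\<^sub>R blinfun_inner_right x)"
  define P where "P = (\<lambda>e y. 1 - N y * (y \<bullet> e))" for e :: 'a
  define P' where "P' = (\<lambda>e y. (- N y) *\<^sub>R blinfun_inner_left e + (- (y \<bullet> e)) *\<^sub>R N' y)" for e :: 'a
  have N1: "C1_on (- {0}) N" unfolding N_def by (rule C1_on_inverse_norm)
  have inner1: "C1_on (- {0}) (\<lambda>y::'a. y \<bullet> e)" for e
    by (rule C1_on_bounded_linear) (rule bounded_linear_inner_left)
  have neg: "C1_on (- {0}) (\<lambda>y. - f y)" if "C1_on (- {0}) f" for f :: "'a \<Rightarrow> real"
    using C1_on_scaleR[OF C1_on_const[of _ "-1"] that] by simp
  have N'1: "C1_on (- {0}) N'"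
    unfolding N'_def real_scaleR_def[symmetric]
    by (intro C1_on_scaleR neg N1 C1_on_bounded_linear bounded_linear_blinfun_inner_right)
  have P1: "C1_on (- {0}) (P e)" for e
    using C1_on_add[OF C1_on_const[of _ 1] neg[OF C1_on_scaleR[OF N1 inner1, of e]]]
    by (simp add: P_def)
  have P'1: "C1_on (- {0}) (P' e)" for e
    unfolding P'_def by (intro C1_on_add C1_on_scaleR neg N1 inner1 N'1 C1_on_const)
  have Nd: "(N has_derivative blinfun_apply (N' y)) (at y)" if "y \<noteq> 0" for y
    using inverse_norm_derivative[OF that] by (simp add: N_def N'_def)
  have Pd: "(P e has_derivative blinfun_apply (P' e y)) (at y)" if "y \<noteq> 0" for e y
    unfolding P_def P'_def using Nd[OF that]
    by (auto intro!: derivative_eq_intros simp: blinfun.bilinear_simps inner_commute)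
  let ?f = "\<lambda>y. m + c * P xm y * P xp y"
  let ?f' = "\<lambda>y. c *\<^sub>R (P xm y *\<^sub>R P' xp y + P xp y *\<^sub>R P' xm y)"
  have "C2_on (- {0}) (hom0 V0)"
  proof (rule C2_onI)
    show "C1_on (- {0}) ?f'"
      by (intro C1_on_scaleR C1_on_add C1_on_const P1 P'1)
    fix y :: 'a assume y: "y \<in> - {0}"
    have "(?f has_derivative blinfun_apply (?f' y)) (at y)"
      using Pd y by (auto intro!: derivative_eq_intros simp: blinfun.bilinear_simps algebra_simps)
    then show "(hom0 V0 has_derivative blinfun_apply (?f' y)) (at y)"
    proof (rule has_derivative_transform_within_open[where s = "- {0}"])
      show "?f z = hom0 V0 z" if "z \<in> - {0}" for z
        using that by (simp add: hom0_def V0_def P_def N_def)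
    qed (use y in auto)
  qed auto
  then have "C2_fun (C2_abs V0) = V0"
    by (intro C2_abs_inverse) (auto simp: V0_def)
  then show thesis
    by (intro that[of "C2_abs V0"]) (simp add: V0_def)
qed

section \<open>Lattice operations and barriers\<close>

lemma subsolution_min:
  assumes f: "subsolution V b f" and g: "subsolution V b g"
  shows "subsolution V b (\<lambda>s. min (f s) (g s))"
  unfolding subsolution_def
proof (intro ballI conjI)
  fix s :: 'a assume s: "s \<in> sphere 0 1"
  have h: "(f s)\<^sup>2 \<le> V s" "slope_le (sphere 0 1) f s (b * sqrt (V s - (f s)\<^sup>2))"
    "(g s)\<^sup>2 \<le> V s" "slope_le (sphere 0 1) g s (b * sqrt (V s - (g s)\<^sup>2))"
    using f g s by (auto simp: subsolution_def)
  show "(min (f s) (g s))\<^sup>2 \<le> V s" using h by (simp add: min_def)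
  show "slope_le (sphere 0 1) (\<lambda>s. min (f s) (g s)) s (b * sqrt (V s - (min (f s) (g s))\<^sup>2))"
    using h by (intro slope_le_min slope_le_tendsto[OF h(2)] slope_le_tendsto[OF h(4)]) (auto simp: min_def)
qed

lemma subsolution_minus: "subsolution V b (\<lambda>s. - f s) \<longleftrightarrow> subsolution V b f"
  by (simp add: subsolution_def slope_le_minus)

lemma subsolution_max:
  assumes f: "subsolution V b f" and g: "subsolution V b g"
  shows "subsolution V b (\<lambda>s. max (f s) (g s))"
proof -
  have "subsolution V b (\<lambda>s. - min (- f s) (- g s))"
    unfolding subsolution_minus using f g by (intro subsolution_min) (simp_all add: subsolution_minus)
  then show ?thesis by (simp add: minus_min_eq_max)
qed

lemma sphere_dist_le_2:
  fixes s t :: "'a::real_normed_vector"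
  assumes "s \<in> sphere 0 1" "t \<in> sphere 0 1"
  shows "dist s t \<le> 2"
  using assms dist_triangle[of s t 0] by (simp add: dist_commute)

text \<open>
With \<open>h = \<surd>m (1 - c D\<^sup>2)\<close>, where \<open>D\<close> is the distance to \<open>\<xi>\<close>, the slope is at most \<open>2 \<surd>m c D\<close>, while
\<open>m - h\<^sup>2 \<ge> m c D\<^sup>2\<close> as long as \<open>c D\<^sup>2 \<le> 1\<close>. The choice \<open>c = b\<^sup>2 / 4\<close> is the largest for which the first bound
is at most \<open>b\<close> times the square root of the second.
\<close>

lemma barrier_subsolution:
  fixes \<xi> :: "'a::euclidean_space"
  assumes \<xi>: "\<xi> \<in> sphere 0 1" and V: "\<And>s. s \<in> sphere 0 1 \<Longrightarrow> m \<le> V s" and m: "m > 0" and b: "0 < b" "b < 1"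
  shows "subsolution V b (\<lambda>s. sqrt m * (1 - b\<^sup>2 / 4 * (dist s \<xi>)\<^sup>2))"
  unfolding subsolution_def
proof (intro ballI conjI)
  fix s :: 'a assume s: "s \<in> sphere 0 1"
  define c where "c = b\<^sup>2 / 4"
  define D where "D = dist s \<xi>"
  have "b\<^sup>2 \<le> 1" using b by (simp add: power_le_one)
  then have c: "0 < c" "c \<le> 1 / 4" using b by (auto simp: c_def)
  have "D\<^sup>2 \<le> 2\<^sup>2" using sphere_dist_le_2[OF s \<xi>] by (intro power_mono) (auto simp: D_def)
  then have "c * D\<^sup>2 \<le> 1 / 4 * 2\<^sup>2" using c by (intro mult_mono) auto
  then have cD: "0 \<le> c * D\<^sup>2" "c * D\<^sup>2 \<le> 1" using c by auto
  have gap: "m * (c * D\<^sup>2) \<le> V s - (sqrt m * (1 - c * D\<^sup>2))\<^sup>2"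
  proof -
    have "(c * D\<^sup>2)\<^sup>2 \<le> c * D\<^sup>2" using cD by (simp add: power2_eq_square mult_left_le)
    then have "m * (1 - c * D\<^sup>2)\<^sup>2 \<le> m * (1 - c * D\<^sup>2)"
      using m by (intro mult_left_mono) (auto simp: power2_diff)
    moreover have "(sqrt m * (1 - c * D\<^sup>2))\<^sup>2 = m * (1 - c * D\<^sup>2)\<^sup>2"
      using m by (simp add: power_mult_distrib)
    ultimately have "(sqrt m * (1 - c * D\<^sup>2))\<^sup>2 \<le> m - m * (c * D\<^sup>2)"
      by (simp only: right_diff_distrib mult_1_right)
    then show ?thesis using V[OF s] by linarith
  qed
  moreover have "0 \<le> m * (c * D\<^sup>2)" using m cD by simp
  ultimately show "(sqrt m * (1 - b\<^sup>2 / 4 * (dist s \<xi>)\<^sup>2))\<^sup>2 \<le> V s"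
    unfolding c_def[symmetric] D_def[symmetric] by linarith
  have "slope_le (sphere 0 1) (\<lambda>y. sqrt m * c * (dist y \<xi>)\<^sup>2) s (sqrt m * c * (2 * D))"
    unfolding D_def using m c by (intro slope_le_cmult slope_le_dist_power2) auto
  moreover have "(\<lambda>y. sqrt m * (1 - c * (dist y \<xi>)\<^sup>2)) = (\<lambda>y. - (sqrt m * c * (dist y \<xi>)\<^sup>2 - sqrt m))"
    by (simp add: algebra_simps)
  ultimately have "slope_le (sphere 0 1) (\<lambda>y. sqrt m * (1 - c * (dist y \<xi>)\<^sup>2)) s (sqrt m * c * (2 * D))"
    by (simp only: slope_le_minus) (simp add: slope_le_def)
  moreover have "sqrt m * c * (2 * D) \<le> b * sqrt (V s - (sqrt m * (1 - c * D\<^sup>2))\<^sup>2)"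
  proof -
    have "sqrt c = b / 2" using b by (simp add: c_def real_sqrt_divide)
    then have "sqrt m * c * (2 * D) = b * sqrt (m * (c * D\<^sup>2))"
      using b by (simp add: real_sqrt_mult D_def) (simp add: c_def power2_eq_square)
    also have "\<dots> \<le> b * sqrt (V s - (sqrt m * (1 - c * D\<^sup>2))\<^sup>2)"
      using gap b by (intro mult_left_mono) auto
    finally show ?thesis .
  qed
  ultimately show "slope_le (sphere 0 1) (\<lambda>s. sqrt m * (1 - b\<^sup>2 / 4 * (dist s \<xi>)\<^sup>2)) s
      (b * sqrt (V s - (sqrt m * (1 - b\<^sup>2 / 4 * (dist s \<xi>)\<^sup>2))\<^sup>2))"
    unfolding c_def[symmetric] D_def[symmetric] by (rule slope_le_mono)
qed

section \<open>The dual description of In\<close>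

locale wells =
  fixes xm xp :: "'a::euclidean_space" and m :: real
  assumes dim: "DIM('a) \<ge> 2" and xm: "xm \<in> sphere 0 1" and xp: "xp \<in> sphere 0 1" and xne: "xm \<noteq> xp"
    and m: "m > 0"
begin

abbreviation "pots \<equiv> pot_S xm xp m"
abbreviation "params \<equiv> pot_P xm xp m"
abbreviation "Ins \<equiv> In_set xm xp m"
abbreviation "Outs \<equiv> Out_set xm xp m"

lemma pot_SD:
  assumes "V \<in> pots"
  shows "C2_fun V xm = m" "C2_fun V xp = m" "\<And>s. s \<in> sphere 0 1 \<Longrightarrow> m \<le> C2_fun V s"
  using assms by (auto simp: pot_S_def)

definition calibrated :: "'a C2_sphere \<Rightarrow> real \<Rightarrow> ('a \<Rightarrow> real) \<Rightarrow> bool" where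
  "calibrated V b f \<longleftrightarrow> subsolution (C2_fun V) b f \<and> f xp = sqrt m \<and> f xm = - sqrt m \<and> (\<forall>s\<in>sphere 0 1. \<bar>f s\<bar> \<le> sqrt m)"

lemma threshold_eq:
  assumes "\<alpha> < 2"
  shows "4 * sqrt (2 * m) / (2 - \<alpha>) = sqrt 2 / (1 - \<alpha> / 2) * (2 * sqrt m)"
  using assms by (simp add: real_sqrt_mult field_simps)

lemma In_setD: "(V, \<alpha>) \<in> Ins \<Longrightarrow> V \<in> pots \<and> 0 < \<alpha> \<and> \<alpha> < 2"
  by (auto simp: In_set_def pot_P_def)

lemma In_iff_ge:
  assumes "V \<in> pots" "0 < \<alpha>" "\<alpha> < 2"
  shows "(V, \<alpha>) \<in> Ins \<longleftrightarrow> ennreal (4 * sqrt (2 * m) / (2 - \<alpha>)) \<le> min_action xm xp (V, \<alpha>)"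
proof -
  have "min_action xm xp (V, \<alpha>) \<le> ennreal (4 * sqrt (2 * m) / (2 - \<alpha>))"
    using assms xm xp xne by (intro min_action_le_threshold dim m pot_SD) auto
  then show ?thesis using assms by (auto simp: In_set_def pot_P_def)
qed

lemma Out_eq: "Outs = params - Ins"
proof -
  have "min_action xm xp (V, \<alpha>) \<le> ennreal (4 * sqrt (2 * m) / (2 - \<alpha>))" if "(V, \<alpha>) \<in> params" for V \<alpha>
    using that xm xp xne by (intro min_action_le_threshold dim m pot_SD) (auto simp: pot_P_def)
  then show ?thesis by (auto simp: Out_set_def In_set_def less_le)
qed

text \<open>
This equivalence turns all further questions about minimal actions into questions about functions
on the sphere.
\<close>

lemma In_iff_calibrated:
  assumes "V \<in> pots" "0 < \<alpha>" "\<alpha> < 2"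
  shows "(V, \<alpha>) \<in> Ins \<longleftrightarrow> (\<exists>f. calibrated V (1 - \<alpha> / 2) f)"
proof
  assume "(V, \<alpha>) \<in> Ins"
  then have ge: "ennreal (4 * sqrt (2 * m) / (2 - \<alpha>)) \<le> min_action xm xp (V, \<alpha>)"
    using In_iff_ge[OF assms] by simp
  have xx: "norm xm = 1" "norm xp = 1" using xm xp by auto
  show "\<exists>f. calibrated V (1 - \<alpha> / 2) f"
    by (rule min_action_ge_imp_subsolution[OF dim xx xne pot_SD[OF assms(1)] m assms(2,3) _ ge])
      (auto simp: calibrated_def)
next
  assume "\<exists>f. calibrated V (1 - \<alpha> / 2) f"
  then obtain f where f: "subsolution (C2_fun V) (1 - \<alpha> / 2) f" "f xp = sqrt m" "f xm = - sqrt m"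
    by (auto simp: calibrated_def)
  have "ennreal (sqrt 2 / (1 - \<alpha> / 2) * (f xp - f xm)) \<le> min_action xm xp (V, \<alpha>)"
    by (rule subsolution_imp_min_action_ge[OF m pot_SD(3)[OF assms(1)] assms(2,3) _ f(1)]) (use xm xp in auto)
  then show "(V, \<alpha>) \<in> Ins"
    using In_iff_ge[OF assms] f threshold_eq[OF assms(3)] by simp
qed

section \<open>Stability of In\<close>

text \<open>
Taking the minimum with the barrier at \<open>xp\<close> and the maximum with the negative barrier at \<open>xm\<close> preserves
the subsolution property and the values at both points, and forces \<open>f\<^sup>2 < m\<close> strictly away from them.
\<close>

lemma calibrated_with_barriers:
  assumes V: "V \<in> pots" and b: "0 < b" "b < 1" and f: "calibrated V b f" and \<delta>: "0 < \<delta>" "\<delta> \<le> 1"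
  obtains g \<kappa> where "calibrated V b g" "\<kappa> > 0"
    "\<And>s. s \<in> sphere 0 1 \<Longrightarrow> \<delta> \<le> dist s xm \<Longrightarrow> \<delta> \<le> dist s xp \<Longrightarrow> \<kappa> \<le> m - (g s)\<^sup>2"
proof -
  define h where "h = (\<lambda>(\<xi> :: 'a) s. sqrt m * (1 - b\<^sup>2 / 4 * (dist s \<xi>)\<^sup>2))"
  define g where "g = (\<lambda>s. max (min (f s) (h xp s)) (- h xm s))"
  have f': "subsolution (C2_fun V) b f" "f xp = sqrt m" "f xm = - sqrt m" "\<And>s. s \<in> sphere 0 1 \<Longrightarrow> \<bar>f s\<bar> \<le> sqrt m"
    using f by (auto simp: calibrated_def)
  have sq: "0 < sqrt m" using m by simp
  have hs: "subsolution (C2_fun V) b (h \<xi>)" if "\<xi> \<in> sphere 0 1" for \<xi>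
    unfolding h_def using that pot_SD(3)[OF V] m b by (intro barrier_subsolution) auto
  have b2: "b\<^sup>2 \<le> 1" using b by (simp add: power_le_one)
  have h_bounds: "0 \<le> h \<xi> s" "h \<xi> s \<le> sqrt m" if \<xi>: "\<xi> \<in> sphere 0 1" and s: "s \<in> sphere 0 1" for \<xi> s
  proof -
    have "(dist s \<xi>)\<^sup>2 \<le> 2\<^sup>2" using sphere_dist_le_2[OF s \<xi>] by (intro power_mono) auto
    then have "b\<^sup>2 / 4 * (dist s \<xi>)\<^sup>2 \<le> 1 / 4 * 2\<^sup>2" using b2 by (intro mult_mono) auto
    then show "0 \<le> h \<xi> s" using sq by (simp add: h_def)
    show "h \<xi> s \<le> sqrt m" using sq by (simp add: h_def mult_left_le)
  qed
  define k where "k = sqrt m * (1 - b\<^sup>2 / 4 * \<delta>\<^sup>2)"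
  have "b\<^sup>2 / 4 * \<delta>\<^sup>2 \<le> 1 / 4 * 1" using b2 \<delta> by (intro mult_mono) (auto simp: power_le_one)
  then have bd: "0 < b\<^sup>2 / 4 * \<delta>\<^sup>2" "b\<^sup>2 / 4 * \<delta>\<^sup>2 < 1" using b \<delta> by auto
  then have k: "0 \<le> k" "k < sqrt m" using sq by (auto simp: k_def)
  have h_far: "h \<xi> s \<le> k" if "\<delta> \<le> dist s \<xi>" for \<xi> s
  proof -
    have "\<delta>\<^sup>2 \<le> (dist s \<xi>)\<^sup>2" using that \<delta> by (intro power_mono) auto
    then have "b\<^sup>2 / 4 * \<delta>\<^sup>2 \<le> b\<^sup>2 / 4 * (dist s \<xi>)\<^sup>2" by (intro mult_left_mono) auto
    then show ?thesis unfolding h_def k_def using sq by (intro mult_left_mono) auto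
  qed
  show thesis
  proof (rule that[of g "m - k\<^sup>2"])
    have "subsolution (C2_fun V) b g"
      unfolding g_def by (intro subsolution_max subsolution_min f' hs xp iffD2[OF subsolution_minus] xm)
    moreover have "h xp xp = sqrt m" "h xm xm = sqrt m" by (simp_all add: h_def)
    then have "g xp = sqrt m" "g xm = - sqrt m"
      using f'(2,3) h_bounds(1)[OF xm xp] h_bounds(1)[OF xp xm] sq unfolding g_def by linarith+
    moreover have "\<bar>g s\<bar> \<le> sqrt m" if "s \<in> sphere 0 1" for s
      using f'(4)[OF that] h_bounds[OF xm that] h_bounds[OF xp that] unfolding g_def by linarith
    ultimately show "calibrated V b g" by (simp add: calibrated_def)
    have "k\<^sup>2 < (sqrt m)\<^sup>2" using k by (intro power_strict_mono) auto
    then show "m - k\<^sup>2 > 0" using m by simp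
    fix s :: 'a assume s: "s \<in> sphere 0 1" "\<delta> \<le> dist s xm" "\<delta> \<le> dist s xp"
    have "\<bar>g s\<bar> \<le> k"
      using h_far[OF s(2)] h_far[OF s(3)] h_bounds[OF xm s(1)] h_bounds[OF xp s(1)] k
      unfolding g_def by linarith
    then have "\<bar>g s\<bar>\<^sup>2 \<le> k\<^sup>2" by (intro power_mono) auto
    then show "m - k\<^sup>2 \<le> m - (g s)\<^sup>2" by simp
  qed
qed

text \<open>
The difference of two nearby potentials is a small multiple of the squared distance to the well,
which is absorbed by the quadratic growth of \<open>V\<close>.
\<close>

lemma near_wells:
  assumes V: "V \<in> pots" and \<eta>: "\<eta> > 0"
  obtains e \<delta> where "e > 0" "0 < \<delta>" "\<delta> \<le> 1"
    "\<And>W s. W \<in> pots \<Longrightarrow> dist V W < e \<Longrightarrow> s \<in> sphere 0 1 \<Longrightarrow> dist s xm < \<delta> \<or> dist s xp < \<delta> \<Longrightarrow>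
       (1 - \<eta>) * (C2_fun V s - m) \<le> C2_fun W s - m"
proof -
  have one: "\<exists>e>0. \<exists>\<delta>>0. \<forall>W\<in>pots. dist V W < e \<longrightarrow> (\<forall>s\<in>sphere 0 1. dist s \<xi> < \<delta> \<longrightarrow>
       (1 - \<eta>) * (C2_fun V s - m) \<le> C2_fun W s - m)" if \<xi>: "\<xi> \<in> {xm, xp}" for \<xi>
  proof -
    have \<xi>s: "\<xi> \<in> sphere 0 1" using that xm xp by auto
    have V\<xi>: "C2_fun W \<xi> = m" if "W \<in> pots" for W using pot_SD[OF that] \<xi> by auto
    obtain d \<mu> where d: "d > 0" "\<mu> > 0"
      "\<And>s. s \<in> sphere 0 1 \<Longrightarrow> norm (s - \<xi>) < d \<Longrightarrow> \<mu> * (norm (s - \<xi>))\<^sup>2 \<le> C2_fun V s - C2_fun V \<xi>"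
      using V \<xi> unfolding pot_S_def by blast
    define e where "e = \<eta> * \<mu> / 4"
    have e: "e > 0" using \<eta> d by (simp add: e_def)
    have d': "min d (1 / 2) > 0" using d by simp
    have "(1 - \<eta>) * (C2_fun V s - m) \<le> C2_fun W s - m"
      if W: "W \<in> pots" "dist V W < e" and s: "s \<in> sphere 0 1" "dist s \<xi> < min d (1 / 2)" for W s
    proof -
      have "\<bar>C2_fun V s - C2_fun W s\<bar> \<le> 4 * dist V W * (dist s \<xi>)\<^sup>2"
        using s V\<xi>[OF V] V\<xi>[OF W(1)] pot_SD(3)[OF V] pot_SD(3)[OF W(1)]
        by (intro C2_close_at_common_minimum \<xi>s) auto
      also have "\<dots> \<le> 4 * e * (dist s \<xi>)\<^sup>2" using W by (intro mult_right_mono) auto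
      also have "\<dots> = \<eta> * (\<mu> * (norm (s - \<xi>))\<^sup>2)" by (simp add: e_def dist_norm)
      also have "\<dots> \<le> \<eta> * (C2_fun V s - m)"
        using d(3)[of s] s \<eta> V\<xi>[OF V] by (intro mult_left_mono) (auto simp: dist_norm)
      finally show "(1 - \<eta>) * (C2_fun V s - m) \<le> C2_fun W s - m"
        by (simp add: algebra_simps abs_le_iff)
    qed
    with e d' show ?thesis by blast
  qed
  obtain e1 d1 where 1: "e1 > 0" "d1 > 0" "\<And>W s. W \<in> pots \<Longrightarrow> dist V W < e1 \<Longrightarrow> s \<in> sphere 0 1 \<Longrightarrow> dist s xm < d1 \<Longrightarrow>
       (1 - \<eta>) * (C2_fun V s - m) \<le> C2_fun W s - m"
    using one[of xm] by blast
  obtain e2 d2 where 2: "e2 > 0" "d2 > 0" "\<And>W s. W \<in> pots \<Longrightarrow> dist V W < e2 \<Longrightarrow> s \<in> sphere 0 1 \<Longrightarrow> dist s xp < d2 \<Longrightarrow>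
       (1 - \<eta>) * (C2_fun V s - m) \<le> C2_fun W s - m"
    using one[of xp] by blast
  show thesis
    by (rule that[of "min e1 e2" "min 1 (min d1 d2)"]) (use 1 2 in auto)
qed

text \<open>
The same function calibrates all nearby parameters: decreasing the exponent increases \<open>b\<close>, and this
leaves room to replace \<open>V - g\<^sup>2\<close> by \<open>W - g\<^sup>2\<close>, which is at least \<open>(1 - \<eta>) (V - g\<^sup>2)\<close>. Near the wells this
comparison comes from the quadratic growth, and elsewhere from the lower bound for \<open>m - g\<^sup>2\<close>.
\<close>

lemma In_stable:
  assumes I: "(V, \<alpha>0) \<in> Ins" and a: "0 < \<alpha>" "\<alpha> < \<alpha>0"
  obtains e where "e > 0" "\<And>W \<beta>. W \<in> pots \<Longrightarrow> dist V W < e \<Longrightarrow> 0 < \<beta> \<Longrightarrow> \<bar>\<beta> - \<alpha>\<bar> < e \<Longrightarrow> (W, \<beta>) \<in> Ins"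
proof -
  have V: "V \<in> pots" and a0: "0 < \<alpha>0" "\<alpha>0 < 2" using In_setD[OF I] by auto
  define b0 where "b0 = 1 - \<alpha>0 / 2"
  \<comment> \<open>The value of \<open>b\<close> for the exponent halfway between \<open>\<alpha>\<close> and \<open>\<alpha>0\<close>; all exponents near \<open>\<alpha>\<close> have a larger \<open>b\<close>.\<close>
  define b1 where "b1 = 1 - (\<alpha> + \<alpha>0) / 4"
  have b: "0 < b0" "b0 < 1" "b0 < b1" "b1 < 1" using a a0 by (auto simp: b0_def b1_def)
  define \<eta> where "\<eta> = 1 - b0\<^sup>2 / b1\<^sup>2"
  have "b0\<^sup>2 < b1\<^sup>2" using b by (intro power_strict_mono) auto
  then have \<eta>: "0 < \<eta>" "\<eta> < 1" "(1 - \<eta>) * b1\<^sup>2 = b0\<^sup>2" using b by (auto simp: \<eta>_def)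
  obtain e1 \<delta> where e1: "e1 > 0" "0 < \<delta>" "\<delta> \<le> 1"
    "\<And>W s. W \<in> pots \<Longrightarrow> dist V W < e1 \<Longrightarrow> s \<in> sphere 0 1 \<Longrightarrow> dist s xm < \<delta> \<or> dist s xp < \<delta> \<Longrightarrow>
       (1 - \<eta>) * (C2_fun V s - m) \<le> C2_fun W s - m"
    using near_wells[OF V \<eta>(1)] by metis
  obtain f where "calibrated V b0 f"
    using I In_iff_calibrated[OF V a0] unfolding b0_def by blast
  then obtain g \<kappa> where g: "calibrated V b0 g" "\<kappa> > 0"
    "\<And>s. s \<in> sphere 0 1 \<Longrightarrow> \<delta> \<le> dist s xm \<Longrightarrow> \<delta> \<le> dist s xp \<Longrightarrow> \<kappa> \<le> m - (g s)\<^sup>2"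
    using calibrated_with_barriers[OF V b(1,2) _ e1(2,3)] by blast
  have gb: "(g s)\<^sup>2 \<le> m" if "s \<in> sphere 0 1" for s
  proof -
    have "\<bar>g s\<bar> \<le> \<bar>sqrt m\<bar>" using g(1) that m by (auto simp: calibrated_def)
    then have "(g s)\<^sup>2 \<le> (sqrt m)\<^sup>2" by (simp only: abs_le_square_iff)
    then show ?thesis using m by simp
  qed
  define e where "e = min (min e1 (\<eta> * \<kappa>)) ((\<alpha>0 - \<alpha>) / 2)"
  show thesis
  proof (rule that[of e])
    show "e > 0" using e1 \<eta> g a by (simp add: e_def)
    fix W \<beta> assume W: "W \<in> pots" "dist V W < e" and \<beta>: "0 < \<beta>" "\<bar>\<beta> - \<alpha>\<bar> < e"
    have "e \<le> (\<alpha>0 - \<alpha>) / 2" unfolding e_def by (rule min.cobounded2)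
    then have \<beta>2: "\<beta> < (\<alpha> + \<alpha>0) / 2" using \<beta>(2) by argo
    then have \<beta>3: "\<beta> < 2" using a a0 by argo
    have bb: "b1 < 1 - \<beta> / 2" using \<beta>2 by (simp add: b1_def)
    have comp: "(1 - \<eta>) * (C2_fun V s - (g s)\<^sup>2) \<le> C2_fun W s - (g s)\<^sup>2" if s: "s \<in> sphere 0 1" for s
    proof (cases "dist s xm < \<delta> \<or> dist s xp < \<delta>")
      case True
      have "(1 - \<eta>) * (C2_fun V s - m) \<le> C2_fun W s - m"
        using W e1(4)[OF W(1) _ s True] by (simp add: e_def)
      moreover have "(1 - \<eta>) * (m - (g s)\<^sup>2) \<le> m - (g s)\<^sup>2"
        using gb[OF s] \<eta> by (simp add: mult_left_le_one_le)
      ultimately have "(1 - \<eta>) * (C2_fun V s - m) + (1 - \<eta>) * (m - (g s)\<^sup>2) \<le> (C2_fun W s - m) + (m - (g s)\<^sup>2)"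
        by (rule add_mono)
      then show ?thesis by (simp flip: distrib_left)
    next
      case False
      then have "\<kappa> \<le> m - (g s)\<^sup>2" using s by (intro g(3)) auto
      then have "\<eta> * \<kappa> \<le> \<eta> * (C2_fun V s - (g s)\<^sup>2)"
        using \<eta> pot_SD(3)[OF V s] by (intro mult_left_mono) auto
      moreover have "\<bar>C2_fun V s - C2_fun W s\<bar> < \<eta> * \<kappa>"
        using C2_dist_bounds(1)[OF s, of V W] W by (simp add: e_def)
      moreover have "(1 - \<eta>) * (C2_fun V s - (g s)\<^sup>2) = C2_fun V s - (g s)\<^sup>2 - \<eta> * (C2_fun V s - (g s)\<^sup>2)"
        by (simp add: algebra_simps)
      ultimately show ?thesis by (simp add: abs_less_iff)
    qed
    have "subsolution (C2_fun W) (1 - \<beta> / 2) g"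
      unfolding subsolution_def
    proof (intro ballI conjI)
      fix s :: 'a assume s: "s \<in> sphere 0 1"
      show "(g s)\<^sup>2 \<le> C2_fun W s" using gb[OF s] pot_SD(3)[OF W(1) s] by simp
      have "slope_le (sphere 0 1) g s (b0 * sqrt (C2_fun V s - (g s)\<^sup>2))"
        using g(1) s by (auto simp: calibrated_def subsolution_def)
      moreover have "b0 * sqrt (C2_fun V s - (g s)\<^sup>2) \<le> (1 - \<beta> / 2) * sqrt (C2_fun W s - (g s)\<^sup>2)"
      proof -
        have "b0 * sqrt (C2_fun V s - (g s)\<^sup>2) = b1 * sqrt ((1 - \<eta>) * (C2_fun V s - (g s)\<^sup>2))"
        proof -
          have "b0 = sqrt (1 - \<eta>) * b1"
            using b \<eta> by (metis abs_of_pos order_less_trans real_sqrt_abs real_sqrt_mult)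
          then show ?thesis by (simp add: real_sqrt_mult)
        qed
        also have "\<dots> \<le> (1 - \<beta> / 2) * sqrt (C2_fun W s - (g s)\<^sup>2)"
          using comp[OF s] bb b gb[OF s] pot_SD(3)[OF V s] \<eta> by (intro mult_mono) auto
        finally show ?thesis .
      qed
      ultimately show "slope_le (sphere 0 1) g s ((1 - \<beta> / 2) * sqrt (C2_fun W s - (g s)\<^sup>2))"
        by (rule slope_le_mono)
    qed
    then have "calibrated W (1 - \<beta> / 2) g" using g(1) by (auto simp: calibrated_def)
    then show "(W, \<beta>) \<in> Ins" using In_iff_calibrated[OF W(1) \<beta>(1) \<beta>3] by blast
  qed
qed

text \<open>
Multiplying a calibration by \<open>c\<^sup>2\<close> makes it a subsolution for the limit parameter: one factor \<open>c\<close> pays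
for the difference of the exponents and the other for the difference of the potentials. The lower bound for
the minimal action then loses only the factor \<open>c\<^sup>2\<close>, which is arbitrarily close to \<open>1\<close>.
\<close>

lemma In_closed:
  assumes V: "V \<in> pots" and a: "0 < \<alpha>" "\<alpha> < 2"
    and lim: "\<And>e. e > 0 \<Longrightarrow> \<exists>W \<beta>. (W, \<beta>) \<in> Ins \<and> dist V W < e \<and> \<bar>\<beta> - \<alpha>\<bar> < e"
  shows "(V, \<alpha>) \<in> Ins"
proof -
  define b where "b = 1 - \<alpha> / 2"
  have b: "0 < b" using a by (simp add: b_def)
  define T where "T = 4 * sqrt (2 * m) / (2 - \<alpha>)"
  have T: "T > 0" using a m by (simp add: T_def)
  have near: "ennreal (c\<^sup>2 * T) \<le> min_action xm xp (V, \<alpha>)" if c: "0 < c" "c < 1" for c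
  proof -
    have c2: "c\<^sup>2 < 1" using c by (simp add: power_less_one_iff)
    \<comment> \<open>Parameters this close satisfy \<open>c\<^sup>2 W \<le> V\<close> and \<open>c b' \<le> b\<close>.\<close>
    define e where "e = min (m * (1 / c\<^sup>2 - 1)) (2 * b * (1 / c - 1))"
    have "e > 0" using m c c2 b by (simp add: e_def)
    then obtain W \<beta> where W: "(W, \<beta>) \<in> Ins" "dist V W < e" "\<bar>\<beta> - \<alpha>\<bar> < e" using lim by blast
    have WS: "W \<in> pots" "0 < \<beta>" "\<beta> < 2" using In_setD[OF W(1)] by auto
    define b' where "b' = 1 - \<beta> / 2"
    have b': "0 < b'" using WS by (simp add: b'_def)
    have cb: "c * b' \<le> b"
    proof -
      define X where "X = b * (1 / c - 1)"
      have "\<bar>\<beta> - \<alpha>\<bar> < 2 * X" using W(3) by (simp add: e_def X_def)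
      then have "b' \<le> b + X" unfolding b'_def b_def by argo
      also have "\<dots> = b / c" by (simp add: X_def algebra_simps)
      finally show ?thesis using c by (simp add: field_simps)
    qed
    obtain f where f: "calibrated W b' f" using W(1) In_iff_calibrated[OF WS] unfolding b'_def by blast
    have "subsolution (C2_fun V) b (\<lambda>s. c\<^sup>2 * f s)"
      unfolding subsolution_def
    proof (intro ballI conjI)
      fix s :: 'a assume s: "s \<in> sphere 0 1"
      have fs: "(f s)\<^sup>2 \<le> C2_fun W s" "slope_le (sphere 0 1) f s (b' * sqrt (C2_fun W s - (f s)\<^sup>2))"
        using f s by (auto simp: calibrated_def subsolution_def)
      have cWV: "c\<^sup>2 * C2_fun W s \<le> C2_fun V s"
      proof -
        have "C2_fun W s \<le> C2_fun V s + m * (1 / c\<^sup>2 - 1)"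
          using C2_dist_bounds(1)[OF s, of V W] W(2) by (simp add: e_def abs_le_iff)
        also have "\<dots> \<le> C2_fun V s + C2_fun V s * (1 / c\<^sup>2 - 1)"
          using pot_SD(3)[OF V s] c c2 by (intro add_left_mono mult_right_mono) (auto simp: field_simps)
        also have "\<dots> = C2_fun V s / c\<^sup>2" by (simp add: algebra_simps)
        finally show ?thesis using c by (simp add: field_simps)
      qed
      have "(c\<^sup>2 * f s)\<^sup>2 = c\<^sup>2 * (c\<^sup>2 * (f s)\<^sup>2)" by (simp add: power2_eq_square)
      also have "\<dots> \<le> 1 * (c\<^sup>2 * (f s)\<^sup>2)" using c2 by (intro mult_right_mono) auto
      finally have cf: "(c\<^sup>2 * f s)\<^sup>2 \<le> c\<^sup>2 * (f s)\<^sup>2" by simp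
      have cfW: "c\<^sup>2 * (f s)\<^sup>2 \<le> c\<^sup>2 * C2_fun W s" using fs by (intro mult_left_mono) auto
      show "(c\<^sup>2 * f s)\<^sup>2 \<le> C2_fun V s" using cf cfW cWV by linarith
      have "slope_le (sphere 0 1) (\<lambda>s. c\<^sup>2 * f s) s (c\<^sup>2 * (b' * sqrt (C2_fun W s - (f s)\<^sup>2)))"
        by (intro slope_le_cmult fs) simp
      moreover have "c\<^sup>2 * (b' * sqrt (C2_fun W s - (f s)\<^sup>2)) \<le> b * sqrt (C2_fun V s - (c\<^sup>2 * f s)\<^sup>2)"
      proof -
        have "c\<^sup>2 * (b' * sqrt (C2_fun W s - (f s)\<^sup>2)) = (c * b') * sqrt (c\<^sup>2 * (C2_fun W s - (f s)\<^sup>2))"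
          using c by (simp add: real_sqrt_mult power2_eq_square)
        also have "\<dots> \<le> b * sqrt (C2_fun V s - (c\<^sup>2 * f s)\<^sup>2)"
        proof (rule mult_mono)
          show "sqrt (c\<^sup>2 * (C2_fun W s - (f s)\<^sup>2)) \<le> sqrt (C2_fun V s - (c\<^sup>2 * f s)\<^sup>2)"
            using cf cWV by (simp add: right_diff_distrib)
        qed (use cb b fs in auto)
        finally show ?thesis .
      qed
      ultimately show "slope_le (sphere 0 1) (\<lambda>s. c\<^sup>2 * f s) s (b * sqrt (C2_fun V s - (c\<^sup>2 * f s)\<^sup>2))"
        by (rule slope_le_mono)
    qed
    then have "ennreal (sqrt 2 / b * (c\<^sup>2 * f xp - c\<^sup>2 * f xm)) \<le> min_action xm xp (V, \<alpha>)"
      by (intro subsolution_imp_min_action_ge[OF m pot_SD(3)[OF V] a b_def]) (use xm xp in auto)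
    moreover have "sqrt 2 / b * (c\<^sup>2 * f xp - c\<^sup>2 * f xm) = c\<^sup>2 * T"
      using f threshold_eq[OF a(2)] by (simp add: calibrated_def T_def b_def)
    ultimately show ?thesis by simp
  qed
  have "ennreal T \<le> min_action xm xp (V, \<alpha>)"
  proof (rule ennreal_le_epsilon)
    fix e :: real assume e: "e > 0"
    define c where "c = sqrt (1 - min (1 / 2) (e / T))"
    have "0 < min (1 / 2) (e / T)" using e T by simp
    then have c: "0 < c" "c < 1" "c\<^sup>2 = 1 - min (1 / 2) (e / T)" unfolding c_def by auto
    have "T - e \<le> c\<^sup>2 * T"
    proof -
      have "min (1 / 2) (e / T) * T \<le> e / T * T" using T by (intro mult_right_mono) auto
      then show ?thesis using T by (simp add: c(3) left_diff_distrib)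
    qed
    then have "ennreal T \<le> ennreal (c\<^sup>2 * T + e)" by (intro ennreal_leI) simp
    also have "\<dots> = ennreal (c\<^sup>2 * T) + ennreal e" using e T by (intro ennreal_plus) auto
    also have "\<dots> \<le> min_action xm xp (V, \<alpha>) + ennreal e" by (intro add_right_mono near c)
    finally show "ennreal T \<le> min_action xm xp (V, \<alpha>) + ennreal e" .
  qed
  then show ?thesis using In_iff_ge[OF V a] by (simp add: T_def)
qed

text \<open>
A chain whose cost is bounded for all exponents eventually beats the threshold, which tends to
infinity as the exponent tends to \<open>2\<close>.
\<close>

lemma In_exponent_bound:
  assumes V: "V \<in> pots"
  obtains A where "A < 2" "\<And>\<alpha>. (V, \<alpha>) \<in> Ins \<Longrightarrow> \<alpha> \<le> A"
proof -
  have x0: "xm \<noteq> 0" "xp \<noteq> 0" using xm xp by auto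
  then obtain K0 where K0: "\<forall>\<alpha>\<in>{0<..<2}. reach (homog_pot V \<alpha>) xm xp K0"
    using reach_uniform[OF dim, of xm xp V] by blast
  define K where "K = max 1 K0"
  have K: "K > 0" by (simp add: K_def)
  show thesis
  proof (rule that[of "2 - 4 * sqrt (2 * m) / K"])
    show "2 - 4 * sqrt (2 * m) / K < 2" using m K by simp
    fix \<alpha> assume I: "(V, \<alpha>) \<in> Ins"
    then have a: "0 < \<alpha>" "\<alpha> < 2" using In_setD by auto
    have "reach (homog_pot V \<alpha>) xm xp K"
      using K0 a by (intro reach_mono[of _ _ _ K0 K]) (auto simp: K_def)
    then have "min_action xm xp (V, \<alpha>) \<le> ennreal K"
      by (rule reach_imp_min_action_le[OF _ x0(1) xne])
    moreover have "ennreal (4 * sqrt (2 * m) / (2 - \<alpha>)) \<le> min_action xm xp (V, \<alpha>)"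
      using In_iff_ge[OF V a] I by simp
    ultimately have "ennreal (4 * sqrt (2 * m) / (2 - \<alpha>)) \<le> ennreal K" by (rule order_trans[rotated])
    then have "4 * sqrt (2 * m) / (2 - \<alpha>) \<le> K" using K by simp
    then show "\<alpha> \<le> 2 - 4 * sqrt (2 * m) / K" using a K by (simp add: field_simps)
  qed
qed

text \<open>
The potential is steep away from the wells, so it admits a calibration that climbs from \<open>- \<surd>m\<close> to \<open>\<surd>m\<close>
quadratically within a ball around \<open>xm\<close> that stays away from \<open>xp\<close>, and is constant outside this ball.
\<close>

lemma In_nonempty: "\<exists>V \<alpha>. (V, \<alpha>) \<in> Ins"
proof -
  define R where "R = dist xm xp / 2"
  have R: "R > 0" using xne by (simp add: R_def)
  \<comment> \<open>The slope of \<open>f\<close> below is at most \<open>4 \<surd>m D / R\<^sup>2\<close> at distance \<open>D \<le> R\<close> from \<open>xm\<close>, and \<open>b = 1 / 2\<close>, so \<open>V - m\<close> has to be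
    at least \<open>64 m D\<^sup>2 / R\<^sup>4\<close> there; the lower bound \<open>C R\<^sup>2 D\<^sup>2 / 4\<close> is exactly this.\<close>
  define C where "C = 4 * m * (64 / R ^ 6)"
  have C: "C > 0" using m R by (simp add: C_def)
  obtain V :: "'a C2_sphere" where V0: "\<And>s. s \<in> sphere 0 1 \<Longrightarrow> C2_fun V s = m + C * (1 - s \<bullet> xm) * (1 - s \<bullet> xp)"
    using C2_well_exists[where m = m and c = C and xm = xm and xp = xp] by metis
  have inner: "1 - s \<bullet> \<xi> = (dist s \<xi>)\<^sup>2 / 2" if "s \<in> sphere 0 1" "\<xi> \<in> sphere 0 1" for s \<xi> :: 'a
  proof -
    have "s \<bullet> s = 1" "\<xi> \<bullet> \<xi> = 1" using that by (simp_all add: norm_eq_1)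
    then show ?thesis by (simp add: dist_norm power2_norm_eq_inner inner_diff_left inner_diff_right inner_commute)
  qed
  have V1: "C2_fun V s = m + C / 4 * (dist s xm)\<^sup>2 * (dist s xp)\<^sup>2" if "s \<in> sphere 0 1" for s
    using V0[OF that] inner[OF that xm] inner[OF that xp] by simp
  have far: "R \<le> dist s xp" if "dist s xm \<le> R" for s
    using dist_triangle3[of xm xp s] that by (simp add: R_def dist_commute)
  have far': "R \<le> dist s xm" if "dist s xp \<le> R" for s
    using dist_triangle3[of xm xp s] that by (simp add: R_def dist_commute)
  have grow: "C / 4 * R\<^sup>2 * (dist s xm)\<^sup>2 \<le> C2_fun V s - m" if "s \<in> sphere 0 1" "dist s xm \<le> R" for s
  proof -
    have "R\<^sup>2 \<le> (dist s xp)\<^sup>2" using far[OF that(2)] R by (intro power_mono) auto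
    then have "C / 4 * (dist s xm)\<^sup>2 * R\<^sup>2 \<le> C / 4 * (dist s xm)\<^sup>2 * (dist s xp)\<^sup>2"
      using C by (intro mult_left_mono) auto
    then show ?thesis using V1[OF that(1)] by (simp add: mult_ac)
  qed
  have grow': "C / 4 * R\<^sup>2 * (dist s xp)\<^sup>2 \<le> C2_fun V s - m" if "s \<in> sphere 0 1" "dist s xp \<le> R" for s
  proof -
    have "R\<^sup>2 \<le> (dist s xm)\<^sup>2" using far'[OF that(2)] R by (intro power_mono) auto
    then have "C / 4 * (dist s xp)\<^sup>2 * R\<^sup>2 \<le> C / 4 * (dist s xp)\<^sup>2 * (dist s xm)\<^sup>2"
      using C by (intro mult_left_mono) auto
    then show ?thesis using V1[OF that(1)] by (simp add: mult_ac)
  qed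
  have Vm: "C2_fun V xm = m" "C2_fun V xp = m" using V1[OF xm] V1[OF xp] by auto
  have Vge: "m \<le> C2_fun V s" if "s \<in> sphere 0 1" for s
    using V1[OF that] C by simp
  have pos: "C / 4 * R\<^sup>2 > 0" using C R by simp
  have VS: "V \<in> pots"
    unfolding pot_S_def
  proof (intro CollectI ballI)
    fix \<xi> assume \<xi>: "\<xi> \<in> {xm, xp}"
    then have V\<xi>: "C2_fun V \<xi> = m" using Vm by auto
    have "C / 4 * R\<^sup>2 * (norm (s - \<xi>))\<^sup>2 \<le> C2_fun V s - C2_fun V \<xi>" if "s \<in> sphere 0 1" "norm (s - \<xi>) < R" for s
      using \<xi> grow[OF that(1)] grow'[OF that(1)] that(2) V\<xi> by (auto simp: dist_norm)
    then show "C2_fun V \<xi> = m \<and> (\<forall>s\<in>sphere 0 1. C2_fun V \<xi> \<le> C2_fun V s) \<and>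
        (\<exists>\<delta>>0. \<exists>\<mu>>0. \<forall>s\<in>sphere 0 1. norm (s - \<xi>) < \<delta> \<longrightarrow> \<mu> * (norm (s - \<xi>))\<^sup>2 \<le> C2_fun V s - C2_fun V \<xi>)"
      using V\<xi> Vge R pos by blast
  qed
  define q where "q = (\<lambda>s. 1 / R\<^sup>2 * (dist s xm)\<^sup>2)"
  define f where "f = (\<lambda>s. 2 * sqrt m * min (q s) 1 - sqrt m)"
  have q0: "0 \<le> q s" for s by (simp add: q_def)
  have f_bound: "\<bar>f s\<bar> \<le> sqrt m" for s
  proof -
    have "0 \<le> 2 * sqrt m * min (q s) 1" using q0 m by simp
    moreover have "2 * sqrt m * min (q s) 1 \<le> 2 * sqrt m * 1" using m by (intro mult_left_mono) auto
    ultimately show ?thesis unfolding f_def by linarith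
  qed
  have f2: "(f s)\<^sup>2 \<le> m" for s
  proof -
    have "\<bar>f s\<bar> \<le> \<bar>sqrt m\<bar>" using f_bound[of s] m by simp
    then have "(f s)\<^sup>2 \<le> (sqrt m)\<^sup>2" by (simp only: abs_le_square_iff)
    then show ?thesis using m by simp
  qed
  have sub: "subsolution (C2_fun V) (1 / 2) f"
    unfolding subsolution_def
  proof (intro ballI conjI)
    fix s :: 'a assume s: "s \<in> sphere 0 1"
    show fV: "(f s)\<^sup>2 \<le> C2_fun V s" using f2[of s] Vge[OF s] by linarith
    define L where "L = 1 / 2 * sqrt (C2_fun V s - (f s)\<^sup>2) / (2 * sqrt m)"
    have L0: "0 \<le> L" using fV m by (simp add: L_def)
    have "slope_le (sphere 0 1) q s (1 / R\<^sup>2 * (2 * dist s xm))"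
      unfolding q_def by (intro slope_le_cmult slope_le_dist_power2) simp
    moreover have "1 / R\<^sup>2 * (2 * dist s xm) \<le> L" if "q s \<le> 1"
    proof -
      have "(dist s xm)\<^sup>2 \<le> R\<^sup>2" using that R by (simp add: q_def field_simps)
      then have D: "dist s xm \<le> R" using R by (simp add: power2_le_iff_abs_le)
      have "4 * m * (2 * (1 / R\<^sup>2 * (2 * dist s xm)))\<^sup>2 = C / 4 * R\<^sup>2 * (dist s xm)\<^sup>2"
        using R m by (simp add: C_def power_mult_distrib field_simps power2_eq_square power_numeral_reduce)
      also have "\<dots> \<le> C2_fun V s - (f s)\<^sup>2"
        using grow[OF s D] f2[of s] by linarith
      finally have "sqrt (4 * m * (2 * (1 / R\<^sup>2 * (2 * dist s xm)))\<^sup>2) \<le> sqrt (C2_fun V s - (f s)\<^sup>2)"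
        by simp
      then have "2 * sqrt m * (2 * (1 / R\<^sup>2 * (2 * dist s xm))) \<le> sqrt (C2_fun V s - (f s)\<^sup>2)"
        using m R by (simp add: real_sqrt_mult)
      then show ?thesis using m by (simp add: L_def field_simps)
    qed
    ultimately have qL: "slope_le (sphere 0 1) q s L" if "q s \<le> 1" using that slope_le_mono by blast
    have "slope_le (sphere 0 1) (\<lambda>s. min (q s) 1) s L"
    proof (rule slope_le_min)
      show "(q \<longlongrightarrow> q s) (at s within sphere 0 1)"
        unfolding q_def by (intro tendsto_intros)
      show "slope_le (sphere 0 1) (\<lambda>_. 1) s L" using L0 by (intro slope_le_locally_const) auto
    qed (use qL in auto)
    then have "slope_le (sphere 0 1) (\<lambda>s. 2 * sqrt m * min (q s) 1) s (2 * sqrt m * L)"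
      using m by (intro slope_le_cmult) auto
    moreover have "2 * sqrt m * L = 1 / 2 * sqrt (C2_fun V s - (f s)\<^sup>2)" using m by (simp add: L_def)
    ultimately show "slope_le (sphere 0 1) f s (1 / 2 * sqrt (C2_fun V s - (f s)\<^sup>2))"
      by (simp add: slope_le_def f_def)
  qed
  have "q xp \<ge> 1"
    using R by (simp add: q_def R_def dist_commute power_divide)
  then have "f xp = sqrt m" by (simp add: f_def)
  moreover have "f xm = - sqrt m" by (simp add: f_def q_def)
  ultimately have "calibrated V (1 - 1 / 2) f" using sub f_bound by (simp add: calibrated_def)
  then have "(V, 1) \<in> Ins" using In_iff_calibrated[OF VS, of 1] by auto
  then show ?thesis by blast
qed

section \<open>The critical exponent and the common boundary\<close>

definition In_exponents :: "'a C2_sphere \<Rightarrow> real set" where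
  "In_exponents V = {\<alpha>. (V, \<alpha>) \<in> Ins}"

definition critical :: "'a C2_sphere \<Rightarrow> real" where
  "critical V = Sup (In_exponents V)"

definition admissible :: "'a C2_sphere set" where
  "admissible = {V. In_exponents V \<noteq> {}}"

lemma admissible_pots: "V \<in> admissible \<Longrightarrow> V \<in> pots"
  using In_setD by (auto simp: admissible_def In_exponents_def)

lemma bdd_In_exponents: "bdd_above (In_exponents V)"
  using In_setD by (intro bdd_aboveI[of _ 2]) (auto simp: In_exponents_def less_imp_le)

lemma le_critical: "(V, \<alpha>) \<in> Ins \<Longrightarrow> \<alpha> \<le> critical V"
  unfolding critical_def by (intro cSup_upper bdd_In_exponents) (simp add: In_exponents_def)

lemma critical_In:
  assumes V: "V \<in> admissible"
  shows "(V, critical V) \<in> Ins"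
proof -
  have VS: "V \<in> pots" using V by (rule admissible_pots)
  have ne: "In_exponents V \<noteq> {}" using V by (simp add: admissible_def)
  then obtain \<alpha>0 where \<alpha>0: "(V, \<alpha>0) \<in> Ins" by (auto simp: In_exponents_def)
  then have "0 < critical V" using In_setD[OF \<alpha>0] le_critical[OF \<alpha>0] by linarith
  obtain A where A: "A < 2" "\<And>\<alpha>. (V, \<alpha>) \<in> Ins \<Longrightarrow> \<alpha> \<le> A"
    using In_exponent_bound[OF VS] by metis
  have "critical V \<le> A"
    unfolding critical_def by (rule cSup_least[OF ne]) (use A in \<open>auto simp: In_exponents_def\<close>)
  then have "critical V < 2" using A by simp
  show ?thesis
  proof (rule In_closed[OF VS])
    fix e :: real assume "e > 0"
    then have "critical V - e < Sup (In_exponents V)" by (simp add: critical_def)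
    then obtain \<alpha> where "\<alpha> \<in> In_exponents V" "critical V - e < \<alpha>"
      using less_cSup_iff[OF ne bdd_In_exponents] by blast
    then have "(V, \<alpha>) \<in> Ins \<and> dist V V < e \<and> \<bar>\<alpha> - critical V\<bar> < e"
      using le_critical[of V \<alpha>] \<open>e > 0\<close> by (auto simp: In_exponents_def)
    then show "\<exists>W \<beta>. (W, \<beta>) \<in> Ins \<and> dist V W < e \<and> \<bar>\<beta> - critical V\<bar> < e" by blast
  qed fact+
qed

lemma In_iff_le_critical:
  assumes V: "V \<in> admissible" and a: "0 < \<alpha>"
  shows "(V, \<alpha>) \<in> Ins \<longleftrightarrow> \<alpha> \<le> critical V"
proof
  assume "\<alpha> \<le> critical V"
  then consider "\<alpha> = critical V" | "\<alpha> < critical V" by linarith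
  then show "(V, \<alpha>) \<in> Ins"
  proof cases
    case 2
    obtain e where "e > 0" "\<And>W \<beta>. W \<in> pots \<Longrightarrow> dist V W < e \<Longrightarrow> 0 < \<beta> \<Longrightarrow> \<bar>\<beta> - \<alpha>\<bar> < e \<Longrightarrow> (W, \<beta>) \<in> Ins"
      using In_stable[OF critical_In[OF V] a 2] by metis
    then show ?thesis using admissible_pots[OF V] a by simp
  qed (use critical_In[OF V] in simp)
qed (rule le_critical)

lemma critical_bounds: "V \<in> admissible \<Longrightarrow> 0 < critical V \<and> critical V < 2"
  using In_setD[OF critical_In] by blast

lemma admissible_open: "openin (top_of_set pots) admissible"
  unfolding openin_euclidean_subtopology_iff
proof (intro conjI ballI)
  show "admissible \<subseteq> pots" using admissible_pots by blast
  fix V assume V: "V \<in> admissible"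
  have half: "0 < critical V / 2" "critical V / 2 < critical V" using critical_bounds[OF V] by auto
  obtain e where e: "e > 0" "\<And>W \<beta>. W \<in> pots \<Longrightarrow> dist V W < e \<Longrightarrow> 0 < \<beta> \<Longrightarrow> \<bar>\<beta> - critical V / 2\<bar> < e \<Longrightarrow> (W, \<beta>) \<in> Ins"
    using In_stable[OF critical_In[OF V] half] by metis
  have "W \<in> admissible" if "W \<in> pots" "dist W V < e" for W
  proof -
    have "(W, critical V / 2) \<in> Ins"
      by (rule e(2)) (use that half e(1) in \<open>auto simp: dist_commute\<close>)
    then show ?thesis by (auto simp: admissible_def In_exponents_def)
  qed
  then show "\<exists>e>0. \<forall>W\<in>pots. dist W V < e \<longrightarrow> W \<in> admissible" using e(1) by blast
qed

text \<open>
Stability just below the critical exponent gives lower semicontinuity, and closedness of In just above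
it gives upper semicontinuity.
\<close>

lemma critical_continuous: "continuous_on admissible critical"
  unfolding continuous_on_iff
proof (intro ballI allI impI)
  fix V and e :: real assume V: "V \<in> admissible" and e: "e > 0"
  note cV = critical_bounds[OF V]
  have VS: "V \<in> pots" using V by (rule admissible_pots)
  define lo where "lo = max (critical V - e / 2) (critical V / 2)"
  have lo: "0 < lo" "lo < critical V" "critical V - e < lo" using cV e by (auto simp: lo_def)
  obtain d1 where d1: "d1 > 0" "\<And>W \<beta>. W \<in> pots \<Longrightarrow> dist V W < d1 \<Longrightarrow> 0 < \<beta> \<Longrightarrow> \<bar>\<beta> - lo\<bar> < d1 \<Longrightarrow> (W, \<beta>) \<in> Ins"
    using In_stable[OF critical_In[OF V] lo(1,2)] by metis
  define hi where "hi = min (critical V + e / 2) ((critical V + 2) / 2)"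
  have hi: "0 < hi" "hi < 2" "critical V < hi" "hi < critical V + e" using cV e by (auto simp: hi_def min_less_iff_disj)
  have "(V, hi) \<notin> Ins" using In_iff_le_critical[OF V hi(1)] hi(3) by simp
  then obtain d2 where d2: "d2 > 0" "\<And>W \<beta>. (W, \<beta>) \<in> Ins \<Longrightarrow> dist V W < d2 \<Longrightarrow> \<not> \<bar>\<beta> - hi\<bar> < d2"
    using In_closed[OF VS hi(1,2)] by blast
  have "dist (critical W) (critical V) < e" if W: "W \<in> admissible" "dist W V < min d1 d2" for W
  proof -
    have "(W, lo) \<in> Ins"
      by (rule d1(2)) (use W lo d1(1) admissible_pots in \<open>auto simp: dist_commute\<close>)
    then have "lo \<le> critical W" by (rule le_critical)
    moreover have "(W, hi) \<notin> Ins" using d2(2)[of W hi] W d2(1) by (auto simp: dist_commute)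
    then have "critical W < hi" using In_iff_le_critical[OF W(1) hi(1)] by simp
    ultimately show ?thesis using lo(3) hi(4) unfolding dist_real_def by linarith
  qed
  then show "\<exists>d>0. \<forall>W\<in>admissible. dist W V < d \<longrightarrow> dist (critical W) (critical V) < e"
    using d1(1) d2(1) by (intro exI[of _ "min d1 d2"]) auto
qed

lemma In_closedin: "closedin (top_of_set params) Ins"
proof -
  have sub: "Ins \<subseteq> params" by (auto simp: In_set_def)
  have "p \<in> Ins" if p: "p \<in> params" and lim: "\<And>e. e > 0 \<Longrightarrow> \<exists>x\<in>Ins. dist x p < e" for p
  proof -
    obtain V \<alpha> where p_eq: "p = (V, \<alpha>)" by force
    show ?thesis
      unfolding p_eq
    proof (rule In_closed)
      show "V \<in> pots" "0 < \<alpha>" "\<alpha> < 2" using p by (auto simp: p_eq pot_P_def)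
      fix e :: real assume "e > 0"
      then obtain x where x: "x \<in> Ins" "dist x p < e" using lim by blast
      have "dist (fst x) V < e" "dist (snd x) \<alpha> < e"
        using dist_fst_le[of x p] dist_snd_le[of x p] x(2) by (auto simp: p_eq)
      then show "\<exists>W \<beta>. (W, \<beta>) \<in> Ins \<and> dist V W < e \<and> \<bar>\<beta> - \<alpha>\<bar> < e"
        using x(1) by (intro exI[of _ "fst x"] exI[of _ "snd x"]) (auto simp: dist_commute dist_real_def)
    qed
  qed
  then have "Ins = params \<inter> closure Ins"
    using sub closure_subset[of Ins] by (auto simp: closure_approachable)
  then show ?thesis unfolding closedin_closed by blast
qed

lemma Pi_eq_diff_interior: "Pi_set xm xp m = Ins - top_of_set params interior_of Ins"
proof -
  have "topspace (top_of_set params) - Ins = Outs" by (simp add: Out_eq)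
  then have "top_of_set params frontier_of Outs = top_of_set params frontier_of Ins"
    using frontier_of_complement[of "top_of_set params" Ins] by simp
  then have "Pi_set xm xp m = top_of_set params frontier_of Ins" by (simp add: Pi_set_def)
  then show ?thesis
    using closure_of_closedin[OF In_closedin] by (simp add: frontier_of_def)
qed

text \<open>
Below the critical exponent \<open>In_stable\<close> provides a neighbourhood; at the critical exponent every
neighbourhood contains the same potential with a slightly larger exponent, which is Out.
\<close>

lemma interior_In_iff:
  assumes I: "(V, \<alpha>) \<in> Ins"
  shows "(V, \<alpha>) \<in> top_of_set params interior_of Ins \<longleftrightarrow> \<alpha> < critical V"
proof
  have V: "V \<in> admissible" using I by (auto simp: admissible_def In_exponents_def)
  have VS: "V \<in> pots" and a: "0 < \<alpha>" "\<alpha> < 2" using In_setD[OF I] by auto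
  {
    assume lt: "\<alpha> < critical V"
    obtain e where e: "e > 0" "\<And>W \<beta>. W \<in> pots \<Longrightarrow> dist V W < e \<Longrightarrow> 0 < \<beta> \<Longrightarrow> \<bar>\<beta> - \<alpha>\<bar> < e \<Longrightarrow> (W, \<beta>) \<in> Ins"
      using In_stable[OF critical_In[OF V] a(1) lt] by metis
    let ?T = "params \<inter> ball V e \<times> ball \<alpha> e"
    have "openin (top_of_set params) ?T" by (intro openin_open_Int open_Times open_ball)
    moreover have "(V, \<alpha>) \<in> ?T" using VS a e(1) by (simp add: pot_P_def)
    moreover have "?T \<subseteq> Ins"
      using e(2) by (auto simp: pot_P_def dist_real_def abs_minus_commute)
    ultimately show "(V, \<alpha>) \<in> top_of_set params interior_of Ins"
      unfolding interior_of_def by blast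
  }
  {
    assume "(V, \<alpha>) \<in> top_of_set params interior_of Ins"
    then obtain T where T: "openin (top_of_set params) T" "(V, \<alpha>) \<in> T" "T \<subseteq> Ins"
      unfolding interior_of_def by blast
    obtain e where e: "e > 0" "\<And>y. y \<in> params \<Longrightarrow> dist y (V, \<alpha>) < e \<Longrightarrow> y \<in> T"
      using T(1,2) unfolding openin_euclidean_subtopology_iff by blast
    define \<beta> where "\<beta> = min (\<alpha> + e / 2) ((\<alpha> + 2) / 2)"
    have \<beta>: "\<alpha> < \<beta>" "\<beta> < 2" "\<beta> < \<alpha> + e" using a e(1) by (auto simp: \<beta>_def min_less_iff_disj)
    have "(V, \<beta>) \<in> T"
      by (rule e(2)) (use VS a \<beta> in \<open>auto simp: pot_P_def dist_Pair_Pair dist_real_def\<close>)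
    then have "\<beta> \<le> critical V" using T(3) le_critical by blast
    then show "\<alpha> < critical V" using \<beta>(1) by simp
  }
qed

lemma Pi_eq_graph: "Pi_set xm xp m = {(V, critical V) | V. V \<in> admissible}"
proof (intro set_eqI iffI)
  fix p assume p: "p \<in> Pi_set xm xp m"
  obtain V \<alpha> where p_eq: "p = (V, \<alpha>)" by force
  have I: "(V, \<alpha>) \<in> Ins" and "\<not> \<alpha> < critical V"
    using p interior_In_iff[of V \<alpha>] unfolding Pi_eq_diff_interior p_eq by auto
  then have "\<alpha> = critical V" using le_critical[OF I] by simp
  moreover have "V \<in> admissible" using I by (auto simp: admissible_def In_exponents_def)
  ultimately show "p \<in> {(V, critical V) | V. V \<in> admissible}" by (auto simp: p_eq)
next
  fix p assume "p \<in> {(V, critical V) | V. V \<in> admissible}"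
  then obtain V where V: "V \<in> admissible" "p = (V, critical V)" by blast
  then show "p \<in> Pi_set xm xp m"
    using critical_In[OF V(1)] interior_In_iff[OF critical_In[OF V(1)]] by (simp add: Pi_eq_diff_interior)
qed

end

theorem lemma1p3:
  fixes xm xp :: "real ^ 'n" and Vmin :: real
  assumes "CARD('n) \<ge> 2"
    and "xm \<in> sphere 0 1" and "xp \<in> sphere 0 1" and "xp \<noteq> xm"
    and "Vmin > 0"
  shows "\<exists>(U :: (real ^ 'n) C2_sphere set) (\<alpha> :: (real ^ 'n) C2_sphere \<Rightarrow> real).
    openin (top_of_set (pot_S xm xp Vmin)) U \<and> U \<noteq> {} \<and>
    continuous_on U \<alpha> \<and> (\<forall>V\<in>U. \<alpha> V \<in> {0<..<2}) \<and>
    Pi_set xm xp Vmin = {(V, \<alpha> V) | V. V \<in> U}"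
proof -
  interpret wells xm xp Vmin
    by unfold_locales (use assms in auto)
  have "admissible \<noteq> {}"
    using In_nonempty by (auto simp: admissible_def In_exponents_def)
  then show ?thesis
    using admissible_open critical_continuous critical_bounds Pi_eq_graph
    by (intro exI[of _ admissible] exI[of _ critical] conjI ballI) auto
qed

end
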